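(* Let $Q$ be the transition kernel on $E\cup\{\partial\}$ of a Markov process absorbed at $\partial\notin E$ (i.e. $Q(\partial,\{\partial\})=1$) such that there exist a probability measure $\zeta$ on $E$, a positive function $g:E\to(0,+\infty)$ and a constant $C>1$ with $$g(y)\zeta(A)\le Q(y,A)\le C\,g(y)\zeta(A)\qquad\text{for all }y\in E\text{ and all measurable }A\subset E.$$ Let $p:E\times E\to(0,1]$ be measurable and let $X$ be the Markov process in $E\cup\{\partial\}$, absorbed at $\partial$, with transition kernel $P$ given for $x\in E$ and measurable $A\subset E$ by $P(x,A)=\int_Ap(x,y)\,Q(x,\mathrm dy)$, $P(x,\{\partial\})=1-P(x,E)$, and $P(\partial,\cdot)=\delta_\partial$. Assume that there exists an increasing sequence $(L_k)_{k\ge1}$ of measurable subsets of $E$ such that $E=\bigcup_{k=1}^{+\infty}L_k$ and $\inf_{x,y\in L_k}p(x,y)>0$ for all $k\ge1$. Then $X$ satisfies Assumption (E) (defined in the context) with $\varphi_1=1$ and $\varphi_2$ positive on $E$. In particular, $X$ admits a unique quasi-stationary distribution, whose domain of attraction contains all probability measures on $E$.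
   Context: $E$ is a measurable space. For the discrete-time process $(X_n)_{n\in\mathbb{Z}_+}$ with law $\mathbb{P}_x$ started from $x$, $\tau_\partial=\inf\{n\in\mathbb{Z}_+:X_n=\partial\}$ and $P_1f(x)=\mathbb{E}_x(f(X_1)\mathbf{1}_{1<\tau_\partial})$. Assumption (E). There exist a positive integer $n_1$, positive real constants $\theta_1,\theta_2,c_1,c_2,c_3$, two measurable functions $\varphi_1,\varphi_2:E\to\mathbb{R}_+$ and a probability measure $\nu$ on a measurable subset $K\subset E$ such that: - (E1) for all $x\in K$, $\mathbb{P}_x(X_{n_1}\in\cdot)\ge c_1\nu(\cdot\cap K)$. - (E2) $\theta_1<\theta_2$, $\inf_E\varphi_1\ge1$, $\sup_K\varphi_1<\infty$, $\inf_K\varphi_2>0$, $\sup_E\varphi_2\le1$, and for all $x\in E$, $P_1\varphi_1(x)\le\theta_1\varphi_1(x)+c_2\mathbf{1}_K(x)$ and $P_1\varphi_2(x)\ge\theta_2\varphi_2(x)$. - (E3) $\displaystyle\sup_{n\in\mathbb{Z}_+}\frac{\sup_{y\in K}\mathbb{P}_y(n<\tau_\partial)}{\inf_{y\in K}\mathbb{P}_y(n<\tau_\partial)}\le c_3$. - (E4) for all $x\in K$ there exists $n_4(x)$ such that $\mathbb{P}_x(X_n\in K)>0$ for all $n\ge n_4(x)$. A quasi-stationary distribution is a probability measure $\nu'$ on $E$ with $\mathbb{P}_{\nu'}(X_n\in\cdot\mid n<\tau_\partial)=\nu'$ for all $n\in\mathbb{Z}_+$; its domain of attraction is the set of probability measures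 $\mu$ on $E$ such that $\mathbb{P}_\mu(X_n\in\cdot\mid n<\tau_\partial)\to\nu'$ in total variation as $n\to+\infty$. *)

theory Defs
  imports "HOL-Probability.Probability"
begin

text \<open>
  A measurable space \<open>E\<close> is given by a measure \<open>M\<close> of which only \<open>space M\<close> and \<open>sets M\<close> are used.
  The state space \<open>E \<union> {\<partial>}\<close> is modelled on the option type: \<open>Some x\<close> is the point \<open>x\<close> of \<open>E\<close> and
  \<open>None\<close> is the cemetery point. Since \<open>{None}\<close> is the complement of \<open>Some ` space M\<close>, it is
  measurable.
\<close>

definition with_cemetery :: "'a measure \<Rightarrow> 'a option measure" where
  "with_cemetery M = sigma (insert None (Some ` space M)) ((`) Some ` sets M)"

text \<open>
  The law of the discrete-time Markov process with transition kernel \<open>P\<close> on the measurable space \<open>S\<close>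
  and initial law \<open>\<mu>\<close>, on the path space \<open>PiM UNIV (\<lambda>_. S)\<close>, by the Ionescu-Tulcea theorem. The
  process itself is the coordinate process: the state at time \<open>n\<close> of the path \<open>\<omega>\<close> is \<open>\<omega> n\<close>.
\<close>

definition markov_step ::
    "('s \<Rightarrow> 's measure) \<Rightarrow> 's measure \<Rightarrow> nat \<Rightarrow> (nat \<Rightarrow> 's) \<Rightarrow> 's measure" where
  "markov_step P \<mu> i \<omega> = (case i of 0 \<Rightarrow> \<mu> | Suc n \<Rightarrow> P (\<omega> n))"

definition markov_law ::
    "'s measure \<Rightarrow> ('s \<Rightarrow> 's measure) \<Rightarrow> 's measure \<Rightarrow> (nat \<Rightarrow> 's) measure" where
  "markov_law S P \<mu> =
     projective_family.lim UNIV (Ionescu_Tulcea.CI (markov_step P \<mu>) (\<lambda>_. S)) (\<lambda>_. S)"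

definition absorption_time :: "(nat \<Rightarrow> 'a option) \<Rightarrow> enat" where
  "absorption_time \<omega> = (INF n\<in>{n. \<omega> n = None}. enat n)"

text \<open>The laws \<open>\<P>\<^sub>\<mu>\<close> (for \<open>\<mu>\<close> a probability measure on \<open>E\<close>) and \<open>\<P>\<^sub>x\<close> (for \<open>x \<in> E\<close>).\<close>

definition law_init ::
    "'a measure \<Rightarrow> ('a option \<Rightarrow> 'a option measure) \<Rightarrow> 'a measure \<Rightarrow> (nat \<Rightarrow> 'a option) measure" where
  "law_init M P \<mu> = markov_law (with_cemetery M) P (distr \<mu> (with_cemetery M) Some)"

definition law_at ::
    "'a measure \<Rightarrow> ('a option \<Rightarrow> 'a option measure) \<Rightarrow> 'a \<Rightarrow> (nat \<Rightarrow> 'a option) measure" where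
  "law_at M P x = markov_law (with_cemetery M) P (return (with_cemetery M) (Some x))"

definition hit_prob ::
    "'a measure \<Rightarrow> ('a option \<Rightarrow> 'a option measure) \<Rightarrow> 'a \<Rightarrow> nat \<Rightarrow> 'a set \<Rightarrow> ennreal" where
  "hit_prob M P x n A =
     emeasure (law_at M P x) {\<omega> \<in> space (law_at M P x). \<omega> n \<in> Some ` A}"

definition survival_prob ::
    "'a measure \<Rightarrow> ('a option \<Rightarrow> 'a option measure) \<Rightarrow> 'a \<Rightarrow> nat \<Rightarrow> ennreal" where
  "survival_prob M P x n =
     emeasure (law_at M P x) {\<omega> \<in> space (law_at M P x). enat n < absorption_time \<omega>}"

text \<open>The operator \<open>P\<^sub>1 f(x) = \<E>\<^sub>x(f(X\<^sub>1) 1\<^bsub>1 < \<tau>\<^esub>)\<close> on nonnegative functions.\<close>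

definition P1_op ::
    "'a measure \<Rightarrow> ('a option \<Rightarrow> 'a option measure) \<Rightarrow> ('a \<Rightarrow> real) \<Rightarrow> 'a \<Rightarrow> ennreal" where
  "P1_op M P f x =
     (\<integral>\<^sup>+\<omega>. (if 1 < absorption_time \<omega> then ennreal (f (the (\<omega> 1))) else 0) \<partial>law_at M P x)"

text \<open>
  All suprema and infima below are taken in \<^typ>\<open>ennreal\<close>, so they always exist. In the third
  condition the denominator is never zero when the second one holds, because
  \<open>\<P>\<^sub>x(n < \<tau>) \<ge> \<theta>\<^sub>2\<^sup>n \<phi>\<^sub>2(x)\<close>; so the value \<open>0 / 0 = 0\<close> in \<^typ>\<open>ennreal\<close> plays no role.
\<close>

definition assumption_E1 ::
    "'a measure \<Rightarrow> ('a option \<Rightarrow> 'a option measure) \<Rightarrow> nat \<Rightarrow> real \<Rightarrow> 'a measure \<Rightarrow> 'a set \<Rightarrow> bool" where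
  "assumption_E1 M P n1 c1 \<nu> K \<longleftrightarrow>
     (\<forall>x\<in>K. \<forall>A\<in>sets M. ennreal c1 * emeasure \<nu> (A \<inter> K) \<le> hit_prob M P x n1 A)"

definition assumption_E2 ::
    "'a measure \<Rightarrow> ('a option \<Rightarrow> 'a option measure) \<Rightarrow> real \<Rightarrow> real \<Rightarrow> real \<Rightarrow>
     ('a \<Rightarrow> real) \<Rightarrow> ('a \<Rightarrow> real) \<Rightarrow> 'a set \<Rightarrow> bool" where
  "assumption_E2 M P \<theta>1 \<theta>2 c2 \<phi>1 \<phi>2 K \<longleftrightarrow>
     \<theta>1 < \<theta>2 \<and>
     1 \<le> (INF x\<in>space M. ennreal (\<phi>1 x)) \<and> (SUP x\<in>K. ennreal (\<phi>1 x)) < \<infinity> \<and>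
     0 < (INF x\<in>K. ennreal (\<phi>2 x)) \<and> (SUP x\<in>space M. ennreal (\<phi>2 x)) \<le> 1 \<and>
     (\<forall>x\<in>space M. P1_op M P \<phi>1 x \<le> ennreal (\<theta>1 * \<phi>1 x) + ennreal c2 * indicator K x) \<and>
     (\<forall>x\<in>space M. ennreal (\<theta>2 * \<phi>2 x) \<le> P1_op M P \<phi>2 x)"

definition assumption_E3 ::
    "'a measure \<Rightarrow> ('a option \<Rightarrow> 'a option measure) \<Rightarrow> real \<Rightarrow> 'a set \<Rightarrow> bool" where
  "assumption_E3 M P c3 K \<longleftrightarrow>
     (SUP n. (SUP y\<in>K. survival_prob M P y n) / (INF y\<in>K. survival_prob M P y n)) \<le> ennreal c3"

definition assumption_E4 ::
    "'a measure \<Rightarrow> ('a option \<Rightarrow> 'a option measure) \<Rightarrow> 'a set \<Rightarrow> bool" where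
  "assumption_E4 M P K \<longleftrightarrow> (\<forall>x\<in>K. \<exists>n4. \<forall>n\<ge>n4. 0 < hit_prob M P x n K)"

text \<open>Assumption (E), with the functions \<open>\<phi>\<^sub>1\<close> and \<open>\<phi>\<^sub>2\<close> displayed.\<close>

definition assumption_E ::
    "'a measure \<Rightarrow> ('a option \<Rightarrow> 'a option measure) \<Rightarrow> ('a \<Rightarrow> real) \<Rightarrow> ('a \<Rightarrow> real) \<Rightarrow> bool" where
  "assumption_E M P \<phi>1 \<phi>2 \<longleftrightarrow>
     \<phi>1 \<in> borel_measurable M \<and> (\<forall>x\<in>space M. 0 \<le> \<phi>1 x) \<and>
     \<phi>2 \<in> borel_measurable M \<and> (\<forall>x\<in>space M. 0 \<le> \<phi>2 x) \<and>
     (\<exists>n1 \<theta>1 \<theta>2 c1 c2 c3 K \<nu>.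
        0 < n1 \<and> 0 < \<theta>1 \<and> 0 < \<theta>2 \<and> 0 < c1 \<and> 0 < c2 \<and> 0 < c3 \<and>
        K \<in> sets M \<and> \<nu> \<in> space (prob_algebra (restrict_space M K)) \<and>
        assumption_E1 M P n1 c1 \<nu> K \<and>
        assumption_E2 M P \<theta>1 \<theta>2 c2 \<phi>1 \<phi>2 K \<and>
        assumption_E3 M P c3 K \<and>
        assumption_E4 M P K)"

text \<open>
  \<open>\<P>\<^sub>\<mu>(X\<^sub>n \<in> A | n < \<tau>)\<close>. If \<open>\<P>\<^sub>\<mu>(n < \<tau>) = 0\<close> this is \<open>0\<close> for every \<open>A\<close>, which is at
  total variation distance \<open>1\<close> from every probability measure on \<open>E\<close>; hence being quasi-stationary
  entails \<open>\<P>\<^bsub>\<nu>\<^esub>(n < \<tau>) > 0\<close> for all \<open>n\<close>, and lying in a domain of attraction entails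
  \<open>\<P>\<^sub>\<mu>(n < \<tau>) > 0\<close> for all \<open>n\<close>.
\<close>

definition cond_law ::
    "'a measure \<Rightarrow> ('a option \<Rightarrow> 'a option measure) \<Rightarrow> 'a measure \<Rightarrow> nat \<Rightarrow> 'a set \<Rightarrow> real" where
  "cond_law M P \<mu> n A =
     \<P>(\<omega> in law_init M P \<mu>. \<omega> n \<in> Some ` A \<bar> enat n < absorption_time \<omega>)"

definition quasi_stationary ::
    "'a measure \<Rightarrow> ('a option \<Rightarrow> 'a option measure) \<Rightarrow> 'a measure \<Rightarrow> bool" where
  "quasi_stationary M P \<nu> \<longleftrightarrow>
     \<nu> \<in> space (prob_algebra M) \<and> (\<forall>n. \<forall>A\<in>sets M. cond_law M P \<nu> n A = measure \<nu> A)"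

definition tv_dist :: "'a measure \<Rightarrow> ('a set \<Rightarrow> real) \<Rightarrow> ('a set \<Rightarrow> real) \<Rightarrow> real" where
  "tv_dist M \<mu> \<nu> = (SUP A\<in>sets M. \<bar>\<mu> A - \<nu> A\<bar>)"

definition domain_of_attraction ::
    "'a measure \<Rightarrow> ('a option \<Rightarrow> 'a option measure) \<Rightarrow> 'a measure \<Rightarrow> 'a measure set" where
  "domain_of_attraction M P \<nu> =
     {\<mu> \<in> space (prob_algebra M).
        (\<lambda>n. tv_dist M (cond_law M P \<mu> n) (measure \<nu>)) \<longlonglongrightarrow> 0}"

lemma space_with_cemetery: "space (with_cemetery M) = insert None (Some ` space M)"
  unfolding with_cemetery_def
  by (rule space_measure_of) (use sets.sets_into_space in blast)

lemma Some_image_sets_with_cemetery: "A \<in> sets M \<Longrightarrow> Some ` A \<in> sets (with_cemetery M)"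
  unfolding with_cemetery_def
  by (subst sets_measure_of) (use sets.sets_into_space in blast)+

lemma None_sets_with_cemetery: "{None} \<in> sets (with_cemetery M)"
proof -
  have "{None} = space (with_cemetery M) - Some ` space M"
    by (auto simp: space_with_cemetery)
  then show ?thesis
    by (metis Some_image_sets_with_cemetery sets.compl_sets sets.top)
qed

lemma Some_measurable_with_cemetery: "Some \<in> M \<rightarrow>\<^sub>M with_cemetery M"
  unfolding with_cemetery_def
  by (rule measurable_measure_of)
     (use sets.sets_into_space in \<open>auto simp: inj_vimage_image_eq\<close>)

lemma Ionescu_Tulcea_markov_step:
  assumes P: "P \<in> S \<rightarrow>\<^sub>M prob_algebra S" and \<mu>: "\<mu> \<in> space (prob_algebra S)"
  shows "Ionescu_Tulcea (markov_step P \<mu>) (\<lambda>_. S)"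
proof -
  have *: "markov_step P \<mu> i \<in> PiM {0..<i} (\<lambda>_. S) \<rightarrow>\<^sub>M prob_algebra S" for i
  proof (cases i)
    case 0
    then show ?thesis using \<mu> by (simp add: markov_step_def[abs_def])
  next
    case (Suc n)
    have "(\<lambda>\<omega>. P (\<omega> n)) \<in> PiM {0..<i} (\<lambda>_. S) \<rightarrow>\<^sub>M prob_algebra S"
      by (rule measurable_compose[OF measurable_component_singleton[of n] P]) (simp add: Suc)
    then show ?thesis by (simp add: markov_step_def[abs_def] Suc)
  qed
  show ?thesis
  proof (rule Ionescu_Tulcea.intro)
    show "markov_step P \<mu> i \<in> PiM {0..<i} (\<lambda>_. S) \<rightarrow>\<^sub>M subprob_algebra S" for i
      by (rule measurable_prob_algebraD[OF *])
    show "prob_space (markov_step P \<mu> i \<omega>)" if "\<omega> \<in> space (PiM {0..<i} (\<lambda>_. S))" for i \<omega>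
      using measurable_space[OF * that] by (simp add: space_prob_algebra)
  qed
qed

lemma sets_markov_law:
  assumes "P \<in> S \<rightarrow>\<^sub>M prob_algebra S" "\<mu> \<in> space (prob_algebra S)"
  shows "sets (markov_law S P \<mu>) = sets (PiM UNIV (\<lambda>_. S))"
proof -
  interpret Ionescu_Tulcea "markov_step P \<mu>" "\<lambda>_. S"
    by (rule Ionescu_Tulcea_markov_step[OF assms])
  show ?thesis by (simp add: markov_law_def)
qed

text \<open>The joint law of \<open>(X\<^sub>0, \<dots>, X\<^sub>n)\<close> is the one prescribed by the initial law and the kernel.\<close>

lemma markov_law_initial_segment:
  assumes P: "P \<in> S \<rightarrow>\<^sub>M prob_algebra S" and \<mu>: "\<mu> \<in> space (prob_algebra S)"
  defines "D \<equiv> \<lambda>n. distr (markov_law S P \<mu>) (PiM {0..<n} (\<lambda>_. S)) (\<lambda>\<omega>. restrict \<omega> {0..<n})"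
  shows "D 0 = return (PiM {0..<0} (\<lambda>_. S)) (\<lambda>_. undefined)"
    and "D (Suc n) = D n \<bind> (\<lambda>\<omega>. distr (case n of 0 \<Rightarrow> \<mu> | Suc m \<Rightarrow> P (\<omega> m))
           (PiM {0..<Suc n} (\<lambda>_. S)) (fun_upd \<omega> n))"
proof -
  interpret Ionescu_Tulcea "markov_step P \<mu>" "\<lambda>_. S"
    by (rule Ionescu_Tulcea_markov_step[OF P \<mu>])
  have undef: "(\<lambda>_. undefined) \<in> space (PiM {0..<0::nat} (\<lambda>_. S))"
    by (simp add: space_PiM)
  have D: "D k = C 0 k (\<lambda>_. undefined)" for k
  proof -
    have up: "up_to {0..<k} = k"
    proof (rule antisym)
      show "up_to {0..<k} \<le> k"
        unfolding up_to_def by (rule Least_le) auto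
      have "{0..<k} \<subseteq> {0..<up_to {0..<k}}" by (rule up_to) simp
      then show "k \<le> up_to {0..<k}" by (cases k) auto
    qed
    have sp: "space (C 0 k (\<lambda>_. undefined)) = space (PiM {0..<k} (\<lambda>_. S))"
      and se: "sets (C 0 k (\<lambda>_. undefined)) = sets (PiM {0..<k} (\<lambda>_. S))"
      using space_C[OF undef, of k] sets_C[OF undef, of k] by auto
    have "D k = CI {0..<k}"
      unfolding D_def markov_law_def by (rule distr_lim) simp
    also have "\<dots> = distr (C 0 k (\<lambda>_. undefined)) (PiM {0..<k} (\<lambda>_. S)) (\<lambda>\<omega>. restrict \<omega> {0..<k})"
      by (simp add: CI_def up)
    also have "\<dots> = distr (C 0 k (\<lambda>_. undefined)) (PiM {0..<k} (\<lambda>_. S)) (\<lambda>\<omega>. \<omega>)"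
      by (rule distr_cong) (auto simp: sp space_PiM PiE_def extensional_restrict)
    also have "\<dots> = C 0 k (\<lambda>_. undefined)"
      by (rule distr_id2) (simp add: se)
    finally show ?thesis .
  qed
  show "D 0 = return (PiM {0..<0} (\<lambda>_. S)) (\<lambda>_. undefined)"
    by (simp add: D)
  have "D (Suc n) = D n \<bind> eP n" by (simp add: D)
  then show "D (Suc n) = D n \<bind> (\<lambda>\<omega>. distr (case n of 0 \<Rightarrow> \<mu> | Suc m \<Rightarrow> P (\<omega> m))
           (PiM {0..<Suc n} (\<lambda>_. S)) (fun_upd \<omega> n))"
    by (simp add: eP_def[abs_def] markov_step_def)
qed

end

theory Submission
  imports Defs
begin

text \<open>
  Let \<open>T f(x) = \<E>\<^sub>x(f(X\<^sub>1); 1 < \<tau>)\<close>. The hypotheses on \<open>Q\<close> and \<open>p\<close> amount to two facts. Globally,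
  \<open>T f \<le> C \<integral> f d\<zeta>\<close>, because \<open>g \<le> Q(\<cdot>, E) \<le> 1\<close>. On \<open>A\<^sub>k\<close>, the part of some \<open>L\<^sub>j\<close> where \<open>Q(\<cdot>, E)\<close> is
  bounded below, \<open>T f \<ge> a\<^sub>k \<integral> 1\<^bsub>A k\<^esub> f d\<zeta>\<close>; the sets \<open>A\<^sub>k\<close> increase to \<open>E\<close>.

  A core \<open>A\<^sub>b\<close> with \<open>\<zeta>(A\<^sub>b) > 0\<close> guarantees that mass keeps at least the factor \<open>\<beta> = a\<^sub>b \<zeta>(A\<^sub>b)\<close> per step, while by the
  upper bound one step puts only the fraction \<open>C \<zeta>(E - A\<^sub>m)\<close> of the mass outside \<open>A\<^sub>m\<close>. For \<open>m\<close> large this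
  fraction is at most \<open>\<beta> / 4\<close>: what leaves \<open>A\<^sub>m\<close> is lost faster than what stays. This gives invariant cones, one
  of laws (\<open>good_T\<close>), entered sooner or later by every law (\<open>eventually_good\<close>), and one of functions, which
  contains all survival probabilities (\<open>expectation_surv_le\<close>).

  A law of the cone, conditioned on surviving to a remote horizon, is found at an intermediate time outside
  a large set \<open>A\<^sub>l\<close> with probability at most \<open>\<epsilon>\<close> (\<open>good_outside\<close>). Inside \<open>A\<^sub>l\<close> two such laws have a common part
  after one step, which may be subtracted from both (\<open>coupling_step\<close>). The remaining weight \<open>y\<close> satisfies
  \<open>y' - \<epsilon> \<le> (1 - \<delta>) (y - \<epsilon>)\<close> with \<open>\<delta>\<close> depending on \<open>\<epsilon>\<close>, and it bounds the distance of the two conditioned laws.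
  So conditioned laws from the cone merge uniformly (\<open>good_profiles_merge\<close>). Applied to the iterates of one law
  this is the Cauchy property and yields a quasi-stationary distribution; applied to two laws it yields
  uniqueness and attraction of every initial law.

  Assumption (E) follows from the same estimates, with \<open>K = {T 1 \<ge> \<beta> / 2}\<close>, \<open>\<theta>\<^sub>1 = \<beta> / 2\<close>, \<open>\<theta>\<^sub>2 = \<beta>\<close>, \<open>n\<^sub>1 = 2\<close>, \<open>\<nu>\<close> the law \<open>\<zeta>\<close>
  conditioned on the core, and \<open>\<phi>\<^sub>2 = T\<^sup>2 1\<^bsub>A b\<^esub>\<close>. From \<open>K\<close>, a mass of at least \<open>\<beta> / 4\<close> stays in \<open>A\<^sub>m\<close> and is minorized
  in the next step (\<open>K_two_steps\<close>); this is (E1), the lower bound of \<open>\<phi>\<^sub>2\<close> on \<open>K\<close> in (E2), and, with the cone of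
  functions, (E3).
\<close>

section \<open>Bounded functions and positive functionals\<close>

text \<open>
  All operators below are compared on bounded measurable real functions, and finite measures are
  replaced by the positive functionals \<open>f \<mapsto> \<integral> f d\<mu>\<close>: the coupling subtracts one measure from another,
  which is a harmless operation on functionals and an awkward one on measures.
\<close>

definition bfun :: "'a measure \<Rightarrow> ('a \<Rightarrow> real) set" where
  "bfun M = {f \<in> borel_measurable M. \<exists>b. \<forall>x\<in>space M. \<bar>f x\<bar> \<le> b}"

lemma bfunI: "f \<in> borel_measurable M \<Longrightarrow> (\<And>x. x \<in> space M \<Longrightarrow> \<bar>f x\<bar> \<le> b) \<Longrightarrow> f \<in> bfun M"
  by (auto simp: bfun_def)

lemma bfun_measurable[measurable_dest]: "f \<in> bfun M \<Longrightarrow> f \<in> borel_measurable M"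
  by (simp add: bfun_def)

lemma bfun_const[simp, intro]: "(\<lambda>_. c) \<in> bfun M"
  by (rule bfunI[of _ _ "\<bar>c\<bar>"]) auto

lemma bfun_indicator[intro]: "S \<in> sets M \<Longrightarrow> indicat_real S \<in> bfun M"
  by (rule bfunI[of _ _ 1]) (auto simp: indicator_def)

lemma bfun_add[intro]:
  assumes "f \<in> bfun M" "g \<in> bfun M" shows "(\<lambda>x. f x + g x) \<in> bfun M"
proof -
  obtain b c where "\<forall>x\<in>space M. \<bar>f x\<bar> \<le> b" "\<forall>x\<in>space M. \<bar>g x\<bar> \<le> c"
    using assms by (auto simp: bfun_def)
  then show ?thesis using assms[THEN bfun_measurable]
    by (intro bfunI[of _ _ "b + c"]) (auto intro: order_trans[OF abs_triangle_ineq] add_mono)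
qed

lemma bfun_mult[intro]:
  assumes "f \<in> bfun M" "g \<in> bfun M" shows "(\<lambda>x. f x * g x) \<in> bfun M"
proof -
  obtain b c where "\<forall>x\<in>space M. \<bar>f x\<bar> \<le> b" "\<forall>x\<in>space M. \<bar>g x\<bar> \<le> c"
    using assms by (auto simp: bfun_def)
  then show ?thesis using assms[THEN bfun_measurable]
    by (intro bfunI[of _ _ "b * c"]) (auto simp: abs_mult intro!: mult_mono intro: order_trans[OF abs_ge_zero])
qed

lemma bfun_cmult[intro]: "f \<in> bfun M \<Longrightarrow> (\<lambda>x. c * f x) \<in> bfun M"
  by (rule bfun_mult) auto

lemma bfun_diff[intro]: "f \<in> bfun M \<Longrightarrow> g \<in> bfun M \<Longrightarrow> (\<lambda>x. f x - g x) \<in> bfun M"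
  using bfun_add[of f M "\<lambda>x. - 1 * g x"] bfun_cmult[of g M "- 1"] by simp

lemma bfun_integrable:
  assumes "finite_measure \<mu>" "f \<in> bfun M" "sets \<mu> = sets M"
  shows "integrable \<mu> f"
proof -
  interpret finite_measure \<mu> by fact
  obtain b where b: "\<forall>x\<in>space M. \<bar>f x\<bar> \<le> b" using assms by (auto simp: bfun_def)
  have "f \<in> borel_measurable \<mu>" using assms(2,3) by (simp add: bfun_def cong: measurable_cong_sets)
  then show ?thesis
    using b sets_eq_imp_space_eq[OF assms(3)]
    by (intro integrable_const_bound[of _ b]) (auto intro!: AE_I2)
qed

definition positive_functional :: "'a measure \<Rightarrow> (('a \<Rightarrow> real) \<Rightarrow> real) \<Rightarrow> bool" where
  "positive_functional M I \<longleftrightarrow>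
     (\<forall>f\<in>bfun M. \<forall>g\<in>bfun M. I (\<lambda>x. f x + g x) = I f + I g) \<and>
     (\<forall>c. \<forall>f\<in>bfun M. I (\<lambda>x. c * f x) = c * I f) \<and>
     (\<forall>f\<in>bfun M. (\<forall>x\<in>space M. 0 \<le> f x) \<longrightarrow> 0 \<le> I f)"

lemma positive_functional_add:
  "positive_functional M I \<Longrightarrow> f \<in> bfun M \<Longrightarrow> g \<in> bfun M \<Longrightarrow> I (\<lambda>x. f x + g x) = I f + I g"
  by (simp add: positive_functional_def)

lemma positive_functional_cmult:
  "positive_functional M I \<Longrightarrow> f \<in> bfun M \<Longrightarrow> I (\<lambda>x. c * f x) = c * I f"
  by (simp add: positive_functional_def)

lemma positive_functional_nonneg:
  "positive_functional M I \<Longrightarrow> f \<in> bfun M \<Longrightarrow> (\<And>x. x \<in> space M \<Longrightarrow> 0 \<le> f x) \<Longrightarrow> 0 \<le> I f"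
  by (simp add: positive_functional_def)

lemma positive_functional_diff:
  assumes "positive_functional M I" "f \<in> bfun M" "g \<in> bfun M"
  shows "I (\<lambda>x. f x - g x) = I f - I g"
  using positive_functional_add[OF assms(1,2) bfun_cmult[OF assms(3), of "- 1"]]
    positive_functional_cmult[OF assms(1,3), of "- 1"] by simp

lemma positive_functional_mono:
  assumes "positive_functional M I" "f \<in> bfun M" "g \<in> bfun M" "\<And>x. x \<in> space M \<Longrightarrow> f x \<le> g x"
  shows "I f \<le> I g"
  using positive_functional_nonneg[OF assms(1) bfun_diff[OF assms(3,2)]]
    positive_functional_diff[OF assms(1,3,2)] assms(4) by simp

lemma positive_functional_cong:
  assumes "positive_functional M I" "f \<in> bfun M" "g \<in> bfun M" "\<And>x. x \<in> space M \<Longrightarrow> f x = g x"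
  shows "I f = I g"
  using positive_functional_mono[OF assms(1,2,3)] positive_functional_mono[OF assms(1,3,2)] assms(4)
  by (intro antisym) auto

lemma positive_functional_const:
  "positive_functional M I \<Longrightarrow> I (\<lambda>_. c) = c * I (\<lambda>_. 1)"
  using positive_functional_cmult[of M I "\<lambda>_. 1" c] by simp

lemma positive_functional_split:
  assumes "positive_functional M I" "f \<in> bfun M" "S \<in> sets M"
  shows "I f = I (\<lambda>x. indicator S x * f x) + I (\<lambda>x. indicator (space M - S) x * f x)"
proof -
  have S: "space M - S \<in> sets M" using assms(3) by auto
  have b: "(\<lambda>x. indicator S x * f x) \<in> bfun M" "(\<lambda>x. indicator (space M - S) x * f x) \<in> bfun M"
    using assms S by auto
  have "I f = I (\<lambda>x. indicator S x * f x + indicator (space M - S) x * f x)"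
    by (rule positive_functional_cong[OF assms(1,2) bfun_add[OF b]]) (auto simp: indicator_def)
  then show ?thesis by (simp add: positive_functional_add[OF assms(1) b])
qed

lemma positive_functional_integral:
  assumes "finite_measure \<mu>" "sets \<mu> = sets M"
  shows "positive_functional M (\<lambda>f. \<integral>x. f x \<partial>\<mu>)"
  using bfun_integrable[OF assms(1) _ assms(2)] sets_eq_imp_space_eq[OF assms(2)]
  by (auto simp: positive_functional_def intro!: integral_nonneg_AE AE_I2)

lemma integral_le_of_emeasure_le:
  assumes "finite_measure \<mu>" "finite_measure \<nu>" and s: "sets \<mu> = sets \<nu>"
    and le: "\<And>S. S \<in> sets \<mu> \<Longrightarrow> emeasure \<mu> S \<le> emeasure \<nu> S"
    and f: "f \<in> bfun \<mu>" "\<And>x. x \<in> space \<mu> \<Longrightarrow> 0 \<le> f x"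
  shows "(\<integral>x. f x \<partial>\<mu>) \<le> (\<integral>x. f x \<partial>\<nu>)"
proof -
  have sp: "space \<mu> = space \<nu>" by (rule sets_eq_imp_space_eq[OF s])
  have int: "integrable \<mu> f" "integrable \<nu> f"
    using assms by (auto intro!: bfun_integrable[of _ f \<mu>])
  have "\<mu> \<le> \<nu>" using le by (simp add: le_measure[OF s])
  then have "(\<integral>\<^sup>+x. ennreal (f x) \<partial>\<mu>) \<le> (\<integral>\<^sup>+x. ennreal (f x) \<partial>\<nu>)"
    by (rule nn_integral_mono_measure[OF s])
  then show ?thesis
    using f(2) sp int
    by (subst (asm) (1 2) nn_integral_eq_integral) (auto intro!: AE_I2 integral_nonneg_AE simp: ennreal_le_iff)
qed

lemma integral_scale_measure:
  assumes \<mu>: "finite_measure \<mu>" and f: "f \<in> bfun \<mu>" "\<And>x. x \<in> space \<mu> \<Longrightarrow> 0 \<le> f x" and r: "0 \<le> r"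
  shows "(\<integral>x. f x \<partial>scale_measure (ennreal r) \<mu>) = r * (\<integral>x. f x \<partial>\<mu>)"
proof -
  interpret finite_measure \<mu> by fact
  have fin: "finite_measure (scale_measure (ennreal r) \<mu>)"
    by (rule finite_measureI) (simp add: ennreal_mult_eq_top_iff)
  have [measurable]: "f \<in> borel_measurable \<mu>" by (rule bfun_measurable[OF f(1)])
  have "ennreal (\<integral>x. f x \<partial>scale_measure (ennreal r) \<mu>) = (\<integral>\<^sup>+x. ennreal (f x) \<partial>scale_measure (ennreal r) \<mu>)"
    using f by (intro nn_integral_eq_integral[symmetric] bfun_integrable[OF fin]) (auto intro!: AE_I2 simp: space_scale_measure)
  also have "\<dots> = ennreal r * (\<integral>\<^sup>+x. ennreal (f x) \<partial>\<mu>)" by (simp add: nn_integral_scale_measure)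
  also have "(\<integral>\<^sup>+x. ennreal (f x) \<partial>\<mu>) = ennreal (\<integral>x. f x \<partial>\<mu>)"
    using f by (intro nn_integral_eq_integral bfun_integrable[OF \<mu>]) (auto intro!: AE_I2)
  also have "ennreal r * ennreal (\<integral>x. f x \<partial>\<mu>) = ennreal (r * (\<integral>x. f x \<partial>\<mu>))"
    using r by (simp add: ennreal_mult')
  finally show ?thesis
    using f r by (subst (asm) ennreal_inj) (auto intro!: integral_nonneg_AE AE_I2 mult_nonneg_nonneg simp: space_scale_measure)
qed

lemma bfun_cong_sets:
  assumes "sets M = sets N" shows "bfun M = bfun N"
  using sets_eq_imp_space_eq[OF assms] assms by (simp add: bfun_def cong: measurable_cong_sets)

lemma positive_functional_cong_sets:
  assumes "sets M = sets N" shows "positive_functional M = positive_functional N"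
  by (simp add: positive_functional_def fun_eq_iff bfun_cong_sets[OF assms] sets_eq_imp_space_eq[OF assms])

text \<open>
  Domination by a measure supplies the continuity from above that countable additivity needs, so no
  Daniell condition has to be imposed on \<open>J\<close>. Monotone limits are carried over by applying the
  domination to the difference \<open>f - U i\<close>.
\<close>

lemma positive_functional_representation:
  assumes \<zeta>: "finite_measure \<zeta>" and J: "positive_functional \<zeta> J"
    and dom: "\<And>f. f \<in> bfun \<zeta> \<Longrightarrow> (\<And>x. x \<in> space \<zeta> \<Longrightarrow> 0 \<le> f x) \<Longrightarrow> J f \<le> c * (\<integral>x. f x \<partial>\<zeta>)"
  shows "\<exists>\<alpha>. sets \<alpha> = sets \<zeta> \<and> finite_measure \<alpha> \<and> (\<forall>f\<in>bfun \<zeta>. J f = (\<integral>x. f x \<partial>\<alpha>))"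
proof -
  interpret finite_measure \<zeta> by fact
  define F where "F S = ennreal (J (indicator S))" for S
  define \<alpha> where "\<alpha> = measure_of (space \<zeta>) (sets \<zeta>) F"
  have ind_nonneg: "0 \<le> J (indicator S)" if "S \<in> sets \<zeta>" for S
    using that by (intro positive_functional_nonneg[OF J]) auto
  have J_zero: "J (\<lambda>_. 0) = 0" using positive_functional_const[OF J, of 0] by simp
  have ca: "countably_additive (sets \<zeta>) F"
  proof (rule sets.empty_continuous_imp_countably_additive)
    show "positive (sets \<zeta>) F"
      using J_zero by (auto simp: positive_def F_def indicator_def[abs_def])
    show "additive (sets \<zeta>) F"
    proof (unfold additive_def, intro ballI impI)
      fix X Y assume XY: "X \<in> sets \<zeta>" "Y \<in> sets \<zeta>" "X \<inter> Y = {}"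
      have "J (indicator (X \<union> Y)) = J (\<lambda>x. indicator X x + indicator Y x)"
        using XY by (intro positive_functional_cong[OF J] bfun_add bfun_indicator)
          (auto simp: indicator_def)
      also have "\<dots> = J (indicator X) + J (indicator Y)"
        using XY by (intro positive_functional_add[OF J]) auto
      finally show "F (X \<union> Y) = F X + F Y"
        using XY ind_nonneg by (simp add: F_def)
    qed
    show "\<forall>S\<in>sets \<zeta>. F S \<noteq> \<infinity>" by (simp add: F_def)
    fix S :: "nat \<Rightarrow> 'a set" assume S: "range S \<subseteq> sets \<zeta>" "decseq S" "(\<Inter>i. S i) = {}"
    have le: "J (indicator (S i)) \<le> c * measure \<zeta> (S i)" for i
      using dom[of "indicator (S i)"] S(1) by (auto simp: Int_absorb1 sets.sets_into_space)
    have "(\<lambda>i. measure \<zeta> (S i)) \<longlonglongrightarrow> measure \<zeta> (\<Inter>i. S i)"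
      by (rule finite_Lim_measure_decseq[OF S(1,2)])
    then have "(\<lambda>i. c * measure \<zeta> (S i)) \<longlonglongrightarrow> 0"
      using S(3) by (auto intro: tendsto_mult_right_zero)
    have "(\<lambda>i. J (indicator (S i))) \<longlonglongrightarrow> 0"
      by (rule tendsto_sandwich[OF _ _ tendsto_const \<open>(\<lambda>i. c * measure \<zeta> (S i)) \<longlonglongrightarrow> 0\<close>]) (use le ind_nonneg S(1) in auto)
    then show "(\<lambda>i. F (S i)) \<longlonglongrightarrow> 0"
      unfolding F_def using tendsto_ennrealI by fastforce
  qed
  have s: "sets \<alpha> = sets \<zeta>" "space \<alpha> = space \<zeta>"
    by (auto simp: \<alpha>_def)
  have em: "emeasure \<alpha> S = F S" if "S \<in> sets \<zeta>" for S
    using J_zero that ca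
    by (intro emeasure_measure_of[OF \<alpha>_def])
       (auto simp: s positive_def F_def indicator_def[abs_def] dest: sets.sets_into_space)
  interpret a: finite_measure \<alpha>
    by (rule finite_measureI) (use s em in \<open>simp add: F_def\<close>)
  have meas: "measure \<alpha> S = J (indicator S)" if "S \<in> sets \<zeta>" for S
    using em[OF that] ind_nonneg[OF that] by (simp add: measure_def F_def)
  have nonneg: "f \<in> bfun \<zeta> \<longrightarrow> J f = (\<integral>x. f x \<partial>\<alpha>)"
    if "f \<in> borel_measurable \<zeta>" "\<And>x. 0 \<le> f x" for f
    using that
  proof (induction rule: borel_measurable_induct_real)
    case (set S)
    then show ?case using meas by (simp add: s Int_absorb1 sets.sets_into_space)
  next
    case (mult u d)
    show ?case
    proof (cases "d = 0")
      case True then show ?thesis by (simp add: J_zero)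
    next
      case False
      show ?thesis
      proof
        assume "(\<lambda>x. d * u x) \<in> bfun \<zeta>"
        then have "(\<lambda>x. (1/d) * (d * u x)) \<in> bfun \<zeta>" by (rule bfun_cmult)
        then have "u \<in> bfun \<zeta>" using False by simp
        then show "J (\<lambda>x. d * u x) = (\<integral>x. d * u x \<partial>\<alpha>)"
          using mult by (simp add: positive_functional_cmult[OF J])
      qed
    qed
  next
    case (add u v)
    show ?case
    proof
      assume "(\<lambda>x. v x + u x) \<in> bfun \<zeta>"
      then obtain b where b: "\<forall>x\<in>space \<zeta>. \<bar>v x + u x\<bar> \<le> b" by (auto simp: bfun_def)
      have "u \<in> bfun \<zeta>" "v \<in> bfun \<zeta>"
        using add b by (auto intro!: bfunI[of _ _ b] simp: abs_le_iff) (smt (verit))+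
      then show "J (\<lambda>x. v x + u x) = (\<integral>x. v x + u x \<partial>\<alpha>)"
        using add bfun_integrable[OF a.finite_measure_axioms _ s(1)]
        by (simp add: positive_functional_add[OF J])
    qed
  next
    case (seq U)
    show ?case
    proof
      assume f: "f \<in> bfun \<zeta>"
      then obtain b where b: "\<forall>x\<in>space \<zeta>. \<bar>f x\<bar> \<le> b" by (auto simp: bfun_def)
      have lim: "(\<lambda>i. U i x) \<longlonglongrightarrow> f x" if "x \<in> space \<zeta>" for x using seq that by auto
      have inc: "incseq (\<lambda>i. U i x)" for x using \<open>incseq U\<close> by (auto simp: incseq_def le_fun_def)
      have le: "U i x \<le> f x" if "x \<in> space \<zeta>" for i x
        by (rule incseq_le[OF inc lim[OF that]])
      have U: "U i \<in> bfun \<zeta>" for i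
        using seq le b by (intro bfunI[of _ _ b]) (auto, smt (verit))
      have bdU: "\<bar>U i x\<bar> \<le> b" if "x \<in> space \<zeta>" for i x
        using seq le[OF that, of i] b that by (smt (verit))
      have 1: "(\<lambda>i. \<integral>x. U i x \<partial>\<zeta>) \<longlonglongrightarrow> (\<integral>x. f x \<partial>\<zeta>)"
        by (rule integral_dominated_convergence[where w = "\<lambda>_. b"])
           (use f U lim bdU in \<open>auto intro!: AE_I2 bfun_measurable\<close>)
      have 2: "(\<lambda>i. \<integral>x. U i x \<partial>\<alpha>) \<longlonglongrightarrow> (\<integral>x. f x \<partial>\<alpha>)"
        by (rule integral_dominated_convergence[where w = "\<lambda>_. b"])
           (use f U lim bdU s in \<open>auto intro!: AE_I2 bfun_measurable cong: measurable_cong_sets\<close>)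
      have "(\<lambda>i. c * ((\<integral>x. f x \<partial>\<zeta>) - (\<integral>x. U i x \<partial>\<zeta>))) \<longlonglongrightarrow> c * ((\<integral>x. f x \<partial>\<zeta>) - (\<integral>x. f x \<partial>\<zeta>))"
        by (intro tendsto_intros 1)
      then have z: "(\<lambda>i. c * ((\<integral>x. f x \<partial>\<zeta>) - (\<integral>x. U i x \<partial>\<zeta>))) \<longlonglongrightarrow> 0" by simp
      have up: "J f - J (U i) \<le> c * ((\<integral>x. f x \<partial>\<zeta>) - (\<integral>x. U i x \<partial>\<zeta>))" for i
        using dom[OF bfun_diff[OF f U], of i] le bfun_integrable[OF finite_measure_axioms f refl]
          bfun_integrable[OF finite_measure_axioms U refl]
        by (simp add: positive_functional_diff[OF J f U])
      have low: "0 \<le> J f - J (U i)" for i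
        using positive_functional_mono[OF J U f le] by simp
      have "(\<lambda>i. J f - J (U i)) \<longlonglongrightarrow> 0"
        by (rule tendsto_sandwich[OF _ _ tendsto_const z]) (use up low in auto)
      then have "(\<lambda>i. J f - (J f - J (U i))) \<longlonglongrightarrow> J f - 0" by (intro tendsto_intros)
      then have "(\<lambda>i. J (U i)) \<longlonglongrightarrow> J f" by simp
      moreover have "J (U i) = (\<integral>x. U i x \<partial>\<alpha>)" for i using seq U by blast
      ultimately show "J f = (\<integral>x. f x \<partial>\<alpha>)" using 2 LIMSEQ_unique by auto
    qed
  qed
  have "J f = (\<integral>x. f x \<partial>\<alpha>)" if f: "f \<in> bfun \<zeta>" for f
  proof -
    have [measurable]: "f \<in> borel_measurable \<zeta>" using f by (rule bfun_measurable)
    obtain b where b: "\<forall>x\<in>space \<zeta>. \<bar>f x\<bar> \<le> b" using f by (auto simp: bfun_def)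
    have pn: "(\<lambda>x. max 0 (f x)) \<in> bfun \<zeta>" "(\<lambda>x. max 0 (- f x)) \<in> bfun \<zeta>"
      using b by (auto intro!: bfunI[of _ _ b]) (smt (verit))+
    have J2: "J (\<lambda>x. max 0 (f x)) = (\<integral>x. max 0 (f x) \<partial>\<alpha>)" "J (\<lambda>x. max 0 (- f x)) = (\<integral>x. max 0 (- f x) \<partial>\<alpha>)"
      using nonneg pn by auto
    have *: "f = (\<lambda>x. max 0 (f x) - max 0 (- f x))" by auto
    have "J f = J (\<lambda>x. max 0 (f x)) - J (\<lambda>x. max 0 (- f x))"
      by (subst *) (rule positive_functional_diff[OF J pn])
    also have "\<dots> = (\<integral>x. max 0 (f x) - max 0 (- f x) \<partial>\<alpha>)"
      unfolding J2 using bfun_integrable[OF a.finite_measure_axioms _ s(1)] pn by simp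
    also have "\<dots> = (\<integral>x. f x \<partial>\<alpha>)" by (rule Bochner_Integration.integral_cong) auto
    finally show ?thesis .
  qed
  with s a.finite_measure_axioms show ?thesis by blast
qed

section \<open>Operators minorized on an exhausting sequence\<close>

text \<open>
  A sub-Markov operator with a global upper density bound \<open>T_upper\<close>; \<open>T_pos\<close> makes the core reachable from
  everywhere, and
  \<open>T_minor\<close> is a Doeblin minorization which holds only on the sets \<open>A k\<close>, with a constant \<open>a k\<close> that may
  degenerate as they exhaust the space. On a single \<open>A k\<close> both bounds together would be a two-sided
  estimate; the work consists in controlling the mass outside.
\<close>

locale minorized_operator = prob_space \<zeta> for \<zeta> :: "'a measure" +
  fixes T :: "('a \<Rightarrow> real) \<Rightarrow> 'a \<Rightarrow> real" and A :: "nat \<Rightarrow> 'a set" and a :: "nat \<Rightarrow> real" and C :: real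
  assumes T_bfun: "f \<in> bfun \<zeta> \<Longrightarrow> T f \<in> bfun \<zeta>"
    and T_functional: "x \<in> space \<zeta> \<Longrightarrow> positive_functional \<zeta> (\<lambda>f. T f x)"
    and T_one: "x \<in> space \<zeta> \<Longrightarrow> T (\<lambda>_. 1) x \<le> 1"
    and T_upper: "f \<in> bfun \<zeta> \<Longrightarrow> (\<And>y. y \<in> space \<zeta> \<Longrightarrow> 0 \<le> f y) \<Longrightarrow> x \<in> space \<zeta> \<Longrightarrow>
      T f x \<le> C * (\<integral>y. f y \<partial>\<zeta>)"
    and A_sets: "A k \<in> sets \<zeta>"
    and A_incseq: "incseq A"
    and A_exhausts: "(\<Union>k. A k) = space \<zeta>"
    and a_pos: "0 < a k"
    and T_minor: "f \<in> bfun \<zeta> \<Longrightarrow> (\<And>y. y \<in> space \<zeta> \<Longrightarrow> 0 \<le> f y) \<Longrightarrow> x \<in> A k \<Longrightarrow>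
      a k * (\<integral>y. indicator (A k) y * f y \<partial>\<zeta>) \<le> T f x"
    and T_pos: "S \<in> sets \<zeta> \<Longrightarrow> 0 < prob S \<Longrightarrow> x \<in> space \<zeta> \<Longrightarrow> 0 < T (indicator S) x"
begin

lemma A_sub: "x \<in> A k \<Longrightarrow> x \<in> space \<zeta>"
  using A_exhausts by auto

lemma expectation_functional: "positive_functional \<zeta> (\<lambda>f. \<integral>x. f x \<partial>\<zeta>)"
  by (rule positive_functional_integral) (auto simp: finite_measure_axioms)

lemma prob_A_tendsto: "(\<lambda>k. prob (A k)) \<longlonglongrightarrow> 1"
  using finite_Lim_measure_incseq[of A] A_sets A_incseq A_exhausts prob_space by auto

lemma prob_compl_A_eventually_less:
  assumes "0 < e" shows "\<forall>\<^sub>F k in sequentially. prob (space \<zeta> - A k) < e"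
proof -
  have "(\<lambda>k. prob (space \<zeta> - A k)) \<longlonglongrightarrow> 0"
    using tendsto_diff[OF tendsto_const[of 1] prob_A_tendsto] prob_compl[OF A_sets] by simp
  then show ?thesis using assms by (rule order_tendstoD)
qed

lemma C_pos: "0 < C"
proof -
  obtain x where x: "x \<in> space \<zeta>" using not_empty by auto
  have "0 < T (indicator (space \<zeta>)) x" using x prob_space by (intro T_pos) auto
  also have "\<dots> = T (\<lambda>_. 1) x"
    by (rule positive_functional_cong[OF T_functional[OF x]]) auto
  also have "\<dots> \<le> C * 1" using T_upper[of "\<lambda>_. 1" x] x prob_space by simp
  finally show ?thesis by simp
qed

lemma T_mono:
  "f \<in> bfun \<zeta> \<Longrightarrow> g \<in> bfun \<zeta> \<Longrightarrow> (\<And>y. y \<in> space \<zeta> \<Longrightarrow> f y \<le> g y) \<Longrightarrow> x \<in> space \<zeta> \<Longrightarrow> T f x \<le> T g x"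
  by (rule positive_functional_mono[OF T_functional])

lemma T_nonneg: "f \<in> bfun \<zeta> \<Longrightarrow> (\<And>y. y \<in> space \<zeta> \<Longrightarrow> 0 \<le> f y) \<Longrightarrow> x \<in> space \<zeta> \<Longrightarrow> 0 \<le> T f x"
  by (rule positive_functional_nonneg[OF T_functional])

lemma T_cmult: "f \<in> bfun \<zeta> \<Longrightarrow> x \<in> space \<zeta> \<Longrightarrow> T (\<lambda>y. c * f y) x = c * T f x"
  by (rule positive_functional_cmult[OF T_functional])

lemma iter_bfun: "f \<in> bfun \<zeta> \<Longrightarrow> (T ^^ n) f \<in> bfun \<zeta>"
  by (induction n) (auto intro: T_bfun)

text \<open>
  \<open>funpow\<close> unfolds on the outside, while a functional \<open>I\<close> evolves by \<open>f \<mapsto> I (T f)\<close>.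
\<close>

lemma iter_Suc_inner: "(T ^^ Suc n) f = (T ^^ n) (T f)"
  by (simp add: funpow_swap1)

lemma functional_T:
  assumes I: "positive_functional \<zeta> I" shows "positive_functional \<zeta> (\<lambda>f. I (T f))"
  unfolding positive_functional_def
proof (intro conjI ballI allI impI)
  fix f g assume fg: "f \<in> bfun \<zeta>" "g \<in> bfun \<zeta>"
  have "I (T (\<lambda>x. f x + g x)) = I (\<lambda>x. T f x + T g x)"
    using fg by (intro positive_functional_cong[OF I] T_bfun bfun_add positive_functional_add[OF T_functional])
  then show "I (T (\<lambda>x. f x + g x)) = I (T f) + I (T g)"
    using fg by (simp add: positive_functional_add[OF I] T_bfun)
next
  fix c f assume f: "f \<in> bfun \<zeta>"
  have "I (T (\<lambda>x. c * f x)) = I (\<lambda>x. c * T f x)"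
    using f by (intro positive_functional_cong[OF I] T_bfun bfun_cmult T_cmult)
  then show "I (T (\<lambda>x. c * f x)) = c * I (T f)"
    using f by (simp add: positive_functional_cmult[OF I] T_bfun)
next
  fix f assume "f \<in> bfun \<zeta>" "\<forall>x\<in>space \<zeta>. 0 \<le> f x"
  then show "0 \<le> I (T f)"
    by (intro positive_functional_nonneg[OF I] T_bfun T_nonneg) auto
qed

lemma functional_iter:
  "positive_functional \<zeta> I \<Longrightarrow> positive_functional \<zeta> (\<lambda>f. I ((T ^^ n) f))"
proof (induction n arbitrary: I)
  case (Suc n)
  from Suc.IH[OF functional_T[OF Suc.prems]] show ?case by simp
qed simp

lemma iter_functional: "x \<in> space \<zeta> \<Longrightarrow> positive_functional \<zeta> (\<lambda>f. (T ^^ n) f x)"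
  by (rule functional_iter) (auto simp: positive_functional_def)

lemma iter_mono:
  "f \<in> bfun \<zeta> \<Longrightarrow> g \<in> bfun \<zeta> \<Longrightarrow> (\<And>y. y \<in> space \<zeta> \<Longrightarrow> f y \<le> g y) \<Longrightarrow> x \<in> space \<zeta> \<Longrightarrow>
    (T ^^ n) f x \<le> (T ^^ n) g x"
  by (rule positive_functional_mono[OF iter_functional])

lemma iter_nonneg:
  "f \<in> bfun \<zeta> \<Longrightarrow> (\<And>y. y \<in> space \<zeta> \<Longrightarrow> 0 \<le> f y) \<Longrightarrow> x \<in> space \<zeta> \<Longrightarrow> 0 \<le> (T ^^ n) f x"
  by (rule positive_functional_nonneg[OF iter_functional])

definition surv :: "nat \<Rightarrow> 'a \<Rightarrow> real" where
  "surv n = (T ^^ n) (\<lambda>_. 1)"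

lemma surv_0[simp]: "surv 0 = (\<lambda>_. 1)" by (simp add: surv_def)

lemma surv_Suc: "surv (Suc n) = T (surv n)" by (simp add: surv_def)

lemma surv_add: "(T ^^ m) (surv n) = surv (m + n)" by (simp add: surv_def funpow_add)

lemma surv_bfun[simp, intro]: "surv n \<in> bfun \<zeta>" by (simp add: surv_def iter_bfun)

lemma surv_nonneg: "x \<in> space \<zeta> \<Longrightarrow> 0 \<le> surv n x"
  unfolding surv_def by (rule iter_nonneg) auto

lemma surv_Suc_le: "x \<in> space \<zeta> \<Longrightarrow> surv (Suc n) x \<le> surv n x"
  unfolding surv_def iter_Suc_inner
  by (rule iter_mono) (auto intro: T_bfun T_one)

lemma surv_antimono: "m \<le> n \<Longrightarrow> x \<in> space \<zeta> \<Longrightarrow> surv n x \<le> surv m x"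
  by (rule lift_Suc_antimono_le[of "\<lambda>n. surv n x"]) (simp_all add: surv_Suc_le)

end

section \<open>Invariant cones of laws and of survival functions\<close>

text \<open>
  The core \<open>A b\<close> fixes a factor \<open>\<beta>\<close>, the share of its mass that the core keeps at least in each step. The outer set
  \<open>A m\<close> is chosen afterwards, so large that by \<open>T_upper\<close> one step puts outside it at most the fraction
  \<open>\<beta> / 4\<close> of the mass. Mass outside \<open>A m\<close> therefore dies out faster than mass in the core.
\<close>

locale minorized_operator_core = minorized_operator +
  fixes b m :: nat
  assumes core_pos: "0 < prob (A b)"
    and b_le_m: "b \<le> m"
    and outer_small: "4 * C * prob (space \<zeta> - A m) \<le> a b * prob (A b)"
begin

text \<open>
  \<open>c\<close> bounds the chance to enter the core in one step from \<open>A m\<close> from below. \<open>\<psi>\<close> and \<open>core_flux\<close> are a right and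
  a left sub-eigenvector of \<open>T\<close>: \<open>T \<psi> \<ge> \<beta> \<psi>\<close> and \<open>core_flux \<circ> T \<ge> \<beta> core_flux\<close>. They replace the unknown
  eigenfunction and eigenmeasure. \<open>D\<close> is the aperture of the two cones built from them; the recursion
  \<open>z \<mapsto> 1 / c + z / 4\<close> for the ratio total mass over \<open>\<psi>\<close>-mass has the fixed point \<open>4 / (3 c)\<close>, and \<open>D\<close> lies
  strictly above it, so that the cone of laws is entered after finitely many steps.
\<close>

definition "\<beta> = a b * prob (A b)"
definition "c = a m * prob (A b)"
definition "D = 2 / c"
definition "\<psi> = T (indicator (A b))"
definition "core_flux f = (\<integral>x. indicator (A b) x * T f x \<partial>\<zeta>)"

lemma \<beta>_pos: "0 < \<beta>" using a_pos core_pos by (simp add: \<beta>_def)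
lemma c_pos: "0 < c" using a_pos core_pos by (simp add: c_def)
lemma D_pos: "0 < D" using c_pos by (simp add: D_def)

lemma A_b_sub_m: "A b \<subseteq> A m" using A_incseq b_le_m by (auto simp: incseq_def)

lemma ind_bfun[simp, intro]: "indicator (A k) \<in> bfun \<zeta>" "indicator (space \<zeta> - A k) \<in> bfun \<zeta>"
  using A_sets by auto

lemma ind_A_mult[simp, intro]:
  "f \<in> bfun \<zeta> \<Longrightarrow> (\<lambda>x. indicator (A k) x * f x) \<in> bfun \<zeta>"
  "f \<in> bfun \<zeta> \<Longrightarrow> (\<lambda>x. indicator (space \<zeta> - A k) x * f x) \<in> bfun \<zeta>"
  by auto

lemma ind_mult_nonneg: "0 \<le> (r::real) \<Longrightarrow> 0 \<le> indicator S x * r"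
  by (simp add: indicator_def)

lemma \<psi>_bfun[simp, intro]: "\<psi> \<in> bfun \<zeta>" unfolding \<psi>_def by (intro T_bfun) auto

lemma \<psi>_pos: "x \<in> space \<zeta> \<Longrightarrow> 0 < \<psi> x"
  unfolding \<psi>_def by (rule T_pos) (auto simp: A_sets core_pos)

lemma \<psi>_le_1: "x \<in> space \<zeta> \<Longrightarrow> \<psi> x \<le> 1"
  unfolding \<psi>_def
  by (rule order_trans[OF T_mono T_one]) (auto simp: indicator_le_1)

lemma integral_ind_A: "(\<integral>x. indicator (A k) x * indicator (A b) x \<partial>\<zeta>) = prob (A b)" if "A b \<subseteq> A k"
proof -
  have "(\<integral>x. indicator (A k) x * indicator (A b) x \<partial>\<zeta>) = (\<integral>x. indicat_real (A b) x \<partial>\<zeta>)"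
    by (rule Bochner_Integration.integral_cong) (use that in \<open>auto simp: indicator_def\<close>)
  also have "\<dots> = prob (A b)"
    using A_sets[of b] by (simp add: Int_absorb1 sets.sets_into_space)
  finally show ?thesis .
qed

lemma \<psi>_ge_\<beta>: "x \<in> space \<zeta> \<Longrightarrow> \<beta> * indicator (A b) x \<le> \<psi> x"
  using T_minor[of "indicator (A b)" x b] \<psi>_pos[of x]
  by (cases "x \<in> A b") (auto simp: \<psi>_def \<beta>_def integral_ind_A)

lemma \<psi>_ge_c: "x \<in> space \<zeta> \<Longrightarrow> c * indicator (A m) x \<le> \<psi> x"
  using T_minor[of "indicator (A b)" x m] \<psi>_pos[of x]
  by (cases "x \<in> A m") (auto simp: \<psi>_def c_def integral_ind_A A_b_sub_m)

text \<open>
  Since \<open>\<psi>\<close> is \<open>T\<close> applied to \<open>1\<^bsub>A b\<^esub>\<close>, the bound \<open>\<psi> \<ge> \<beta> 1\<^bsub>A b\<^esub>\<close> propagates by monotonicity. The function \<open>\<psi>\<close> is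
  preferred to \<open>1\<^bsub>A b\<^esub>\<close> because it is positive everywhere.
\<close>

lemma T_\<psi>_ge: "x \<in> space \<zeta> \<Longrightarrow> \<beta> * \<psi> x \<le> T \<psi> x"
  using T_mono[of "\<lambda>x. \<beta> * indicator (A b) x" \<psi> x] T_cmult[of "indicator (A b)" x \<beta>] \<psi>_ge_\<beta>
  by (auto simp: \<psi>_def[symmetric] bfun_cmult)

lemma \<beta>_le_C: "\<beta> \<le> C"
proof -
  obtain x where x: "x \<in> A b" using core_pos by fastforce
  have "\<beta> \<le> \<psi> x" using \<psi>_ge_\<beta>[OF A_sub[OF x]] x by simp
  also have "\<dots> \<le> C * prob (A b)"
    using T_upper[of "indicator (A b)" x] A_sub[OF x] A_sets[of b]
    by (simp add: \<psi>_def Int_absorb1 sets.sets_into_space)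
  also have "\<dots> \<le> C" using C_pos by (simp add: mult_left_le)
  finally show ?thesis .
qed

lemma prob_A_m: "1 / 2 \<le> prob (A m)"
proof -
  have "4 * C * prob (space \<zeta> - A m) \<le> C * 1"
    using outer_small \<beta>_le_C by (simp add: \<beta>_def)
  then have "4 * prob (space \<zeta> - A m) \<le> 1" using C_pos by simp
  then show ?thesis using prob_compl[OF A_sets, of m] by simp
qed

lemma upper_outside:
  assumes f: "f \<in> bfun \<zeta>" "\<And>y. y \<in> space \<zeta> \<Longrightarrow> 0 \<le> f y" "\<And>y. y \<in> space \<zeta> \<Longrightarrow> f y \<le> K"
  shows "(\<integral>x. indicator (space \<zeta> - A k) x * f x \<partial>\<zeta>) \<le> K * prob (space \<zeta> - A k)"
proof -
  have "(\<integral>x. indicator (space \<zeta> - A k) x * f x \<partial>\<zeta>) \<le> (\<integral>x. K * indicator (space \<zeta> - A k) x \<partial>\<zeta>)"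
    using f by (intro positive_functional_mono[OF expectation_functional] ind_A_mult bfun_cmult ind_bfun)
      (auto simp: indicator_def)
  also have "\<dots> = K * prob (space \<zeta> - A k)"
    using A_sets[of k] by (simp add: Int_absorb1 Diff_subset)
  finally show ?thesis .
qed

text \<open>
  An invariant cone of laws: \<open>I \<psi>\<close> is the mass that enters the core in the next step.
\<close>

definition good :: "(('a \<Rightarrow> real) \<Rightarrow> real) \<Rightarrow> bool" where
  "good I \<longleftrightarrow> positive_functional \<zeta> I \<and> I (\<lambda>_. 1) \<le> D * I \<psi>"

text \<open>
  The surviving mass is split at \<open>A m\<close>. Inside, \<open>1 \<le> \<psi> / c\<close>; outside, the choice of \<open>A m\<close> leaves at most the
  fraction \<open>\<beta> / 4\<close> of the previous mass.
\<close>

lemma mass_step: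
  assumes I: "positive_functional \<zeta> I"
  shows "I (T (\<lambda>_. 1)) \<le> (1 / c) * I (T \<psi>) + (\<beta> / 4) * I (\<lambda>_. 1)"
proof -
  note IT = functional_T[OF I]
  have "I (T (\<lambda>_. 1)) = I (T (\<lambda>x. indicator (A m) x * 1)) + I (T (\<lambda>x. indicator (space \<zeta> - A m) x * 1))"
    by (rule positive_functional_split[OF IT]) (auto simp: A_sets)
  also have "I (T (\<lambda>x. indicator (A m) x * 1)) \<le> I (T (\<lambda>x. (1 / c) * \<psi> x))"
    using \<psi>_ge_c c_pos
    by (intro positive_functional_mono[OF IT] ind_A_mult bfun_cmult)
       (auto simp: field_simps)
  also have "I (T (\<lambda>x. (1 / c) * \<psi> x)) = (1 / c) * I (T \<psi>)"
    by (rule positive_functional_cmult[OF IT]) auto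
  also have "I (T (\<lambda>x. indicator (space \<zeta> - A m) x * 1)) \<le> I (\<lambda>_. \<beta> / 4)"
  proof (intro positive_functional_mono[OF I] T_bfun)
    fix x assume x: "x \<in> space \<zeta>"
    have "T (\<lambda>x. indicator (space \<zeta> - A m) x * 1) x \<le> C * (\<integral>x. indicator (space \<zeta> - A m) x * 1 \<partial>\<zeta>)"
      using x by (intro T_upper ind_A_mult) auto
    also have "\<dots> \<le> C * prob (space \<zeta> - A m)"
      using upper_outside[of "\<lambda>_. 1" 1 m] C_pos by simp
    finally show "T (\<lambda>x. indicator (space \<zeta> - A m) x * 1) x \<le> \<beta> / 4"
      using outer_small by (simp add: \<beta>_def)
  qed auto
  also have "I (\<lambda>_. \<beta> / 4) = (\<beta> / 4) * I (\<lambda>_. 1)" by (rule positive_functional_const[OF I])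
  finally show ?thesis by simp
qed

lemma \<psi>_growth:
  assumes I: "positive_functional \<zeta> I" shows "\<beta> * I \<psi> \<le> I (T \<psi>)"
  using positive_functional_mono[OF I bfun_cmult[OF \<psi>_bfun] T_bfun[OF \<psi>_bfun] T_\<psi>_ge]
  by (simp add: positive_functional_cmult[OF I])

lemma good_T:
  assumes "good I" shows "good (\<lambda>f. I (T f))"
proof -
  have I: "positive_functional \<zeta> I" and le: "I (\<lambda>_. 1) \<le> D * I \<psi>" using assms by (auto simp: good_def)
  have "0 \<le> I (T \<psi>)"
    by (intro positive_functional_nonneg[OF functional_T[OF I]]) (auto intro: less_imp_le \<psi>_pos)
  have "I (T (\<lambda>_. 1)) \<le> (1 / c) * I (T \<psi>) + (\<beta> / 4) * I (\<lambda>_. 1)" by (rule mass_step[OF I])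
  also have "(\<beta> / 4) * I (\<lambda>_. 1) \<le> (\<beta> / 4) * (D * I \<psi>)" using le \<beta>_pos by (intro mult_left_mono) auto
  also have "\<dots> = (D / 4) * (\<beta> * I \<psi>)" by simp
  also have "\<dots> \<le> (D / 4) * I (T \<psi>)" using \<psi>_growth[OF I] D_pos by (intro mult_left_mono) auto
  also have "(1 / c) * I (T \<psi>) + (D / 4) * I (T \<psi>) = (3 / (2 * c)) * I (T \<psi>)"
    by (simp add: D_def field_simps)
  also have "\<dots> \<le> D * I (T \<psi>)" using c_pos \<open>0 \<le> I (T \<psi>)\<close>
    by (intro mult_right_mono) (auto simp: D_def field_simps)
  finally show ?thesis using functional_T[OF I] by (simp add: good_def)
qed

lemma good_iter: "good I \<Longrightarrow> good (\<lambda>f. I ((T ^^ n) f))"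
proof (induction n arbitrary: I)
  case (Suc n)
  from Suc.IH[OF good_T[OF Suc.prems]] show ?case by simp
qed simp

lemma \<psi>_growth_iter:
  assumes I: "positive_functional \<zeta> I" shows "\<beta> ^ n * I \<psi> \<le> I ((T ^^ n) \<psi>)"
proof (induction n)
  case (Suc n)
  have "\<beta> ^ Suc n * I \<psi> \<le> \<beta> * I ((T ^^ n) \<psi>)" using Suc \<beta>_pos by simp
  also have "\<dots> \<le> I ((T ^^ n) (T \<psi>))" by (rule \<psi>_growth[OF functional_iter[OF I]])
  finally show ?case by (simp add: iter_Suc_inner del: funpow.simps)
qed simp

text \<open>
  The ratio total mass over \<open>\<psi>\<close>-mass contracts by the factor \<open>1 / 4\<close> at each step towards a value below \<open>D\<close>.
  The time needed depends on the initial law, and this is why the attraction is not uniform over all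
  initial laws; it is uniform over the cone.
\<close>

lemma eventually_good:
  assumes I: "positive_functional \<zeta> I" and pos: "0 < I \<psi>"
  obtains n where "good (\<lambda>f. I ((T ^^ n) f))"
proof -
  \<comment> \<open>The fixed point of \<open>z \<mapsto> 1 / c + z / 4\<close>.\<close>
  define d where "d = 4 / (3 * c)"
  have d: "1 / c + d / 4 = d" "0 < d" "d < D" using c_pos by (auto simp: d_def D_def field_simps)
  have bound: "I (surv n) \<le> d * I ((T ^^ n) \<psi>) + (\<beta> / 4) ^ n * I (\<lambda>_. 1)" for n
  proof (induction n)
    case 0
    show ?case using d(2) pos by (simp add: surv_def)
  next
    case (Suc n)
    note In = functional_iter[OF I, of n]
    have "I (surv (Suc n)) \<le> (1 / c) * I ((T ^^ n) (T \<psi>)) + (\<beta> / 4) * I (surv n)"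
      using mass_step[OF In] by (simp add: surv_def iter_Suc_inner del: funpow.simps)
    also have "(\<beta> / 4) * I (surv n) \<le> (\<beta> / 4) * (d * I ((T ^^ n) \<psi>) + (\<beta> / 4) ^ n * I (\<lambda>_. 1))"
      using Suc \<beta>_pos by (intro mult_left_mono) auto
    also have "\<dots> = (d / 4) * (\<beta> * I ((T ^^ n) \<psi>)) + (\<beta> / 4) ^ Suc n * I (\<lambda>_. 1)"
      by (simp add: field_simps)
    also have "(d / 4) * (\<beta> * I ((T ^^ n) \<psi>)) \<le> (d / 4) * I ((T ^^ n) (T \<psi>))"
      using \<psi>_growth[OF In] d(2) by (intro mult_left_mono) auto
    finally have "I (surv (Suc n)) \<le> (1 / c + d / 4) * I ((T ^^ n) (T \<psi>)) + (\<beta> / 4) ^ Suc n * I (\<lambda>_. 1)"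
      by (simp add: algebra_simps)
    then show ?case by (simp add: d(1) iter_Suc_inner del: funpow.simps power_Suc)
  qed
  have "0 < (D - d) * I \<psi>" using d pos by simp
  moreover have "(\<lambda>n. (1 / 4) ^ n * I (\<lambda>_. 1)) \<longlonglongrightarrow> 0"
    by (intro tendsto_mult_left_zero LIMSEQ_realpow_zero) auto
  ultimately have "\<forall>\<^sub>F n in sequentially. (1 / 4) ^ n * I (\<lambda>_. 1) < (D - d) * I \<psi>"
    by (rule order_tendstoD(2)[rotated])
  then obtain n where n: "(1 / 4) ^ n * I (\<lambda>_. 1) < (D - d) * I \<psi>"
    by (auto simp: eventually_sequentially)
  have "(\<beta> / 4) ^ n * I (\<lambda>_. 1) = \<beta> ^ n * ((1 / 4) ^ n * I (\<lambda>_. 1))"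
    by (simp add: power_divide)
  also have "\<dots> \<le> \<beta> ^ n * ((D - d) * I \<psi>)" using n \<beta>_pos by (intro mult_left_mono) auto
  also have "\<dots> = (D - d) * (\<beta> ^ n * I \<psi>)" by simp
  also have "\<dots> \<le> (D - d) * I ((T ^^ n) \<psi>)" using \<psi>_growth_iter[OF I] d by (intro mult_left_mono) auto
  finally have "I (surv n) \<le> D * I ((T ^^ n) \<psi>)" using bound[of n] by (simp add: algebra_simps)
  then have "good (\<lambda>f. I ((T ^^ n) f))" using functional_iter[OF I] by (simp add: good_def surv_def)
  then show ?thesis by (rule that)
qed

text \<open>
  A good law keeps a fixed fraction of its mass at each step. This turns \<open>T_upper\<close> into a density bound for
  conditioned laws which is uniform in time.
\<close>

lemma good_mass_decay:
  assumes "good I" shows "(\<beta> / D) * I (\<lambda>_. 1) \<le> I (T (\<lambda>_. 1))"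
proof -
  have I: "positive_functional \<zeta> I" and le: "I (\<lambda>_. 1) \<le> D * I \<psi>" using assms by (auto simp: good_def)
  have "(\<beta> / D) * I (\<lambda>_. 1) \<le> \<beta> * I \<psi>"
    using mult_left_mono[OF le less_imp_le[OF \<beta>_pos]] D_pos by (simp add: field_simps)
  also have "\<dots> \<le> I (T \<psi>)" by (rule \<psi>_growth[OF I])
  also have "\<dots> \<le> I (T (\<lambda>_. 1))"
    by (rule positive_functional_mono[OF functional_T[OF I]]) (auto simp: \<psi>_le_1)
  finally show ?thesis .
qed

lemma core_flux_T:
  assumes f: "f \<in> bfun \<zeta>" "\<And>x. x \<in> space \<zeta> \<Longrightarrow> 0 \<le> f x" shows "\<beta> * core_flux f \<le> core_flux (T f)"
proof -
  have "\<beta> * core_flux f = (\<integral>x. (a b * core_flux f) * indicator (A b) x \<partial>\<zeta>)"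
    using A_sets[of b] by (simp add: \<beta>_def Int_absorb1 sets.sets_into_space)
  also have "\<dots> \<le> (\<integral>x. indicator (A b) x * T (T f) x \<partial>\<zeta>)"
  proof (rule positive_functional_mono[OF expectation_functional])
    fix x assume "x \<in> space \<zeta>"
    show "(a b * core_flux f) * indicator (A b) x \<le> indicator (A b) x * T (T f) x"
      using T_minor[OF T_bfun[OF f(1)] T_nonneg[OF f], of x b]
      by (cases "x \<in> A b") (auto simp: core_flux_def)
  qed (use f in \<open>auto intro!: T_bfun bfun_cmult\<close>)
  finally show ?thesis by (simp add: core_flux_def)
qed

lemma core_flux_ge:
  assumes f: "f \<in> bfun \<zeta>" "\<And>x. x \<in> space \<zeta> \<Longrightarrow> 0 \<le> f x"
  shows "c * (\<integral>x. indicator (A m) x * f x \<partial>\<zeta>) \<le> core_flux f"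
proof -
  let ?q = "\<integral>x. indicator (A m) x * f x \<partial>\<zeta>"
  have "c * ?q = (\<integral>x. (a m * ?q) * indicator (A b) x \<partial>\<zeta>)"
    using A_sets[of b] by (simp add: c_def Int_absorb1 sets.sets_into_space)
  also have "\<dots> \<le> (\<integral>x. indicator (A b) x * T f x \<partial>\<zeta>)"
  proof (rule positive_functional_mono[OF expectation_functional])
    fix x assume "x \<in> space \<zeta>"
    show "(a m * ?q) * indicator (A b) x \<le> indicator (A b) x * T f x"
      using T_minor[OF f, of x m] A_b_sub_m by (cases "x \<in> A b") auto
  qed (use f in \<open>auto intro!: T_bfun bfun_cmult\<close>)
  finally show ?thesis by (simp add: core_flux_def)
qed

lemma surv_Suc_upper: "x \<in> space \<zeta> \<Longrightarrow> surv (Suc n) x \<le> C * (\<integral>y. surv n y \<partial>\<zeta>)"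
  unfolding surv_Suc by (rule T_upper) (auto intro: surv_nonneg)

text \<open>
  The dual of \<open>mass_step\<close> and \<open>good_T\<close>: survival probabilities stay in an invariant cone of functions, so the
  survival seen on average over the space is comparable to the survival seen from the core.
\<close>

lemma expectation_surv_le: "(\<integral>x. surv n x \<partial>\<zeta>) \<le> D * core_flux (surv n)"
proof (induction n)
  case 0
  have "c * prob (A m) \<le> core_flux (\<lambda>_. 1)"
    using core_flux_ge[of "\<lambda>_. 1"] A_sets[of m] by (simp add: Int_absorb1 sets.sets_into_space)
  moreover have "c * (1 / 2) \<le> c * prob (A m)" using prob_A_m c_pos by (intro mult_left_mono) auto
  ultimately have "c / 2 \<le> core_flux (\<lambda>_. 1)" by simp
  then show ?case using c_pos by (simp add: D_def prob_space field_simps)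
next
  case (Suc n)
  let ?g = "surv (Suc n)"
  have l0: "0 \<le> core_flux ?g"
    unfolding core_flux_def
    by (intro positive_functional_nonneg[OF expectation_functional] ind_A_mult T_bfun)
       (auto intro!: mult_nonneg_nonneg T_nonneg surv_nonneg)
  have "(\<integral>x. ?g x \<partial>\<zeta>) = (\<integral>x. indicator (A m) x * ?g x \<partial>\<zeta>) + (\<integral>x. indicator (space \<zeta> - A m) x * ?g x \<partial>\<zeta>)"
    by (rule positive_functional_split[OF expectation_functional]) (auto simp: A_sets)
  also have "(\<integral>x. indicator (A m) x * ?g x \<partial>\<zeta>) \<le> (1 / c) * core_flux ?g"
    using core_flux_ge[of ?g] c_pos surv_nonneg by (auto simp: field_simps)
  also have "(\<integral>x. indicator (space \<zeta> - A m) x * ?g x \<partial>\<zeta>) \<le> (C * (\<integral>x. surv n x \<partial>\<zeta>)) * prob (space \<zeta> - A m)"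
    by (rule upper_outside) (auto intro: surv_nonneg surv_Suc_upper)
  also have "\<dots> = (C * prob (space \<zeta> - A m)) * (\<integral>x. surv n x \<partial>\<zeta>)" by simp
  also have "\<dots> \<le> (\<beta> / 4) * (\<integral>x. surv n x \<partial>\<zeta>)"
    using outer_small by (intro mult_right_mono positive_functional_nonneg[OF expectation_functional])
      (auto simp: \<beta>_def intro: surv_nonneg)
  also have "\<dots> \<le> (\<beta> / 4) * (D * core_flux (surv n))" using Suc \<beta>_pos by (intro mult_left_mono) auto
  also have "\<dots> = (D / 4) * (\<beta> * core_flux (surv n))" by simp
  also have "\<dots> \<le> (D / 4) * core_flux ?g"
    unfolding surv_Suc using D_pos by (intro mult_left_mono core_flux_T) (auto intro: surv_nonneg)
  finally have "(\<integral>x. ?g x \<partial>\<zeta>) \<le> (1 / c + D / 4) * core_flux ?g" by (simp add: algebra_simps)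
  also have "\<dots> \<le> D * core_flux ?g"
    using l0 c_pos by (intro mult_right_mono) (auto simp: D_def field_simps)
  finally show ?case .
qed

text \<open>
  A Harnack-type inequality: by \<open>expectation_surv_le\<close>, a starting point drawn from the core survives about as
  well as one drawn from the whole space.
\<close>

lemma core_mass_surv: "(\<integral>x. surv n x \<partial>\<zeta>) \<le> D * (\<integral>x. indicator (A b) x * surv (Suc n) x \<partial>\<zeta>)"
  using expectation_surv_le[of n] by (simp add: core_flux_def surv_Suc)

lemma good_functional: "good I \<Longrightarrow> positive_functional \<zeta> I"
  by (simp add: good_def)

lemma \<psi>_le_surv: "x \<in> space \<zeta> \<Longrightarrow> \<beta> ^ n * \<psi> x \<le> surv n x"
proof -
  assume x: "x \<in> space \<zeta>"
  have "\<beta> ^ n * \<psi> x \<le> (T ^^ n) \<psi> x"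
    using \<psi>_growth_iter[OF iter_functional[OF x, of 0]] by simp
  also have "\<dots> \<le> surv n x"
    unfolding surv_def using x by (intro iter_mono) (auto simp: \<psi>_le_1)
  finally show ?thesis .
qed

lemma functional_surv_pos:
  assumes I: "positive_functional \<zeta> I" "0 < I \<psi>" shows "0 < I (surv n)"
proof -
  have "0 < \<beta> ^ n * I \<psi>" using I \<beta>_pos by simp
  also have "\<dots> = I (\<lambda>x. \<beta> ^ n * \<psi> x)" by (simp add: positive_functional_cmult[OF I(1)])
  also have "\<dots> \<le> I (surv n)"
    by (rule positive_functional_mono[OF I(1)]) (auto simp: \<psi>_le_surv)
  finally show ?thesis .
qed

lemma good_\<psi>_pos:
  assumes "good I" "0 < I (\<lambda>_. 1)" shows "0 < I \<psi>"
proof -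
  have "0 < D * I \<psi>" using assms by (simp add: good_def)
  then show ?thesis using D_pos by (simp add: zero_less_mult_iff)
qed

lemma good_surv_pos: "good I \<Longrightarrow> 0 < I (\<lambda>_. 1) \<Longrightarrow> 0 < I (surv n)"
  by (rule functional_surv_pos[OF good_functional good_\<psi>_pos])

section \<open>Coupling of conditioned laws\<close>

text \<open>
  Passage through the core decouples past and future. A good law reaches the core in one step with a
  probability proportional to its mass; from there one step spreads it over the core, where survival is
  comparable to its average by \<open>core_mass_surv\<close>.
\<close>

lemma good_renewal:
  assumes "good J"
  shows "(a b / D\<^sup>2) * (J (\<lambda>_. 1) * (\<integral>x. surv n x \<partial>\<zeta>)) \<le> J (surv (n + 3))"
proof -
  have J: "positive_functional \<zeta> J" and le: "J (\<lambda>_. 1) \<le> D * J \<psi>" using assms by (auto simp: good_def)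
  define s where "s = (\<integral>x. indicator (A b) x * surv (Suc n) x \<partial>\<zeta>)"
  have s0: "0 \<le> s" unfolding s_def
    by (intro positive_functional_nonneg[OF expectation_functional]) (auto intro!: ind_mult_nonneg surv_nonneg)
  have core: "a b * s * indicator (A b) x \<le> surv (n + 2) x" if x: "x \<in> space \<zeta>" for x
    using T_minor[of "surv (Suc n)" x b] surv_nonneg[OF x, of "n + 2"] surv_nonneg
    by (cases "x \<in> A b") (auto simp: s_def surv_Suc[symmetric])
  have "a b * s * \<psi> x \<le> surv (n + 3) x" if x: "x \<in> space \<zeta>" for x
  proof -
    have "a b * s * \<psi> x = T (\<lambda>x. a b * s * indicator (A b) x) x"
      using x by (simp add: \<psi>_def T_cmult)
    also have "\<dots> \<le> T (surv (n + 2)) x" using x core by (intro T_mono) (auto intro: bfun_cmult)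
    finally show ?thesis by (simp add: surv_Suc numeral_3_eq_3 numeral_2_eq_2)
  qed
  then have "J (\<lambda>x. (a b * s) * \<psi> x) \<le> J (surv (n + 3))"
    by (intro positive_functional_mono[OF J]) (auto intro: bfun_cmult)
  then have up: "a b * s * J \<psi> \<le> J (surv (n + 3))" by (simp add: positive_functional_cmult[OF J])
  have J0: "0 \<le> J (\<lambda>_. 1)" by (rule positive_functional_nonneg[OF J]) auto
  have "J (\<lambda>_. 1) * (\<integral>x. surv n x \<partial>\<zeta>) \<le> (D * J \<psi>) * (D * s)"
    using le core_mass_surv[of n] J0 s0 D_pos unfolding s_def
    by (intro mult_mono) (auto intro: order_trans positive_functional_nonneg[OF expectation_functional] surv_nonneg)
  then have "(a b / D\<^sup>2) * (J (\<lambda>_. 1) * (\<integral>x. surv n x \<partial>\<zeta>)) \<le> (a b / D\<^sup>2) * ((D * J \<psi>) * (D * s))"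
    using a_pos[of b] by (intro mult_left_mono) auto
  also have "\<dots> = a b * s * J \<psi>" using D_pos by (simp add: power2_eq_square field_simps)
  also note up
  finally show ?thesis .
qed

text \<open>
  Conditioned on surviving, a good law is at an intermediate time outside \<open>A l\<close> with a probability at most
  \<open>\<epsilon>\<close>. Two applications of the upper bound estimate the numerator by the product of past mass, measure of
  the outside and future survival; \<open>good_renewal\<close> bounds the denominator below by the same product. The
  constant \<open>a b / D\<^sup>2\<close> depends on \<open>A b\<close> and \<open>A m\<close> only, hence \<open>l\<close> may be chosen after it.
\<close>

lemma good_outside:
  assumes "good J" and l: "C\<^sup>2 * prob (space \<zeta> - A l) \<le> \<epsilon> * (a b / D\<^sup>2)" and \<epsilon>: "0 < \<epsilon>"
  shows "J (T (\<lambda>x. indicator (space \<zeta> - A l) x * surv (q + 2) x)) \<le> \<epsilon> * J (surv (q + 3))"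
proof -
  have J: "positive_functional \<zeta> J" using assms by (simp add: good_def)
  have J0: "0 \<le> J (\<lambda>_. 1)" by (rule positive_functional_nonneg[OF J]) auto
  define s where "s = (\<integral>x. surv q x \<partial>\<zeta>)"
  have s: "0 \<le> s" unfolding s_def by (rule positive_functional_nonneg[OF expectation_functional]) (auto intro: surv_nonneg)
  have sq: "(\<integral>x. surv (Suc q) x \<partial>\<zeta>) \<le> s"
    unfolding s_def by (rule positive_functional_mono[OF expectation_functional]) (auto intro: surv_Suc_le)
  let ?h = "\<lambda>x. indicator (space \<zeta> - A l) x * surv (q + 2) x"
  have h: "(\<integral>x. ?h x \<partial>\<zeta>) \<le> (C * s) * prob (space \<zeta> - A l)"
  proof (rule upper_outside)
    fix y assume "y \<in> space \<zeta>"
    then have "surv (q + 2) y \<le> C * (\<integral>x. surv (Suc q) x \<partial>\<zeta>)" using surv_Suc_upper[of y "Suc q"] by simp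
    also have "\<dots> \<le> C * s" using sq C_pos by (intro mult_left_mono) auto
    finally show "surv (q + 2) y \<le> C * s" .
  qed (auto intro: surv_nonneg)
  have "J (T ?h) \<le> J (\<lambda>_. \<epsilon> * (a b / D\<^sup>2) * s)"
  proof (intro positive_functional_mono[OF J] T_bfun)
    fix x assume x: "x \<in> space \<zeta>"
    have "T ?h x \<le> C * (\<integral>x. ?h x \<partial>\<zeta>)" using x by (intro T_upper) (auto intro!: ind_mult_nonneg surv_nonneg)
    also have "\<dots> \<le> C * ((C * s) * prob (space \<zeta> - A l))" using h C_pos by (intro mult_left_mono) auto
    also have "\<dots> = (C\<^sup>2 * prob (space \<zeta> - A l)) * s" by (simp add: power2_eq_square)
    also have "\<dots> \<le> \<epsilon> * (a b / D\<^sup>2) * s" using l s by (intro mult_right_mono) auto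
    finally show "T ?h x \<le> \<epsilon> * (a b / D\<^sup>2) * s" .
  qed auto
  also have "\<dots> = \<epsilon> * ((a b / D\<^sup>2) * (J (\<lambda>_. 1) * s))"
    unfolding positive_functional_const[OF J, of "\<epsilon> * (a b / D\<^sup>2) * s"] by simp
  also have "\<dots> \<le> \<epsilon> * J (surv (q + 3))"
    using good_renewal[OF assms(1), of q] \<epsilon> by (intro mult_left_mono) (auto simp: s_def)
  finally show ?thesis .
qed

text \<open>
  The minorization on \<open>A l\<close> allows to remove a multiple of \<open>1\<^bsub>A l\<^esub> \<zeta>\<close> from a law after one step, as long as the
  multiple does not exceed \<open>a l\<close> times the mass \<open>u\<close> gives to \<open>A l\<close>.
\<close>

lemma coupled_part:
  assumes u: "positive_functional \<zeta> u" and w: "0 \<le> w" "w \<le> u (indicator (A l))"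
  shows "positive_functional \<zeta> (\<lambda>f. u (T f) - a l * w * (\<integral>x. indicator (A l) x * f x \<partial>\<zeta>))"
  unfolding positive_functional_def
proof (intro conjI ballI allI impI)
  note uT = functional_T[OF u]
  fix f g assume fg: "f \<in> bfun \<zeta>" "g \<in> bfun \<zeta>"
  show "u (T (\<lambda>x. f x + g x)) - a l * w * (\<integral>x. indicator (A l) x * (f x + g x) \<partial>\<zeta>) =
    u (T f) - a l * w * (\<integral>x. indicator (A l) x * f x \<partial>\<zeta>) +
    (u (T g) - a l * w * (\<integral>x. indicator (A l) x * g x \<partial>\<zeta>))"
    unfolding distrib_left[of "indicator (A l) _"]
      positive_functional_add[OF expectation_functional ind_A_mult(1)[OF fg(1)] ind_A_mult(1)[OF fg(2)]]
    using fg by (simp add: positive_functional_add[OF uT] algebra_simps)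
next
  note uT = functional_T[OF u]
  fix d f assume f: "f \<in> bfun \<zeta>"
  show "u (T (\<lambda>x. d * f x)) - a l * w * (\<integral>x. indicator (A l) x * (d * f x) \<partial>\<zeta>) =
    d * (u (T f) - a l * w * (\<integral>x. indicator (A l) x * f x \<partial>\<zeta>))"
    using f by (simp add: positive_functional_cmult[OF uT] mult.left_commute[of _ d] algebra_simps)
next
  fix f assume f: "f \<in> bfun \<zeta>" "\<forall>x\<in>space \<zeta>. 0 \<le> f x"
  let ?q = "\<integral>x. indicator (A l) x * f x \<partial>\<zeta>"
  have q: "0 \<le> ?q" using f by (intro positive_functional_nonneg[OF expectation_functional]) auto
  have "a l * w * ?q \<le> (a l * ?q) * u (indicator (A l))"
    using mult_left_mono[OF w(2), of "a l * ?q"] q a_pos[of l] by (simp add: mult_ac)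
  also have "\<dots> = u (\<lambda>x. (a l * ?q) * indicator (A l) x)"
    by (simp add: positive_functional_cmult[OF u])
  also have "\<dots> \<le> u (T f)"
  proof (intro positive_functional_mono[OF u] bfun_cmult T_bfun f ind_bfun)
    fix x assume x: "x \<in> space \<zeta>"
    show "(a l * ?q) * indicator (A l) x \<le> T f x"
      using T_minor[OF f(1), of x l] f(2) T_nonneg[OF f(1) _ x] by (cases "x \<in> A l") auto
  qed
  finally show "0 \<le> u (T f) - a l * w * ?q" by simp
qed

text \<open>
  One step of a coupling argument at the level of functionals. The functionals \<open>u\<close> and \<open>v\<close> are the parts of two laws
  which have not met, normalised to have the same weight \<open>y\<close> against the probability of surviving to the
  horizon. The same multiple of \<open>1\<^bsub>A l\<^esub> \<zeta>\<close> is removed from both: this leaves their difference unchanged and keeps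
  the two weights equal. The removed weight is at least a fixed fraction of \<open>y - \<epsilon>\<close>, because at most \<open>\<epsilon>\<close> of the
  weight lies outside \<open>A l\<close>, inside the survival probability is at most \<open>C\<close> times its average, and the removed
  measure sees at least \<open>1 / D\<close> of that average.
\<close>

lemma coupling_step:
  assumes u: "positive_functional \<zeta> u" and v: "positive_functional \<zeta> v"
    and eq: "u (surv (Suc (Suc n))) = y" "v (surv (Suc (Suc n))) = y"
    and bl: "b \<le> l"
    and out: "u (\<lambda>x. indicator (space \<zeta> - A l) x * surv (Suc (Suc n)) x) \<le> \<epsilon>"
      "v (\<lambda>x. indicator (space \<zeta> - A l) x * surv (Suc (Suc n)) x) \<le> \<epsilon>"
  obtains u' v' where "positive_functional \<zeta> u'" "positive_functional \<zeta> v'"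
    "\<And>f. f \<in> bfun \<zeta> \<Longrightarrow> u' f - v' f = u (T f) - v (T f)"
    "\<And>f. f \<in> bfun \<zeta> \<Longrightarrow> (\<And>x. x \<in> space \<zeta> \<Longrightarrow> 0 \<le> f x) \<Longrightarrow> u' f \<le> u (T f)"
    "\<And>f. f \<in> bfun \<zeta> \<Longrightarrow> (\<And>x. x \<in> space \<zeta> \<Longrightarrow> 0 \<le> f x) \<Longrightarrow> v' f \<le> v (T f)"
    "u' (surv (Suc n)) = v' (surv (Suc n))"
    "u' (surv (Suc n)) \<le> y"
    "u' (surv (Suc n)) - \<epsilon> \<le> (1 - a l / (C * D)) * (y - \<epsilon>)"
proof -
  define w where "w = min (u (indicator (A l))) (v (indicator (A l)))"
  have w: "0 \<le> w" "w \<le> u (indicator (A l))" "w \<le> v (indicator (A l))"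
    using positive_functional_nonneg[OF u, of "indicator (A l)"]
      positive_functional_nonneg[OF v, of "indicator (A l)"]
    by (auto simp: w_def)
  let ?q = "\<lambda>f. \<integral>x. indicator (A l) x * f x \<partial>\<zeta>"
  define u' where "u' f = u (T f) - a l * w * ?q f" for f
  define v' where "v' f = v (T f) - a l * w * ?q f" for f
  define s where "s = (\<integral>x. surv (Suc n) x \<partial>\<zeta>)"
  have s: "0 \<le> s" unfolding s_def
    by (rule positive_functional_nonneg[OF expectation_functional]) (auto intro: surv_nonneg)
  have q0: "0 \<le> ?q f" if "f \<in> bfun \<zeta>" "\<And>x. x \<in> space \<zeta> \<Longrightarrow> 0 \<le> f x" for f
    using that by (intro positive_functional_nonneg[OF expectation_functional]) auto
  have le: "a l * w * ?q f \<ge> 0" if "f \<in> bfun \<zeta>" "\<And>x. x \<in> space \<zeta> \<Longrightarrow> 0 \<le> f x" for f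
    using q0[OF that] w(1) a_pos[of l] by (intro mult_nonneg_nonneg) auto
  have lower: "y - \<epsilon> \<le> C * s * I (indicator (A l))"
    if I: "positive_functional \<zeta> I" and "I (surv (Suc (Suc n))) = y"
      and "I (\<lambda>x. indicator (space \<zeta> - A l) x * surv (Suc (Suc n)) x) \<le> \<epsilon>" for I
  proof -
    have "y - \<epsilon> \<le> I (\<lambda>x. indicator (A l) x * surv (Suc (Suc n)) x)"
      using positive_functional_split[OF I surv_bfun A_sets, of "Suc (Suc n)" l] that by simp
    also have "\<dots> \<le> I (\<lambda>x. (C * s) * indicator (A l) x)"
      using surv_Suc_upper[of _ "Suc n"]
      by (intro positive_functional_mono[OF I] bfun_cmult ind_A_mult ind_bfun)
         (auto simp: s_def indicator_def split: if_splits)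
    also have "\<dots> = C * s * I (indicator (A l))" by (rule positive_functional_cmult[OF I]) auto
    finally show ?thesis .
  qed
  have lw: "y - \<epsilon> \<le> C * s * w"
    using lower[OF u eq(1) out(1)] lower[OF v eq(2) out(2)] by (auto simp: w_def min_def)
  have sq: "s \<le> D * ?q (surv (Suc n))"
  proof -
    have "s \<le> (\<integral>x. surv n x \<partial>\<zeta>)" unfolding s_def
      by (rule positive_functional_mono[OF expectation_functional]) (auto intro: surv_Suc_le)
    also have "\<dots> \<le> D * (\<integral>x. indicator (A b) x * surv (Suc n) x \<partial>\<zeta>)" by (rule core_mass_surv)
    also have "(\<integral>x. indicator (A b) x * surv (Suc n) x \<partial>\<zeta>) \<le> ?q (surv (Suc n))"
      using A_incseq bl
      by (intro positive_functional_mono[OF expectation_functional] ind_A_mult surv_bfun)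
         (auto intro!: mult_right_mono surv_nonneg simp: indicator_def incseq_def)
    finally show ?thesis using D_pos by simp
  qed
  have "a l / (C * D) * (y - \<epsilon>) \<le> a l / (C * D) * (C * s * w)"
    using lw a_pos[of l] C_pos D_pos by (intro mult_left_mono) auto
  also have "\<dots> = a l * w / D * s" using C_pos by (simp add: field_simps)
  also have "\<dots> \<le> a l * w / D * (D * ?q (surv (Suc n)))"
    using sq a_pos[of l] w(1) D_pos by (intro mult_left_mono) auto
  also have "\<dots> = a l * w * ?q (surv (Suc n))" using D_pos by simp
  finally have drop: "a l / (C * D) * (y - \<epsilon>) \<le> a l * w * ?q (surv (Suc n))" .
  show ?thesis
  proof (rule that[of u' v'])
    show "positive_functional \<zeta> u'" unfolding u'_def by (rule coupled_part[OF u w(1,2)])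
    show "positive_functional \<zeta> v'" unfolding v'_def by (rule coupled_part[OF v w(1,3)])
    show "u' f - v' f = u (T f) - v (T f)" for f by (simp add: u'_def v'_def)
    show "u' f \<le> u (T f)" "v' f \<le> v (T f)" if "f \<in> bfun \<zeta>" "\<And>x. x \<in> space \<zeta> \<Longrightarrow> 0 \<le> f x" for f
      using le[OF that] by (auto simp: u'_def v'_def)
    show "u' (surv (Suc n)) = v' (surv (Suc n))" using eq by (simp add: u'_def v'_def surv_Suc)
    have u'y: "u' (surv (Suc n)) = y - a l * w * ?q (surv (Suc n))" using eq by (simp add: u'_def surv_Suc)
    show "u' (surv (Suc n)) \<le> y" using le[of "surv (Suc n)"] surv_nonneg by (auto simp: u'y)
    show "u' (surv (Suc n)) - \<epsilon> \<le> (1 - a l / (C * D)) * (y - \<epsilon>)"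
      using drop by (simp add: u'y algebra_simps)
  qed
qed

lemma good_scale:
  assumes "good I" "0 \<le> r" shows "good (\<lambda>f. r * I f)"
proof -
  have "r * I (\<lambda>_. 1) \<le> r * (D * I \<psi>)"
    using assms by (intro mult_left_mono) (auto simp: good_def)
  then show ?thesis
    using assms by (auto simp: good_def positive_functional_def algebra_simps)
qed

text \<open>
  Iteration of \<open>coupling_step\<close> for two good laws normalised to survive to time \<open>n + 1\<close>. The uncoupled parts
  are dominated by the full laws, which is what makes \<open>good_outside\<close> applicable to them although they need
  not be good themselves. That estimate requires at least one step of the past, so no weight is removed in
  the first step, and the exponent is \<open>k - 1\<close>.
\<close>

lemma coupling:
  assumes "good I" "good I'" "I (surv (Suc n)) = 1" "I' (surv (Suc n)) = 1"
    and bl: "b \<le> l" and l: "C\<^sup>2 * prob (space \<zeta> - A l) \<le> \<epsilon> * (a b / D\<^sup>2)" and \<epsilon>: "0 < \<epsilon>"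
    and \<delta>: "a l / (C * D) \<le> 1"
  shows "k \<le> n \<Longrightarrow> \<exists>u v. positive_functional \<zeta> u \<and> positive_functional \<zeta> v \<and>
    (\<forall>f\<in>bfun \<zeta>. u f - v f = I ((T ^^ k) f) - I' ((T ^^ k) f)) \<and>
    (\<forall>f\<in>bfun \<zeta>. (\<forall>x\<in>space \<zeta>. 0 \<le> f x) \<longrightarrow> u f \<le> I ((T ^^ k) f) \<and> v f \<le> I' ((T ^^ k) f)) \<and>
    u (surv (Suc n - k)) = v (surv (Suc n - k)) \<and>
    u (surv (Suc n - k)) \<le> \<epsilon> + (1 - a l / (C * D)) ^ (k - 1)"
proof (induction k)
  case 0
  show ?case
    using assms(1-4) \<epsilon> by (intro exI[of _ I] exI[of _ I']) (auto simp: good_def)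
next
  case (Suc k)
  let ?r = "1 - a l / (C * D)"
  obtain u v where uv: "positive_functional \<zeta> u" "positive_functional \<zeta> v"
    "\<And>f. f \<in> bfun \<zeta> \<Longrightarrow> u f - v f = I ((T ^^ k) f) - I' ((T ^^ k) f)"
    "\<And>f. f \<in> bfun \<zeta> \<Longrightarrow> (\<forall>x\<in>space \<zeta>. 0 \<le> f x) \<Longrightarrow> u f \<le> I ((T ^^ k) f)"
    "\<And>f. f \<in> bfun \<zeta> \<Longrightarrow> (\<forall>x\<in>space \<zeta>. 0 \<le> f x) \<Longrightarrow> v f \<le> I' ((T ^^ k) f)"
    "u (surv (Suc n - k)) = v (surv (Suc n - k))"
    "u (surv (Suc n - k)) \<le> \<epsilon> + ?r ^ (k - 1)"
    using Suc by auto
  obtain q where q: "n = k + q + 1" using Suc.prems by (metis Suc_eq_plus1 Suc_le_eq add_Suc_right less_iff_Suc_add)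
  have nk: "Suc n - k = Suc (Suc q)" "Suc n - Suc k = Suc q" by (auto simp: q)
  define y where "y = u (surv (Suc (Suc q)))"
  define h where "h = (\<lambda>x. indicator (space \<zeta> - A l) x * surv (Suc (Suc q)) x)"
  show ?case
  proof (cases "k = 0")
    case True
    have "u (T f) - v (T f) = I (T f) - I' (T f)" if "f \<in> bfun \<zeta>" for f
      using uv(3)[OF T_bfun[OF that]] True by simp
    have *: "good (\<lambda>f. I (T f))" "good (\<lambda>f. I' (T f))" using good_T assms(1,2) by auto
    have "I (T (surv n)) = 1" "I' (T (surv n)) = 1"
      using assms(3,4) by (simp_all add: surv_Suc)
    with * show ?thesis using True \<epsilon>
      by (intro exI[of _ "\<lambda>f. I (T f)"] exI[of _ "\<lambda>f. I' (T f)"]) (auto simp: good_def)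
  next
    case False
    then obtain j where j: "k = Suc j" by (cases k) auto
    have h: "h \<in> bfun \<zeta>" "\<forall>x\<in>space \<zeta>. 0 \<le> h x"
      unfolding h_def by (auto intro!: ind_mult_nonneg surv_nonneg)
    have tail: "I ((T ^^ k) h) \<le> \<epsilon>" if "good I" "I (surv (Suc n)) = 1" for I
      using good_outside[OF good_iter[OF that(1), of j] l \<epsilon>, of q] that(2)
      by (simp add: h_def j iter_Suc_inner surv_add q numeral_3_eq_3 add.commute add.left_commute
          del: funpow.simps)
    have out: "u h \<le> \<epsilon>" "v h \<le> \<epsilon>"
      using uv(4)[OF h] uv(5)[OF h] tail[OF assms(1,3)] tail[OF assms(2,4)] by auto
    obtain u' v' where u'v': "positive_functional \<zeta> u'" "positive_functional \<zeta> v'"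
      "\<And>f. f \<in> bfun \<zeta> \<Longrightarrow> u' f - v' f = u (T f) - v (T f)"
      "\<And>f. f \<in> bfun \<zeta> \<Longrightarrow> (\<And>x. x \<in> space \<zeta> \<Longrightarrow> 0 \<le> f x) \<Longrightarrow> u' f \<le> u (T f)"
      "\<And>f. f \<in> bfun \<zeta> \<Longrightarrow> (\<And>x. x \<in> space \<zeta> \<Longrightarrow> 0 \<le> f x) \<Longrightarrow> v' f \<le> v (T f)"
      "u' (surv (Suc q)) = v' (surv (Suc q))"
      "u' (surv (Suc q)) \<le> y"
      "u' (surv (Suc q)) - \<epsilon> \<le> ?r * (y - \<epsilon>)"
      using uv(6) y_def nk out
      by (rule_tac coupling_step[OF uv(1,2), of q y l \<epsilon>]) (auto simp: bl h_def)
    have "u' (surv (Suc q)) - \<epsilon> \<le> ?r * (y - \<epsilon>)" by fact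
    also have "\<dots> \<le> ?r * ?r ^ (k - 1)"
      using uv(7) \<delta> by (intro mult_left_mono) (auto simp: y_def nk)
    also have "\<dots> = ?r ^ (Suc k - 1)" by (simp add: j)
    finally have 1: "u' (surv (Suc q)) \<le> \<epsilon> + ?r ^ (Suc k - 1)" by simp
    have 2: "u' f - v' f = I ((T ^^ Suc k) f) - I' ((T ^^ Suc k) f)" if "f \<in> bfun \<zeta>" for f
      using u'v'(3)[OF that] uv(3)[OF T_bfun[OF that]] by (simp add: iter_Suc_inner del: funpow.simps)
    have 3: "u' f \<le> I ((T ^^ Suc k) f) \<and> v' f \<le> I' ((T ^^ Suc k) f)"
      if f: "f \<in> bfun \<zeta>" "\<forall>x\<in>space \<zeta>. 0 \<le> f x" for f
    proof -
      have Tf: "T f \<in> bfun \<zeta>" "\<forall>x\<in>space \<zeta>. 0 \<le> T f x" using f by (auto intro: T_bfun T_nonneg)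
      show ?thesis
        using u'v'(4,5)[of f] f uv(4)[OF Tf] uv(5)[OF Tf]
        by (auto simp: iter_Suc_inner simp del: funpow.simps intro: order_trans)
    qed
    show ?thesis
      using u'v'(1,2,6) 1 2 3 unfolding nk by blast
  qed
qed

text \<open>
  The law at time \<open>n\<close> conditioned on survival, as a functional.
\<close>

definition profile :: "(('a \<Rightarrow> real) \<Rightarrow> real) \<Rightarrow> nat \<Rightarrow> ('a \<Rightarrow> real) \<Rightarrow> real" where
  "profile I n f = I ((T ^^ n) f) / I (surv n)"

lemma profile_shift: "profile I (n + k) f = profile (\<lambda>f. I ((T ^^ k) f)) n f"
  by (simp add: profile_def surv_add add.commute[of n k] funpow_add)

lemma a_le_C:
  assumes "b \<le> l" shows "a l \<le> C"
proof -
  have "prob (A b) \<le> prob (A l)"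
    using A_incseq assms by (intro finite_measure_mono) (auto simp: incseq_def A_sets)
  then have pos: "0 < prob (A l)" using core_pos by simp
  then obtain x where x: "x \<in> A l" by fastforce
  have int: "(\<integral>y. indicator (A l) y * 1 \<partial>\<zeta>) = prob (A l)"
    using A_sets[of l] by (simp add: Int_absorb1 sets.sets_into_space)
  have "a l * prob (A l) \<le> T (indicator (A l)) x"
    using T_minor[of "indicator (A l)" x l] x int A_sets[of l]
    by (simp add: indicator_inter_arith[symmetric] Int_absorb1 sets.sets_into_space)
  also have "\<dots> \<le> C * prob (A l)"
    using T_upper[of "indicator (A l)" x] A_sub[OF x] A_sets[of l]
    by (simp add: Int_absorb1 sets.sets_into_space)
  finally show ?thesis using pos by simp
qed

lemma D_ge_1: "1 \<le> D"
proof -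
  obtain x where x: "x \<in> A m" using prob_A_m by fastforce
  have "c \<le> 1" using \<psi>_ge_c[OF A_sub[OF x]] \<psi>_le_1[OF A_sub[OF x]] x by simp
  then show ?thesis using c_pos by (simp add: D_def)
qed

definition unit_bfun :: "('a \<Rightarrow> real) set" where
  "unit_bfun = {f \<in> bfun \<zeta>. \<forall>x\<in>space \<zeta>. 0 \<le> f x \<and> f x \<le> 1}"

text \<open>
  Whatever is left uncoupled bounds the difference of the two conditioned laws. First \<open>l\<close> is chosen to make
  the outside contribution at most \<open>\<epsilon> / 2\<close>, then \<open>N\<close> to make the geometric term at most \<open>\<epsilon> / 2\<close>. The bound is
  uniform over all good laws; in particular it applies to the iterates of a single one, which gives the
  Cauchy property.
\<close>

lemma good_profiles_merge:
  assumes \<epsilon>: "0 < \<epsilon>"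
  shows "\<exists>N. \<forall>n\<ge>N. \<forall>I I'. good I \<longrightarrow> good I' \<longrightarrow> 0 < I (\<lambda>_. 1) \<longrightarrow> 0 < I' (\<lambda>_. 1) \<longrightarrow>
    (\<forall>f\<in>unit_bfun. \<bar>profile I n f - profile I' n f\<bar> \<le> \<epsilon>)"
proof -
  have "0 < (\<epsilon> / 2) * (a b / D\<^sup>2) / C\<^sup>2" using \<epsilon> a_pos D_pos C_pos by simp
  from eventually_conj[OF prob_compl_A_eventually_less[OF this] eventually_ge_at_top[of b]]
  obtain l where l0: "prob (space \<zeta> - A l) < (\<epsilon> / 2) * (a b / D\<^sup>2) / C\<^sup>2" and bl: "b \<le> l"
    by (metis (mono_tags, lifting) eventually_happens' sequentially_bot)
  have "prob (space \<zeta> - A l) * C\<^sup>2 < (\<epsilon> / 2) * (a b / D\<^sup>2)"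
    using l0 C_pos by (subst pos_less_divide_eq[symmetric]) auto
  then have l: "C\<^sup>2 * prob (space \<zeta> - A l) \<le> (\<epsilon> / 2) * (a b / D\<^sup>2)"
    by (simp add: mult.commute)
  have \<delta>: "a l / (C * D) \<le> 1"
    using mult_mono[OF a_le_C[OF bl] D_ge_1] C_pos D_pos by simp
  define r where "r = 1 - a l / (C * D)"
  have r: "0 \<le> r" "r < 1" using \<delta> a_pos[of l] C_pos D_pos by (auto simp: r_def)
  have "\<forall>\<^sub>F n in sequentially. r ^ n < \<epsilon> / 2"
    using LIMSEQ_realpow_zero[OF r] \<epsilon> by (intro order_tendstoD) auto
  then obtain N where N: "\<And>n. N \<le> n \<Longrightarrow> r ^ n < \<epsilon> / 2" by (auto simp: eventually_sequentially)
  show ?thesis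
  proof (intro exI[of _ "N + 2"] allI impI ballI)
    fix n I0 I0' f
    assume n: "N + 2 \<le> n" and good: "good I0" "good I0'" and pos: "0 < I0 (\<lambda>_. 1)" "0 < I0' (\<lambda>_. 1)"
      and "f \<in> unit_bfun"
    then have f: "f \<in> bfun \<zeta>" "\<And>x. x \<in> space \<zeta> \<Longrightarrow> 0 \<le> f x \<and> f x \<le> 1"
      by (auto simp: unit_bfun_def)
    obtain p where p: "n = Suc p" "p - 1 \<ge> N" using n by (cases n) auto
    define I where "I f = (1 / I0 (surv n)) * I0 f" for f
    define I' where "I' f = (1 / I0' (surv n)) * I0' f" for f
    have sp: "0 < I0 (surv n)" "0 < I0' (surv n)" using good_surv_pos good pos by auto
    have g: "good I" "good I'" unfolding I_def I'_def using good sp by (intro good_scale; simp)+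
    have s1: "I (surv (Suc p)) = 1" "I' (surv (Suc p)) = 1" using sp by (auto simp: I_def I'_def p)
    obtain u v where uv: "positive_functional \<zeta> u" "positive_functional \<zeta> v"
      "\<And>f. f \<in> bfun \<zeta> \<Longrightarrow> u f - v f = I ((T ^^ p) f) - I' ((T ^^ p) f)"
      "u (surv 1) = v (surv 1)" "u (surv 1) \<le> \<epsilon> / 2 + r ^ (p - 1)"
      using coupling[OF g s1 bl l _ \<delta>, of p] \<epsilon> by (auto simp: r_def)
    have small: "u (surv 1) \<le> \<epsilon>" using uv(5) N[OF p(2)] by simp
    have bd: "0 \<le> w (T f) \<and> w (T f) \<le> w (surv 1)" if w: "positive_functional \<zeta> w" for w
      using f by (auto simp: surv_def intro!: positive_functional_nonneg[OF functional_T[OF w]]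
          positive_functional_mono[OF functional_T[OF w]])
    have "profile I0 n f - profile I0' n f = I ((T ^^ p) (T f)) - I' ((T ^^ p) (T f))"
      by (simp add: profile_def I_def I'_def p iter_Suc_inner del: funpow.simps)
    also have "\<dots> = u (T f) - v (T f)" using uv(3)[OF T_bfun[OF f(1)]] by simp
    finally show "\<bar>profile I0 n f - profile I0' n f\<bar> \<le> \<epsilon>"
      using bd[OF uv(1)] bd[OF uv(2)] uv(4) small by linarith
  qed
qed

section \<open>Limits of conditioned laws\<close>

lemma integral_\<psi>_pos:
  assumes "prob_space \<mu>" "sets \<mu> = sets \<zeta>" shows "0 < (\<integral>x. \<psi> x \<partial>\<mu>)"
proof -
  interpret \<mu>: prob_space \<mu> by fact
  have sp: "space \<mu> = space \<zeta>" using assms(2) by (rule sets_eq_imp_space_eq)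
  have int: "integrable \<mu> \<psi>" by (rule bfun_integrable[OF \<mu>.finite_measure_axioms _ assms(2)]) auto
  have nn: "AE x in \<mu>. 0 \<le> \<psi> x" using \<psi>_pos by (intro AE_I2) (auto simp: sp intro: less_imp_le)
  have "(\<integral>x. \<psi> x \<partial>\<mu>) \<noteq> 0"
  proof
    assume "(\<integral>x. \<psi> x \<partial>\<mu>) = 0"
    then have "AE x in \<mu>. \<psi> x = 0" using integral_nonneg_eq_0_iff_AE[OF int nn] by simp
    moreover have "AE x in \<mu>. \<psi> x \<noteq> 0" by (intro AE_I2) (metis sp \<psi>_pos less_irrefl)
    ultimately have "AE x in \<mu>. False" by eventually_elim simp
    then show False using \<mu>.not_empty by (simp add: \<mu>.AE_False)
  qed
  moreover have "0 \<le> (\<integral>x. \<psi> x \<partial>\<mu>)" using nn by (rule integral_nonneg_AE)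
  ultimately show ?thesis by simp
qed

text \<open>
  If the conditioned laws of \<open>I'\<close> do not change with time, their common value \<open>\<kappa>\<close> attracts all \<open>I\<close>. The two
  laws may need different times to become good; for \<open>I'\<close> the time shift is invisible.
\<close>

lemma profile_tendsto_stationary:
  assumes I: "positive_functional \<zeta> I" "0 < I \<psi>" and I': "positive_functional \<zeta> I'" "0 < I' \<psi>"
    and F: "F \<subseteq> unit_bfun" and stat: "\<And>n f. f \<in> F \<Longrightarrow> profile I' n f = \<kappa> f"
    and \<epsilon>: "0 < \<epsilon>"
  shows "\<exists>N. \<forall>n\<ge>N. \<forall>f\<in>F. \<bar>profile I n f - \<kappa> f\<bar> \<le> \<epsilon>"
proof -
  obtain k where k: "good (\<lambda>f. I ((T ^^ k) f))" by (rule eventually_good[OF I])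
  obtain k' where k': "good (\<lambda>f. I' ((T ^^ k') f))" by (rule eventually_good[OF I'])
  have pos: "0 < I ((T ^^ k) (\<lambda>_. 1))" "0 < I' ((T ^^ k') (\<lambda>_. 1))"
    using functional_surv_pos[OF I, of k] functional_surv_pos[OF I', of k'] by (auto simp: surv_def)
  obtain N where N: "\<forall>n\<ge>N. \<forall>I I'. good I \<longrightarrow> good I' \<longrightarrow> 0 < I (\<lambda>_. 1) \<longrightarrow> 0 < I' (\<lambda>_. 1) \<longrightarrow>
    (\<forall>f\<in>unit_bfun. \<bar>profile I n f - profile I' n f\<bar> \<le> \<epsilon>)"
    using good_profiles_merge[OF \<epsilon>] by (rule exE)
  show ?thesis
  proof (intro exI[of _ "N + k"] allI impI ballI)
    fix n f assume n: "N + k \<le> n" and f: "f \<in> F"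
    have "\<bar>profile (\<lambda>f. I ((T ^^ k) f)) (n - k) f - profile (\<lambda>f. I' ((T ^^ k') f)) (n - k) f\<bar> \<le> \<epsilon>"
      using n f F by (intro N[rule_format] k k' pos) auto
    then show "\<bar>profile I n f - \<kappa> f\<bar> \<le> \<epsilon>"
      using n stat[OF f, of "n - k + k'"]
      by (simp add: profile_shift[symmetric])
  qed
qed

lemma profile_functional:
  assumes "positive_functional \<zeta> I" "0 < I \<psi>"
  shows "positive_functional \<zeta> (\<lambda>f. profile I n f)"
  using functional_iter[OF assms(1), of n] functional_surv_pos[OF assms, of n]
  by (auto simp: positive_functional_def profile_def add_divide_distrib)

lemma profile_one: "positive_functional \<zeta> I \<Longrightarrow> 0 < I \<psi> \<Longrightarrow> profile I n (\<lambda>_. 1) = 1"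
  using functional_surv_pos[of I n] by (simp add: profile_def surv_def)

text \<open>
  By \<open>profile_shift\<close>, two late profiles of \<open>I\<close> are profiles at the same time \<open>N\<close> of two iterates of \<open>I\<close>, all of
  which are good. A general bounded function is reduced to values in \<open>[0, 1]\<close> by an affine change.
\<close>

lemma profile_convergent:
  assumes I: "good I" "0 < I (\<lambda>_. 1)" and f: "f \<in> bfun \<zeta>"
  shows "convergent (\<lambda>n. profile I n f)"
proof -
  have P: "positive_functional \<zeta> (\<lambda>f. profile I n f)" for n
    by (rule profile_functional[OF good_functional[OF I(1)] good_\<psi>_pos[OF I]])
  have one: "profile I n (\<lambda>_. 1) = 1" for n
    by (rule profile_one[OF good_functional[OF I(1)] good_\<psi>_pos[OF I]])
  have unit: "convergent (\<lambda>n. profile I n h)" if h: "h \<in> unit_bfun" for h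
  proof -
    have "Cauchy (\<lambda>n. profile I n h)"
    proof (rule metric_CauchyI)
      fix e :: real assume "0 < e"
      then have e2: "0 < e / 2" by simp
      obtain N where N: "\<forall>n\<ge>N. \<forall>I I'. good I \<longrightarrow> good I' \<longrightarrow> 0 < I (\<lambda>_. 1) \<longrightarrow> 0 < I' (\<lambda>_. 1) \<longrightarrow>
        (\<forall>f\<in>unit_bfun. \<bar>profile I n f - profile I' n f\<bar> \<le> e / 2)"
        using good_profiles_merge[OF e2] by (rule exE)
      show "\<exists>M. \<forall>m\<ge>M. \<forall>n\<ge>M. dist (profile I m h) (profile I n h) < e"
      proof (intro exI[of _ N] allI impI)
        fix i j assume ij: "N \<le> i" "N \<le> j"
        have "\<bar>profile (\<lambda>f. I ((T ^^ (i - N)) f)) N h - profile (\<lambda>f. I ((T ^^ (j - N)) f)) N h\<bar> \<le> e / 2"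
          using good_surv_pos[OF I] by (intro N[rule_format] good_iter I h) (auto simp: surv_def)
        then show "dist (profile I i h) (profile I j h) < e"
          using ij \<open>0 < e\<close> profile_shift[of I N "i - N" h] profile_shift[of I N "j - N" h]
          by (simp add: dist_real_def)
      qed
    qed
    then show ?thesis by (rule Cauchy_convergent)
  qed
  obtain r where r: "\<forall>x\<in>space \<zeta>. \<bar>f x\<bar> \<le> r" using f by (auto simp: bfun_def)
  define d where "d = max r 1"
  have d: "0 < d" "\<forall>x\<in>space \<zeta>. \<bar>f x\<bar> \<le> d" using r by (auto simp: d_def)
  define h where "h = (\<lambda>x. (1 / (2 * d)) * f x + 1 / 2)"
  have h: "h \<in> bfun \<zeta>" unfolding h_def using f by (intro bfun_add bfun_cmult) auto
  have "0 \<le> h x \<and> h x \<le> 1" if "x \<in> space \<zeta>" for x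
  proof -
    have "- d \<le> f x" "f x \<le> d" using d(2) that by (auto simp: abs_le_iff)
    then have "- 1 / 2 \<le> f x / (2 * d)" "f x / (2 * d) \<le> 1 / 2"
      using d(1) by (simp_all add: pos_le_divide_eq pos_divide_le_eq)
    then show ?thesis by (simp add: h_def)
  qed
  then have conv: "convergent (\<lambda>n. profile I n h)" using h by (intro unit) (auto simp: unit_bfun_def)
  have "profile I n f = 2 * d * profile I n h - d" for n
  proof -
    have "2 * d * h x - d = f x" for x
      using d(1) by (simp add: h_def distrib_left)
    then have "f = (\<lambda>x. 2 * d * h x - d)" by simp
    then have "profile I n f = profile I n (\<lambda>x. 2 * d * h x - d)" by (rule arg_cong)
    moreover have "profile I n (\<lambda>x. 2 * d * h x - d) = profile I n (\<lambda>x. 2 * d * h x) - profile I n (\<lambda>_. d)"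
      by (rule positive_functional_diff[OF P bfun_cmult[OF h] bfun_const])
    moreover have "profile I n (\<lambda>x. 2 * d * h x) = 2 * d * profile I n h"
      by (rule positive_functional_cmult[OF P h])
    moreover have "profile I n (\<lambda>_. d) = d"
      by (subst positive_functional_const[OF P]) (simp add: one)
    ultimately show ?thesis by linarith
  qed
  moreover obtain L where "(\<lambda>n. profile I n h) \<longlonglongrightarrow> L" using conv by (auto simp: convergent_def)
  then have "(\<lambda>n. 2 * d * profile I n h - d) \<longlonglongrightarrow> 2 * d * L - d" by (intro tendsto_intros)
  ultimately show ?thesis by (auto simp: convergent_def)
qed

lemma profile_dominated:
  assumes I: "good I" "0 < I (\<lambda>_. 1)" and f: "f \<in> bfun \<zeta>" "\<And>x. x \<in> space \<zeta> \<Longrightarrow> 0 \<le> f x"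
  shows "profile I (Suc n) f \<le> (C * D / \<beta>) * (\<integral>x. f x \<partial>\<zeta>)"
proof -
  let ?J = "\<lambda>f. I ((T ^^ n) f)"
  have J: "good ?J" by (rule good_iter[OF I(1)])
  note Jp = good_functional[OF J]
  have sp: "0 < I (surv n)" "0 < I (surv (Suc n))" using good_surv_pos[OF I] by auto
  have Z0: "0 \<le> (\<integral>x. f x \<partial>\<zeta>)" by (rule positive_functional_nonneg[OF expectation_functional f])
  have "?J (T f) \<le> ?J (\<lambda>_. C * (\<integral>x. f x \<partial>\<zeta>))"
    by (rule positive_functional_mono[OF Jp]) (auto intro: T_bfun T_upper f)
  also have "\<dots> = C * (\<integral>x. f x \<partial>\<zeta>) * I (surv n)"
    unfolding positive_functional_const[OF Jp, of "C * (\<integral>x. f x \<partial>\<zeta>)"] by (simp add: surv_def)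
  finally have 1: "?J (T f) \<le> C * (\<integral>x. f x \<partial>\<zeta>) * I (surv n)" .
  have "(\<beta> / D) * I (surv n) \<le> I (surv (Suc n))"
    using good_mass_decay[OF J] by (simp add: surv_def iter_Suc_inner del: funpow.simps)
  then have 2: "I (surv n) \<le> (D / \<beta>) * I (surv (Suc n))" using D_pos \<beta>_pos by (simp add: field_simps)
  have "?J (T f) \<le> C * (\<integral>x. f x \<partial>\<zeta>) * ((D / \<beta>) * I (surv (Suc n)))"
    using 1 mult_left_mono[OF 2, of "C * (\<integral>x. f x \<partial>\<zeta>)"] Z0 C_pos by simp
  then show ?thesis
    using sp by (simp add: profile_def iter_Suc_inner field_simps del: funpow.simps)
qed

text \<open>
  The limit \<open>J\<close> of the profiles started from a good iterate of \<open>\<zeta>\<close> inherits the uniform density bound, hence it is integration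
  against a probability measure. The cocycle identity
  \<open>profile I i (T\<^sup>n f) = profile I (i + n) f * profile I i (surv n)\<close> passes to the limit and says that \<open>J\<close> is
  invariant under conditioning.
\<close>

theorem quasi_stationary_measure_exists:
  "\<exists>\<alpha>. prob_space \<alpha> \<and> sets \<alpha> = sets \<zeta> \<and>
    (\<forall>n. \<forall>f\<in>bfun \<zeta>. (\<integral>x. (T ^^ n) f x \<partial>\<alpha>) = (\<integral>x. f x \<partial>\<alpha>) * (\<integral>x. surv n x \<partial>\<alpha>))"
proof -
  let ?Z = "\<lambda>f. \<integral>x. f x \<partial>\<zeta>"
  obtain k where k: "good (\<lambda>f. ?Z ((T ^^ k) f))"
    by (rule eventually_good[OF expectation_functional integral_\<psi>_pos[OF prob_space_axioms refl]])
  define I where "I f = ?Z ((T ^^ k) f)" for f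
  have I: "good I" "0 < I (\<lambda>_. 1)"
    using k functional_surv_pos[OF expectation_functional integral_\<psi>_pos[OF prob_space_axioms refl], of k]
    by (auto simp: I_def[abs_def] surv_def)
  note Ip = good_functional[OF I(1)] and I\<psi> = good_\<psi>_pos[OF I]
  define J where "J f = lim (\<lambda>n. profile I n f)" for f
  have J: "(\<lambda>n. profile I n f) \<longlonglongrightarrow> J f" if "f \<in> bfun \<zeta>" for f
    unfolding J_def using profile_convergent[OF I that] by (simp add: convergent_LIMSEQ_iff)
  note P = profile_functional[OF Ip I\<psi>]
  have Jp: "positive_functional \<zeta> J"
    unfolding positive_functional_def
  proof (intro conjI ballI allI impI)
    fix f g assume fg: "f \<in> bfun \<zeta>" "g \<in> bfun \<zeta>"
    have "(\<lambda>n. profile I n (\<lambda>x. f x + g x)) \<longlonglongrightarrow> J f + J g"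
      unfolding positive_functional_add[OF P fg] by (intro tendsto_add J fg)
    then show "J (\<lambda>x. f x + g x) = J f + J g"
      by (rule LIMSEQ_unique[OF J[OF bfun_add[OF fg]]])
  next
    fix d f assume f: "f \<in> bfun \<zeta>"
    have "(\<lambda>n. profile I n (\<lambda>x. d * f x)) \<longlonglongrightarrow> d * J f"
      unfolding positive_functional_cmult[OF P f] by (intro tendsto_mult_left J f)
    then show "J (\<lambda>x. d * f x) = d * J f"
      by (rule LIMSEQ_unique[OF J[OF bfun_cmult[OF f]]])
  next
    fix f assume f: "f \<in> bfun \<zeta>" "\<forall>x\<in>space \<zeta>. 0 \<le> f x"
    show "0 \<le> J f"
      by (rule LIMSEQ_le_const[OF J[OF f(1)]])
         (use f in \<open>auto intro!: positive_functional_nonneg[OF P]\<close>)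
  qed
  have dom: "J f \<le> (C * D / \<beta>) * ?Z f"
    if f: "f \<in> bfun \<zeta>" "\<And>x. x \<in> space \<zeta> \<Longrightarrow> 0 \<le> f x" for f
    by (rule LIMSEQ_le_const2[OF LIMSEQ_Suc[OF J[OF f(1)]]])
       (use profile_dominated[OF I f] in auto)
  have "\<exists>\<alpha>. sets \<alpha> = sets \<zeta> \<and> finite_measure \<alpha> \<and> (\<forall>f\<in>bfun \<zeta>. J f = (\<integral>x. f x \<partial>\<alpha>))"
    by (rule positive_functional_representation[OF finite_measure_axioms Jp]) (rule dom)
  then obtain \<alpha> where \<alpha>: "sets \<alpha> = sets \<zeta>" "finite_measure \<alpha>" "\<And>f. f \<in> bfun \<zeta> \<Longrightarrow> J f = (\<integral>x. f x \<partial>\<alpha>)"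
    by blast
  interpret \<alpha>: finite_measure \<alpha> by fact
  have "(\<lambda>n. profile I n (\<lambda>_. 1)) \<longlonglongrightarrow> 1" unfolding profile_one[OF Ip I\<psi>] by (rule tendsto_const)
  then have "J (\<lambda>_. 1) = 1" by (rule LIMSEQ_unique[OF J[OF bfun_const]])
  then have "measure \<alpha> (space \<alpha>) = 1" using \<alpha>(3)[OF bfun_const, of 1] by simp
  then have prob: "prob_space \<alpha>"
    by (intro prob_spaceI) (simp add: \<alpha>.emeasure_eq_measure)
  have "J ((T ^^ n) f) = J f * J (surv n)" if f: "f \<in> bfun \<zeta>" for n f
  proof -
    have "profile I i ((T ^^ n) f) = profile I (i + n) f * profile I i (surv n)" for i
      using good_surv_pos[OF I, of "i + n"]
      by (simp add: profile_def surv_add funpow_add)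
    moreover have "(\<lambda>i. profile I (i + n) f * profile I i (surv n)) \<longlonglongrightarrow> J f * J (surv n)"
      by (intro tendsto_mult J LIMSEQ_ignore_initial_segment[OF J[OF f]]) auto
    ultimately have "(\<lambda>i. profile I i ((T ^^ n) f)) \<longlonglongrightarrow> J f * J (surv n)" by simp
    then show ?thesis by (rule LIMSEQ_unique[OF J[OF iter_bfun[OF f]]])
  qed
  then show ?thesis
    using prob \<alpha>(1,3) by (intro exI[of _ \<alpha>]) (simp add: iter_bfun)
qed

end

section \<open>The absorbed chain and its killed operator\<close>

text \<open>
  The law on path space is determined by its initial segments, which grow by one application of
  the kernel; the joint law of two consecutive states follows by pushing forward.
\<close>

lemma
  assumes ker: "P \<in> S \<rightarrow>\<^sub>M prob_algebra S" and init: "\<mu> \<in> space (prob_algebra S)"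
  shows nn_integral_markov_law_0:
      "f \<in> borel_measurable S \<Longrightarrow> (\<integral>\<^sup>+\<omega>. f (\<omega> 0) \<partial>markov_law S P \<mu>) = (\<integral>\<^sup>+x. f x \<partial>\<mu>)"
    and nn_integral_markov_law_step:
      "h \<in> borel_measurable (S \<Otimes>\<^sub>M S) \<Longrightarrow>
        (\<integral>\<^sup>+\<omega>. h (\<omega> n, \<omega> (Suc n)) \<partial>markov_law S P \<mu>) =
        (\<integral>\<^sup>+\<omega>. (\<integral>\<^sup>+y. h (\<omega> n, y) \<partial>P (\<omega> n)) \<partial>markov_law S P \<mu>)"
proof -
  interpret Ionescu_Tulcea "markov_step P \<mu>" "\<lambda>_. S"
    by (rule Ionescu_Tulcea_markov_step[OF ker init])
  let ?\<Lambda> = "markov_law S P \<mu>"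
  define D where "D n = distr ?\<Lambda> (PiM {0..<n} (\<lambda>_. S)) (\<lambda>\<omega>. restrict \<omega> {0..<n})" for n
  note sets_\<Lambda>[measurable_cong] = sets_markov_law[OF ker init]
  have sets_D[measurable_cong]: "sets (D n) = sets (PiM {0..<n} (\<lambda>_. S))" for n by (simp add: D_def)
  have sets_\<mu>[measurable_cong]: "sets \<mu> = sets S" using init by (simp add: space_prob_algebra)
  have restr[measurable]: "(\<lambda>\<omega>. restrict \<omega> {0..<n}) \<in> ?\<Lambda> \<rightarrow>\<^sub>M PiM {0..<n} (\<lambda>_. S)" for n
    using measurable_restrict_subset[of "{0..<n}" UNIV "\<lambda>_. S"]
    by (simp add: sets_\<Lambda> cong: measurable_cong_sets)
  have D_Suc: "D (Suc n) = D n \<bind> eP n" for n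
    using markov_law_initial_segment(2)[OF ker init, of n]
    by (simp add: D_def eP_def[abs_def] markov_step_def)
  have int_D: "(\<integral>\<^sup>+\<omega>. F \<omega> \<partial>D (Suc n)) = (\<integral>\<^sup>+\<omega>. \<integral>\<^sup>+\<omega>'. F \<omega>' \<partial>eP n \<omega> \<partial>D n)"
    if [measurable]: "F \<in> borel_measurable (PiM {0..<Suc n} (\<lambda>_. S))" for F n
    unfolding D_Suc
    by (rule nn_integral_bind[where B = "PiM {0..<Suc n} (\<lambda>_. S)"]) (use measurable_eP[of n] in \<open>simp_all add: measurable_cong_sets[OF sets_D refl]\<close>)
  have int_eP: "(\<integral>\<^sup>+\<omega>'. F \<omega>' \<partial>eP n \<omega>) = (\<integral>\<^sup>+y. F (fun_upd \<omega> n y) \<partial>markov_step P \<mu> n \<omega>)"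
    if [measurable]: "F \<in> borel_measurable (PiM {0..<Suc n} (\<lambda>_. S))"
      and \<omega>: "\<omega> \<in> space (PiM {0..<n} (\<lambda>_. S))" for F n \<omega>
    by (rule nn_integral_eP[OF \<omega> that(1)])
  show "(\<integral>\<^sup>+\<omega>. f (\<omega> 0) \<partial>?\<Lambda>) = (\<integral>\<^sup>+x. f x \<partial>\<mu>)" if [measurable]: "f \<in> borel_measurable S"
  proof -
    have "(\<integral>\<^sup>+\<omega>. f (\<omega> 0) \<partial>?\<Lambda>) = (\<integral>\<^sup>+\<omega>. f (\<omega> 0) \<partial>D (Suc 0))"
      unfolding D_def by (subst nn_integral_distr) auto
    also have "\<dots> = (\<integral>\<^sup>+\<omega>. \<integral>\<^sup>+\<omega>'. f (\<omega>' 0) \<partial>eP 0 \<omega> \<partial>D 0)"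
      by (rule int_D) auto
    also have "\<dots> = (\<integral>\<^sup>+\<omega>. \<integral>\<^sup>+y. f y \<partial>\<mu> \<partial>D 0)"
      by (intro nn_integral_cong, subst int_eP) (auto simp: markov_step_def D_def)
    also have "\<dots> = (\<integral>\<^sup>+y. f y \<partial>\<mu>)"
      unfolding D_def markov_law_initial_segment(1)[OF ker init]
      by (subst nn_integral_return) (auto simp: space_PiM)
    finally show ?thesis .
  qed
  show "(\<integral>\<^sup>+\<omega>. h (\<omega> n, \<omega> (Suc n)) \<partial>?\<Lambda>) = (\<integral>\<^sup>+\<omega>. (\<integral>\<^sup>+y. h (\<omega> n, y) \<partial>P (\<omega> n)) \<partial>?\<Lambda>)"
    if [measurable]: "h \<in> borel_measurable (S \<Otimes>\<^sub>M S)"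
  proof -
    have Pm[measurable]: "P \<in> S \<rightarrow>\<^sub>M subprob_algebra S" by (rule measurable_prob_algebraD[OF ker])
    have [measurable]: "(\<lambda>x. \<integral>\<^sup>+y. h (x, y) \<partial>P x) \<in> borel_measurable S"
      by (rule nn_integral_measurable_subprob_algebra2[OF _ Pm]) simp
    have "(\<integral>\<^sup>+\<omega>. h (\<omega> n, \<omega> (Suc n)) \<partial>?\<Lambda>) = (\<integral>\<^sup>+\<omega>. h (\<omega> n, \<omega> (Suc n)) \<partial>D (Suc (Suc n)))"
      unfolding D_def by (subst nn_integral_distr) auto
    also have "\<dots> = (\<integral>\<^sup>+\<omega>. \<integral>\<^sup>+\<omega>'. h (\<omega>' n, \<omega>' (Suc n)) \<partial>eP (Suc n) \<omega> \<partial>D (Suc n))"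
      by (rule int_D) auto
    also have "\<dots> = (\<integral>\<^sup>+\<omega>. \<integral>\<^sup>+y. h (\<omega> n, y) \<partial>P (\<omega> n) \<partial>D (Suc n))"
      by (intro nn_integral_cong, subst int_eP) (auto simp: markov_step_def D_def)
    also have "\<dots> = (\<integral>\<^sup>+\<omega>. (\<integral>\<^sup>+y. h (\<omega> n, y) \<partial>P (\<omega> n)) \<partial>?\<Lambda>)"
      unfolding D_def by (subst nn_integral_distr) auto
    finally show ?thesis .
  qed
qed

text \<open>
  The usual convention that functions vanish at the cemetery.
\<close>

definition extend :: "('a \<Rightarrow> 'b::zero) \<Rightarrow> 'a option \<Rightarrow> 'b" where
  "extend f z = (case z of None \<Rightarrow> 0 | Some x \<Rightarrow> f x)"

lemma extend_simps[simp]: "extend f None = 0" "extend f (Some x) = f x"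
  by (auto simp: extend_def)

lemma extend_measurable[measurable]:
  fixes f :: "'a \<Rightarrow> 'b::{zero, topological_space}"
  assumes f: "f \<in> borel_measurable M"
  shows "extend f \<in> borel_measurable (with_cemetery M)"
proof (rule measurableI)
  fix B :: "'b set" assume B: "B \<in> sets borel"
  have "extend f -` B \<inter> space (with_cemetery M) =
      Some ` (f -` B \<inter> space M) \<union> (if 0 \<in> B then {None} else {})"
    by (auto simp: space_with_cemetery extend_def split: option.splits)
  moreover have "Some ` (f -` B \<inter> space M) \<in> sets (with_cemetery M)"
    using f B by (intro Some_image_sets_with_cemetery) auto
  ultimately show "extend f -` B \<inter> space (with_cemetery M) \<in> sets (with_cemetery M)"
    using sets.Un[OF _ None_sets_with_cemetery[of M]] by (simp split: if_splits)
qed auto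

lemma absorption_time_gt_iff: "enat n < absorption_time \<omega> \<longleftrightarrow> (\<forall>i\<le>n. \<omega> i \<noteq> None)"
proof
  assume l: "enat n < absorption_time \<omega>"
  show "\<forall>i\<le>n. \<omega> i \<noteq> None"
  proof (intro allI impI notI)
    fix i assume "i \<le> n" "\<omega> i = None"
    then have "absorption_time \<omega> \<le> enat i" unfolding absorption_time_def by (auto intro: INF_lower)
    also have "\<dots> \<le> enat n" using \<open>i \<le> n\<close> by simp
    finally show False using l by simp
  qed
next
  assume n: "\<forall>i\<le>n. \<omega> i \<noteq> None"
  have "enat (Suc n) \<le> absorption_time \<omega>"
    unfolding absorption_time_def
  proof (rule INF_greatest)
    fix k assume "k \<in> {k. \<omega> k = None}"
    then have "\<not> k \<le> n" using n by auto
    then show "enat (Suc n) \<le> enat k" by simp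
  qed
  then show "enat n < absorption_time \<omega>"
    by (rule less_le_trans[rotated]) simp
qed

lemma absorption_time_gt:
  assumes "\<And>i. \<omega> i = None \<Longrightarrow> \<omega> (Suc i) = None"
  shows "enat n < absorption_time \<omega> \<longleftrightarrow> \<omega> n \<noteq> None"
proof -
  have stay: "\<omega> k = None \<Longrightarrow> \<omega> (k + d) = None" for k d
    using assms by (induction d) auto
  have "\<omega> i \<noteq> None" if "\<omega> n \<noteq> None" "i \<le> n" for i
    using stay[of i "n - i"] that by auto
  then show ?thesis unfolding absorption_time_gt_iff by blast
qed

text \<open>
  A chain absorbed in \<open>None\<close>. Its law up to absorption is governed by the restriction of the kernel to the
  state space, a sub-probability kernel.
\<close>

locale absorbed_chain =
  fixes M :: "'a measure" and P :: "'a option \<Rightarrow> 'a option measure"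
  assumes kernel: "P \<in> with_cemetery M \<rightarrow>\<^sub>M prob_algebra (with_cemetery M)"
    and absorbed: "P None = return (with_cemetery M) None"
begin

abbreviation "S \<equiv> with_cemetery M"

lemma kernel_sub[measurable]: "P \<in> S \<rightarrow>\<^sub>M subprob_algebra S"
  by (rule measurable_prob_algebraD[OF kernel])

lemma kernel_prob: "x \<in> space M \<Longrightarrow> prob_space (P (Some x))"
  and kernel_sets: "x \<in> space M \<Longrightarrow> sets (P (Some x)) = sets S"
  using measurable_space[OF kernel, of "Some x"] by (auto simp: space_with_cemetery space_prob_algebra)

lemma kernel_space: "x \<in> space M \<Longrightarrow> space (P (Some x)) = space S"
  by (rule sets_eq_imp_space_eq[OF kernel_sets])

definition killed_kernel :: "'a \<Rightarrow> 'a measure" where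
  "killed_kernel x = distr (restrict_space (P (Some x)) (Some ` space M)) M the"

lemma sets_killed_kernel[simp]: "sets (killed_kernel x) = sets M" by (simp add: killed_kernel_def)

lemma the_measurable:
  assumes "x \<in> space M" shows "the \<in> restrict_space (P (Some x)) (Some ` space M) \<rightarrow>\<^sub>M M"
proof (rule measurableI)
  have sp: "Some ` space M \<subseteq> space S" by (auto simp: space_with_cemetery)
  show "the z \<in> space M" if "z \<in> space (restrict_space (P (Some x)) (Some ` space M))" for z
    using that by (auto simp: space_restrict_space)
  fix B assume B: "B \<in> sets M"
  have "the -` B \<inter> space (restrict_space (P (Some x)) (Some ` space M)) = Some ` B"
    using sets.sets_into_space[OF B]
    by (auto simp: space_restrict_space kernel_space[OF assms] space_with_cemetery image_iff)
  then show "the -` B \<inter> space (restrict_space (P (Some x)) (Some ` space M)) \<in>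
      sets (restrict_space (P (Some x)) (Some ` space M))"
    using B sets.sets_into_space[OF B] sp
    by (auto simp: sets_restrict_space_iff kernel_sets[OF assms] kernel_space[OF assms]
        Int_absorb2 Some_image_sets_with_cemetery)
qed

lemma nn_integral_killed_kernel:
  assumes x: "x \<in> space M" and f[measurable]: "f \<in> borel_measurable M"
  shows "(\<integral>\<^sup>+y. f y \<partial>killed_kernel x) = (\<integral>\<^sup>+z. extend f z \<partial>P (Some x))"
proof -
  have "(\<integral>\<^sup>+y. f y \<partial>killed_kernel x) = (\<integral>\<^sup>+z. f (the z) \<partial>restrict_space (P (Some x)) (Some ` space M))"
    unfolding killed_kernel_def by (rule nn_integral_distr[OF the_measurable[OF x]]) simp
  also have "\<dots> = (\<integral>\<^sup>+z. f (the z) * indicator (Some ` space M) z \<partial>P (Some x))"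
    by (rule nn_integral_restrict_space)
       (auto simp: kernel_sets[OF x] intro!: sets.Int Some_image_sets_with_cemetery,
        metis kernel_sets[OF x] sets.top)
  also have "\<dots> = (\<integral>\<^sup>+z. extend f z \<partial>P (Some x))"
    by (rule nn_integral_cong)
       (auto simp: kernel_space[OF x] space_with_cemetery extend_def indicator_def split: option.splits)
  finally show ?thesis .
qed

lemma emeasure_killed_kernel:
  assumes x: "x \<in> space M" and B: "B \<in> sets M"
  shows "emeasure (killed_kernel x) B = emeasure (P (Some x)) (Some ` B)"
proof -
  have "emeasure (killed_kernel x) B = (\<integral>\<^sup>+y. indicator B y \<partial>killed_kernel x)" using B by simp
  also have "\<dots> = (\<integral>\<^sup>+z. extend (indicator B) z \<partial>P (Some x))"
    using B by (intro nn_integral_killed_kernel[OF x]) simp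
  also have "\<dots> = (\<integral>\<^sup>+z. indicator (Some ` B) z \<partial>P (Some x))"
    by (rule nn_integral_cong) (auto simp: extend_def indicator_def split: option.splits)
  also have "\<dots> = emeasure (P (Some x)) (Some ` B)"
    using B by (simp add: kernel_sets[OF x] Some_image_sets_with_cemetery)
  finally show ?thesis .
qed

lemma finite_killed_kernel: "x \<in> space M \<Longrightarrow> finite_measure (killed_kernel x)"
proof (rule finite_measureI)
  assume x: "x \<in> space M"
  interpret prob_space "P (Some x)" by (rule kernel_prob[OF x])
  have "space (killed_kernel x) = space M" by (rule sets_eq_imp_space_eq) simp
  then show "emeasure (killed_kernel x) (space (killed_kernel x)) \<noteq> \<infinity>"
    using emeasure_killed_kernel[OF x sets.top] by simp
qed

lemma space_killed_kernel[simp]: "space (killed_kernel x) = space M"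
  by (rule sets_eq_imp_space_eq) simp

definition killed_op :: "('a \<Rightarrow> real) \<Rightarrow> 'a \<Rightarrow> real" where
  "killed_op f x = (\<integral>y. f y \<partial>killed_kernel x)"

lemma killed_op_functional: "x \<in> space M \<Longrightarrow> positive_functional M (\<lambda>f. killed_op f x)"
  unfolding killed_op_def by (rule positive_functional_integral[OF finite_killed_kernel]) auto

lemma ennreal_killed_op:
  assumes x: "x \<in> space M" and f: "f \<in> bfun M" "\<And>y. y \<in> space M \<Longrightarrow> 0 \<le> f y"
  shows "ennreal (killed_op f x) = (\<integral>\<^sup>+y. ennreal (f y) \<partial>killed_kernel x)"
  unfolding killed_op_def
  by (rule nn_integral_eq_integral[symmetric, OF bfun_integrable[OF finite_killed_kernel[OF x] f(1)]])
     (use f(2) in \<open>auto intro!: AE_I2\<close>)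

lemma ennreal_killed_op_extend:
  assumes x: "x \<in> space M" and f: "f \<in> bfun M" "\<And>y. y \<in> space M \<Longrightarrow> 0 \<le> f y"
  shows "ennreal (killed_op f x) = (\<integral>\<^sup>+z. ennreal (extend f z) \<partial>P (Some x))"
proof -
  have [measurable]: "f \<in> borel_measurable M" by (rule bfun_measurable[OF f(1)])
  have "ennreal (extend f z) = extend (\<lambda>y. ennreal (f y)) z" for z
    by (simp add: extend_def split: option.splits)
  then show ?thesis by (simp add: ennreal_killed_op[OF x f] nn_integral_killed_kernel[OF x])
qed

lemma killed_op_nonneg: "f \<in> bfun M \<Longrightarrow> (\<And>y. y \<in> space M \<Longrightarrow> 0 \<le> f y) \<Longrightarrow> x \<in> space M \<Longrightarrow> 0 \<le> killed_op f x"
  by (rule positive_functional_nonneg[OF killed_op_functional])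

lemma killed_op_one: "x \<in> space M \<Longrightarrow> killed_op (\<lambda>_. 1) x \<le> 1"
proof -
  assume x: "x \<in> space M"
  interpret prob_space "P (Some x)" by (rule kernel_prob[OF x])
  have "ennreal (killed_op (\<lambda>_. 1) x) = emeasure (killed_kernel x) (space M)"
    using x by (subst ennreal_killed_op) auto
  also have "\<dots> \<le> 1" using emeasure_killed_kernel[OF x sets.top] emeasure_le_1 by simp
  finally show ?thesis by simp
qed

lemma killed_op_bfun:
  assumes f: "f \<in> bfun M" shows "killed_op f \<in> bfun M"
proof -
  obtain b where b: "\<forall>x\<in>space M. \<bar>f x\<bar> \<le> b" using f by (auto simp: bfun_def)
  define d where "d = max b 0"
  have d: "0 \<le> d" "\<forall>x\<in>space M. \<bar>f x\<bar> \<le> d" using b by (auto simp: d_def)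
  have [measurable]: "f \<in> borel_measurable M" by (rule bfun_measurable[OF f])
  have eq: "killed_op f x = (\<integral>z. extend f z \<partial>P (Some x))" if x: "x \<in> space M" for x
  proof -
    have "killed_op f x = (\<integral>z. f (the z) \<partial>restrict_space (P (Some x)) (Some ` space M))"
      unfolding killed_op_def killed_kernel_def by (rule integral_distr[OF the_measurable[OF x]]) simp
    also have "\<dots> = (\<integral>z. indicator (Some ` space M) z *\<^sub>R f (the z) \<partial>P (Some x))"
      using Some_image_sets_with_cemetery[of "space M" M]
      by (intro integral_restrict_space) (auto simp: kernel_sets[OF x] kernel_space[OF x])
    also have "\<dots> = (\<integral>z. extend f z \<partial>P (Some x))"
      by (rule Bochner_Integration.integral_cong)
         (auto simp: kernel_space[OF x] space_with_cemetery extend_def indicator_def split: option.splits)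
    finally show ?thesis .
  qed
  have "(\<lambda>x. \<integral>z. extend f z \<partial>P (Some x)) \<in> borel_measurable M"
    by (rule measurable_compose[OF measurable_compose[OF Some_measurable_with_cemetery kernel_sub]
          integral_measurable_subprob_algebra]) simp
  then have "killed_op f \<in> borel_measurable M" by (subst measurable_cong[OF eq])
  moreover have "\<bar>killed_op f x\<bar> \<le> d" if x: "x \<in> space M" for x
  proof -
    note T = killed_op_functional[OF x]
    have "killed_op f x \<le> killed_op (\<lambda>_. d) x" "killed_op (\<lambda>_. - d) x \<le> killed_op f x"
      using d by (auto intro!: positive_functional_mono[OF T] f simp: abs_le_iff minus_le_iff)
    moreover have "killed_op (\<lambda>_. d) x = d * killed_op (\<lambda>_. 1) x" "killed_op (\<lambda>_. - d) x = - d * killed_op (\<lambda>_. 1) x"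
      by (rule positive_functional_const[OF T])+
    moreover have "d * killed_op (\<lambda>_. 1) x \<le> d * 1" using killed_op_one[OF x] d(1) by (rule mult_left_mono)
    ultimately show ?thesis by (simp add: abs_le_iff)
  qed
  ultimately show ?thesis by (rule bfunI)
qed

lemma iter_killed_op_bfun: "f \<in> bfun M \<Longrightarrow> (killed_op ^^ n) f \<in> bfun M"
  by (induction n) (auto intro: killed_op_bfun)

lemma iter_killed_op_nonneg:
  "f \<in> bfun M \<Longrightarrow> (\<And>y. y \<in> space M \<Longrightarrow> 0 \<le> f y) \<Longrightarrow> x \<in> space M \<Longrightarrow> 0 \<le> (killed_op ^^ n) f x"
  by (induction n arbitrary: x) (auto intro!: killed_op_nonneg iter_killed_op_bfun)

context
  fixes \<mu>0 assumes \<mu>0: "\<mu>0 \<in> space (prob_algebra S)"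
begin

abbreviation "\<Lambda> \<equiv> markov_law S P \<mu>0"

lemma sets_\<Lambda>[measurable_cong]: "sets \<Lambda> = sets (PiM UNIV (\<lambda>_. S))"
  by (rule sets_markov_law[OF kernel \<mu>0])

lemma space_\<Lambda>: "\<omega> \<in> space \<Lambda> \<Longrightarrow> \<omega> n \<in> space S"
  using sets_eq_imp_space_eq[OF sets_\<Lambda>] by (auto simp: space_PiM)

text \<open>
  The Markov property, iterated: \<open>\<E>(f(X\<^sub>n); n < \<tau>)\<close> is the integral of the \<open>n\<close>-th iterate against the initial
  law. The induction moves one step of the kernel from the path to the function.
\<close>

lemma nn_integral_state:
  assumes f: "f \<in> bfun M" "\<And>y. y \<in> space M \<Longrightarrow> 0 \<le> f y"
  shows "(\<integral>\<^sup>+\<omega>. ennreal (extend f (\<omega> n)) \<partial>\<Lambda>) = (\<integral>\<^sup>+z. ennreal (extend ((killed_op ^^ n) f) z) \<partial>\<mu>0)"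
  using f
proof (induction n arbitrary: f)
  case 0
  have [measurable]: "f \<in> borel_measurable M" by (rule bfun_measurable[OF 0(1)])
  show ?case using nn_integral_markov_law_0[OF kernel \<mu>0, of "\<lambda>z. ennreal (extend f z)"] by simp
next
  case (Suc n)
  have [measurable]: "f \<in> borel_measurable M" by (rule bfun_measurable[OF Suc.prems(1)])
  have "(\<integral>\<^sup>+\<omega>. ennreal (extend f (\<omega> (Suc n))) \<partial>\<Lambda>) =
      (\<integral>\<^sup>+\<omega>. (\<integral>\<^sup>+y. ennreal (extend f y) \<partial>P (\<omega> n)) \<partial>\<Lambda>)"
    using nn_integral_markov_law_step[OF kernel \<mu>0, of "\<lambda>(a, b). ennreal (extend f b)" n] by simp
  also have "\<dots> = (\<integral>\<^sup>+\<omega>. ennreal (extend (killed_op f) (\<omega> n)) \<partial>\<Lambda>)"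
  proof (rule nn_integral_cong)
    fix \<omega> assume "\<omega> \<in> space \<Lambda>"
    then consider "\<omega> n = None" | x where "\<omega> n = Some x" "x \<in> space M"
      using space_\<Lambda>[of \<omega> n] by (auto simp: space_with_cemetery)
    then show "(\<integral>\<^sup>+y. ennreal (extend f y) \<partial>P (\<omega> n)) = ennreal (extend (killed_op f) (\<omega> n))"
    proof cases
      case 1
      then show ?thesis by (simp add: absorbed nn_integral_return space_with_cemetery)
    next
      case 2
      then show ?thesis using ennreal_killed_op_extend[OF 2(2) Suc.prems] by simp
    qed
  qed
  also have "\<dots> = (\<integral>\<^sup>+z. ennreal (extend ((killed_op ^^ n) (killed_op f)) z) \<partial>\<mu>0)"
    using Suc.prems by (intro Suc.IH killed_op_bfun killed_op_nonneg)
  finally show ?case by (simp add: funpow_swap1)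
qed

lemma emeasure_state:
  assumes B: "B \<in> sets M"
  shows "emeasure \<Lambda> {\<omega> \<in> space \<Lambda>. \<omega> n \<in> Some ` B} =
    (\<integral>\<^sup>+z. ennreal (extend ((killed_op ^^ n) (indicator B)) z) \<partial>\<mu>0)"
proof -
  have [measurable]: "Some ` B \<in> sets S" by (rule Some_image_sets_with_cemetery[OF B])
  have "emeasure \<Lambda> {\<omega> \<in> space \<Lambda>. \<omega> n \<in> Some ` B} = (\<integral>\<^sup>+\<omega>. indicator {\<omega> \<in> space \<Lambda>. \<omega> n \<in> Some ` B} \<omega> \<partial>\<Lambda>)"
    by (rule nn_integral_indicator[symmetric]) measurable
  also have "\<dots> = (\<integral>\<^sup>+\<omega>. ennreal (extend (indicator B) (\<omega> n)) \<partial>\<Lambda>)"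
    by (rule nn_integral_cong) (auto simp: extend_def indicator_def split: option.splits)
  also have "\<dots> = (\<integral>\<^sup>+z. ennreal (extend ((killed_op ^^ n) (indicator B)) z) \<partial>\<mu>0)"
    using B by (intro nn_integral_state) auto
  finally show ?thesis .
qed

text \<open>
  Only almost every path stays in the cemetery, since path space contains all sequences. Hence \<open>n < \<tau>\<close>, which
  concerns all states up to time \<open>n\<close>, agrees with \<open>X\<^sub>n\<close> being alive only up to a null set.
\<close>

lemma AE_absorbed: "AE \<omega> in \<Lambda>. \<forall>n. \<omega> n = None \<longrightarrow> \<omega> (Suc n) = None"
proof (subst AE_all_countable, rule allI)
  fix n
  have [measurable]: "Some ` space M \<in> sets S" "{None} \<in> sets S"
    by (auto intro: Some_image_sets_with_cemetery None_sets_with_cemetery)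
  let ?h = "\<lambda>(a, b). indicator {None} a * indicator (Some ` space M) b :: ennreal"
  have "(\<integral>\<^sup>+\<omega>. ?h (\<omega> n, \<omega> (Suc n)) \<partial>\<Lambda>) = (\<integral>\<^sup>+\<omega>. (\<integral>\<^sup>+y. ?h (\<omega> n, y) \<partial>P (\<omega> n)) \<partial>\<Lambda>)"
    by (rule nn_integral_markov_law_step[OF kernel \<mu>0]) measurable
  also have "\<dots> = (\<integral>\<^sup>+\<omega>. 0 \<partial>\<Lambda>)"
  proof (rule nn_integral_cong)
    fix \<omega> assume "\<omega> \<in> space \<Lambda>"
    show "(\<integral>\<^sup>+y. ?h (\<omega> n, y) \<partial>P (\<omega> n)) = 0"
      by (cases "\<omega> n") (auto simp: absorbed nn_integral_return space_with_cemetery)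
  qed
  finally have "(\<integral>\<^sup>+\<omega>. ?h (\<omega> n, \<omega> (Suc n)) \<partial>\<Lambda>) = 0" by simp
  then have "AE \<omega> in \<Lambda>. ?h (\<omega> n, \<omega> (Suc n)) = 0"
    by (subst (asm) nn_integral_0_iff_AE) auto
  moreover have "AE \<omega> in \<Lambda>. \<omega> (Suc n) \<in> space S" by (rule AE_I2) (rule space_\<Lambda>)
  ultimately show "AE \<omega> in \<Lambda>. \<omega> n = None \<longrightarrow> \<omega> (Suc n) = None"
    by eventually_elim (auto simp: space_with_cemetery indicator_def split: if_splits)
qed

lemma AE_survival: "AE \<omega> in \<Lambda>. \<forall>n. enat n < absorption_time \<omega> \<longleftrightarrow> \<omega> n \<in> Some ` space M"
proof -
  have "AE \<omega> in \<Lambda>. \<forall>n. \<omega> n \<in> space S" by (rule AE_I2) (auto intro: space_\<Lambda>)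
  with AE_absorbed show ?thesis
  proof eventually_elim
    case (elim \<omega>)
    have "enat n < absorption_time \<omega> \<longleftrightarrow> \<omega> n \<noteq> None" for n
      using elim(1) by (intro absorption_time_gt) auto
    moreover have "\<omega> n \<in> Some ` space M \<longleftrightarrow> \<omega> n \<noteq> None" for n
      using spec[OF elim(2), of n] by (auto simp: space_with_cemetery)
    ultimately show ?case by simp
  qed
qed

lemma survival_measurable[measurable]: "{\<omega> \<in> space \<Lambda>. enat n < absorption_time \<omega>} \<in> sets \<Lambda>"
proof -
  have [measurable]: "{None} \<in> sets S" by (rule None_sets_with_cemetery)
  have "{\<omega> \<in> space \<Lambda>. enat n < absorption_time \<omega>} = {\<omega> \<in> space \<Lambda>. \<forall>i\<in>{..n}. \<not> \<omega> i \<in> {None}}"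
    by (auto simp: absorption_time_gt_iff)
  also have "\<dots> \<in> sets \<Lambda>" by measurable
  finally show ?thesis .
qed

lemma emeasure_survival:
  assumes B: "B \<in> sets M"
  shows "emeasure \<Lambda> {\<omega> \<in> space \<Lambda>. \<omega> n \<in> Some ` B \<and> enat n < absorption_time \<omega>} =
    (\<integral>\<^sup>+z. ennreal (extend ((killed_op ^^ n) (indicator B)) z) \<partial>\<mu>0)"
    and "emeasure \<Lambda> {\<omega> \<in> space \<Lambda>. enat n < absorption_time \<omega>} =
    (\<integral>\<^sup>+z. ennreal (extend ((killed_op ^^ n) (indicator (space M))) z) \<partial>\<mu>0)"
proof -
  have [measurable]: "Some ` B \<in> sets S" "Some ` space M \<in> sets S"
    by (auto intro: Some_image_sets_with_cemetery B)
  have "{\<omega> \<in> space \<Lambda>. \<omega> n \<in> Some ` B \<and> enat n < absorption_time \<omega>} =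
     {\<omega> \<in> space \<Lambda>. \<omega> n \<in> Some ` B} \<inter> {\<omega> \<in> space \<Lambda>. enat n < absorption_time \<omega>}" by auto
  also have "\<dots> \<in> sets \<Lambda>" by (intro sets.Int survival_measurable) measurable
  finally have [measurable]: "{\<omega> \<in> space \<Lambda>. \<omega> n \<in> Some ` B \<and> enat n < absorption_time \<omega>} \<in> sets \<Lambda>" .
  have "emeasure \<Lambda> {\<omega> \<in> space \<Lambda>. \<omega> n \<in> Some ` B \<and> enat n < absorption_time \<omega>} =
      emeasure \<Lambda> {\<omega> \<in> space \<Lambda>. \<omega> n \<in> Some ` B}"
    using AE_survival sets.sets_into_space[OF B]
    by (intro emeasure_eq_AE) (auto elim!: eventually_mono)
  then show "emeasure \<Lambda> {\<omega> \<in> space \<Lambda>. \<omega> n \<in> Some ` B \<and> enat n < absorption_time \<omega>} =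
    (\<integral>\<^sup>+z. ennreal (extend ((killed_op ^^ n) (indicator B)) z) \<partial>\<mu>0)"
    by (simp add: emeasure_state[OF B])
  have "emeasure \<Lambda> {\<omega> \<in> space \<Lambda>. enat n < absorption_time \<omega>} =
      emeasure \<Lambda> {\<omega> \<in> space \<Lambda>. \<omega> n \<in> Some ` space M}"
    using AE_survival by (intro emeasure_eq_AE) (auto elim!: eventually_mono)
  then show "emeasure \<Lambda> {\<omega> \<in> space \<Lambda>. enat n < absorption_time \<omega>} =
    (\<integral>\<^sup>+z. ennreal (extend ((killed_op ^^ n) (indicator (space M))) z) \<partial>\<mu>0)"
    by (simp add: emeasure_state)
qed

end

lemma return_in: "x \<in> space M \<Longrightarrow> return S (Some x) \<in> space (prob_algebra S)"
  by (auto simp: space_prob_algebra space_with_cemetery intro!: prob_space_return)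

lemma nn_integral_return_extend:
  assumes x: "x \<in> space M" and [measurable]: "f \<in> borel_measurable M"
  shows "(\<integral>\<^sup>+z. ennreal (extend f z) \<partial>return S (Some x)) = ennreal (f x)"
  using x by (simp add: nn_integral_return space_with_cemetery)

lemma iter_one: "x \<in> space M \<Longrightarrow> (killed_op ^^ n) (indicator (space M)) x = (killed_op ^^ n) (\<lambda>_. 1) x"
proof (induction n arbitrary: x)
  case (Suc n)
  show ?case
    using Suc by (auto intro!: positive_functional_cong[OF killed_op_functional] iter_killed_op_bfun)
qed simp

lemma hit_prob_eq: "x \<in> space M \<Longrightarrow> B \<in> sets M \<Longrightarrow> hit_prob M P x n B = ennreal ((killed_op ^^ n) (indicator B) x)"
  unfolding hit_prob_def law_at_def
  by (simp add: emeasure_state[OF return_in] nn_integral_return_extend bfun_measurable iter_killed_op_bfun bfun_indicator)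

lemma survival_prob_eq: "x \<in> space M \<Longrightarrow> survival_prob M P x n = ennreal ((killed_op ^^ n) (\<lambda>_. 1) x)"
  unfolding survival_prob_def law_at_def
  by (simp add: emeasure_survival(2)[OF return_in sets.top] nn_integral_return_extend bfun_measurable
      iter_killed_op_bfun bfun_indicator iter_one)

lemma P1_op_eq:
  assumes x: "x \<in> space M" and f: "f \<in> bfun M" "\<And>y. y \<in> space M \<Longrightarrow> 0 \<le> f y"
  shows "P1_op M P f x = ennreal (killed_op f x)"
proof -
  have fm: "f \<in> borel_measurable M" by (rule bfun_measurable[OF f(1)])
  have states: "AE \<omega> in markov_law S P (return S (Some x)). \<omega> 1 \<in> space S"
    by (rule AE_I2) (rule space_\<Lambda>[OF return_in[OF x]])
  have "P1_op M P f x = (\<integral>\<^sup>+\<omega>. ennreal (extend f (\<omega> 1)) \<partial>markov_law S P (return S (Some x)))"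
    unfolding P1_op_def law_at_def
  proof (rule nn_integral_cong_AE)
    show "AE \<omega> in markov_law S P (return S (Some x)).
      (if 1 < absorption_time \<omega> then ennreal (f (the (\<omega> 1))) else 0) = ennreal (extend f (\<omega> 1))"
      using AE_survival[OF return_in[OF x]] states
    proof eventually_elim
      case (elim \<omega>)
      have "1 < absorption_time \<omega> \<longleftrightarrow> \<omega> 1 \<in> Some ` space M"
        using spec[OF elim(1), of 1] by (simp add: one_enat_def)
      with elim(2) show ?case by (auto simp: space_with_cemetery)
    qed
  qed
  also have "\<dots> = (\<integral>\<^sup>+z. ennreal (extend ((killed_op ^^ 1) f) z) \<partial>return S (Some x))"
    by (rule nn_integral_state[OF return_in[OF x] f])
  also have "\<dots> = ennreal (killed_op f x)"
    using nn_integral_return_extend[OF x bfun_measurable[OF killed_op_bfun[OF f(1)]]] by simp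
  finally show ?thesis .
qed

lemma cond_law_eq:
  assumes \<mu>: "\<mu> \<in> space (prob_algebra M)" and B: "B \<in> sets M"
  shows "cond_law M P \<mu> n B = (\<integral>x. (killed_op ^^ n) (indicator B) x \<partial>\<mu>) / (\<integral>x. (killed_op ^^ n) (\<lambda>_. 1) x \<partial>\<mu>)"
proof -
  have s: "sets \<mu> = sets M" and "prob_space \<mu>" using \<mu> by (auto simp: space_prob_algebra)
  interpret prob_space \<mu> by fact
  have sp: "space \<mu> = space M" by (rule sets_eq_imp_space_eq[OF s])
  have Sm: "Some \<in> \<mu> \<rightarrow>\<^sub>M S" using Some_measurable_with_cemetery[of M] by (simp add: s cong: measurable_cong_sets)
  have \<mu>0: "distr \<mu> S Some \<in> space (prob_algebra S)"
    using Sm by (auto simp: space_prob_algebra intro: prob_space_distr)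
  have int: "(\<integral>\<^sup>+z. ennreal (extend ((killed_op ^^ n) (indicator A)) z) \<partial>distr \<mu> S Some) =
      ennreal (\<integral>x. (killed_op ^^ n) (indicator A) x \<partial>\<mu>)" if A: "A \<in> sets M" for A
  proof -
    have b: "(killed_op ^^ n) (indicator A) \<in> bfun M" using A by (intro iter_killed_op_bfun) auto
    have [measurable]: "(killed_op ^^ n) (indicator A) \<in> borel_measurable M" by (rule bfun_measurable[OF b])
    have "(\<integral>\<^sup>+z. ennreal (extend ((killed_op ^^ n) (indicator A)) z) \<partial>distr \<mu> S Some) =
        (\<integral>\<^sup>+x. ennreal ((killed_op ^^ n) (indicator A) x) \<partial>\<mu>)"
      by (subst nn_integral_distr[OF Sm]) auto
    also have "\<dots> = ennreal (\<integral>x. (killed_op ^^ n) (indicator A) x \<partial>\<mu>)"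
      using A by (intro nn_integral_eq_integral bfun_integrable[OF finite_measure_axioms b s])
        (auto intro!: AE_I2 iter_killed_op_nonneg simp: sp)
    finally show ?thesis .
  qed
  have nn: "0 \<le> (\<integral>x. (killed_op ^^ n) (indicator A) x \<partial>\<mu>)" if "A \<in> sets M" for A
    using that by (intro integral_nonneg_AE AE_I2 iter_killed_op_nonneg) (auto simp: sp)
  have "(\<integral>x. (killed_op ^^ n) (indicator (space M)) x \<partial>\<mu>) = (\<integral>x. (killed_op ^^ n) (\<lambda>_. 1) x \<partial>\<mu>)"
    by (rule Bochner_Integration.integral_cong) (auto simp: sp iter_one)
  then show ?thesis
    using emeasure_survival[OF \<mu>0 B, of n] nn[OF B] nn[OF sets.top]
    unfolding cond_law_def cond_prob_def law_init_def measure_def int[OF B] int[OF sets.top]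
    by simp
qed

text \<open>
  Bounds for the kernel on sets become bounds for the operator on functions by comparison of measures:
  the restricted kernel lies below \<open>C \<zeta>\<close> and, at points of \<open>A k\<close>, above \<open>a k\<close> times the restriction of \<open>\<zeta>\<close> to
  \<open>A k\<close>.
\<close>

lemma minorized_operatorI:
  assumes "prob_space \<zeta>" and s\<zeta>: "sets \<zeta> = sets M" and C: "1 < C"
    and P_upper: "\<And>x B. x \<in> space M \<Longrightarrow> B \<in> sets M \<Longrightarrow>
      emeasure (P (Some x)) (Some ` B) \<le> ennreal C * emeasure \<zeta> B"
    and A_sets: "\<And>k. A k \<in> sets M" and A_inc: "incseq A" and A_exh: "(\<Union>k. A k) = space M"
    and a_pos: "\<And>k. 0 < a k"
    and P_lower: "\<And>x B k. x \<in> A k \<Longrightarrow> B \<in> sets M \<Longrightarrow>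
      ennreal (a k) * emeasure \<zeta> (A k \<inter> B) \<le> emeasure (P (Some x)) (Some ` B)"
    and P_pos: "\<And>x B. x \<in> space M \<Longrightarrow> B \<in> sets M \<Longrightarrow> 0 < emeasure \<zeta> B \<Longrightarrow>
      0 < emeasure (P (Some x)) (Some ` B)"
  shows "minorized_operator \<zeta> killed_op A a C"
proof -
  interpret \<zeta>: prob_space \<zeta> by fact
  have sp\<zeta>: "space \<zeta> = space M" by (rule sets_eq_imp_space_eq[OF s\<zeta>])
  have bf: "bfun \<zeta> = bfun M" by (rule bfun_cong_sets[OF s\<zeta>])
  have pf: "positive_functional \<zeta> = positive_functional M" by (rule positive_functional_cong_sets[OF s\<zeta>])
  show ?thesis
  proof
    fix f x assume f: "f \<in> bfun \<zeta>" "\<And>y. y \<in> space \<zeta> \<Longrightarrow> 0 \<le> f y" and "x \<in> space \<zeta>"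
    then have x: "x \<in> space M" by (simp add: sp\<zeta>)
    have fin: "finite_measure (scale_measure (ennreal C) \<zeta>)"
      by (rule finite_measureI) (simp add: ennreal_mult_eq_top_iff space_scale_measure)
    have "killed_op f x \<le> (\<integral>y. f y \<partial>scale_measure (ennreal C) \<zeta>)"
      unfolding killed_op_def
    proof (rule integral_le_of_emeasure_le[OF finite_killed_kernel[OF x] fin])
      show "emeasure (killed_kernel x) B \<le> emeasure (scale_measure (ennreal C) \<zeta>) B" if "B \<in> sets (killed_kernel x)" for B
        using that P_upper[OF x] by (simp add: emeasure_killed_kernel[OF x])
    qed (use f in \<open>auto simp: s\<zeta> bf sp\<zeta> bfun_def cong: measurable_cong_sets\<close>)
    also have "\<dots> = C * (\<integral>y. f y \<partial>\<zeta>)"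
      using f C by (intro integral_scale_measure \<zeta>.finite_measure_axioms) auto
    finally show "killed_op f x \<le> C * (\<integral>y. f y \<partial>\<zeta>)" .
  next
    fix f x k assume f: "f \<in> bfun \<zeta>" "\<And>y. y \<in> space \<zeta> \<Longrightarrow> 0 \<le> f y" and xA: "x \<in> A k"
    then have x: "x \<in> space M" using A_exh by auto
    let ?D = "density \<zeta> (\<lambda>y. ennreal (indicator (A k) y))"
    have [measurable]: "A k \<in> sets \<zeta>" "f \<in> borel_measurable \<zeta>"
      using A_sets s\<zeta> bfun_measurable[OF f(1)] by auto
    have emD: "emeasure ?D B = emeasure \<zeta> (A k \<inter> B)" if [measurable]: "B \<in> sets \<zeta>" for B
    proof -
      have "emeasure ?D B = (\<integral>\<^sup>+y. indicator (A k \<inter> B) y \<partial>\<zeta>)"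
        by (subst emeasure_density, simp, rule that, rule nn_integral_cong) (auto simp: indicator_def)
      then show ?thesis by simp
    qed
    have finD: "finite_measure ?D"
      using emD[of "space \<zeta>"] by (intro finite_measureI) simp
    have fin: "finite_measure (scale_measure (ennreal (a k)) ?D)"
      using finite_measure.emeasure_finite[OF finD, of "space ?D"]
      by (intro finite_measureI) (simp add: ennreal_mult_eq_top_iff space_scale_measure)
    have "a k * (\<integral>y. indicator (A k) y * f y \<partial>\<zeta>) = a k * (\<integral>y. f y \<partial>?D)"
      by (subst integral_density) auto
    also have "\<dots> = (\<integral>y. f y \<partial>scale_measure (ennreal (a k)) ?D)"
      using f a_pos[of k]
      by (intro integral_scale_measure[symmetric] finD) (auto simp: bfun_def)
    also have "\<dots> \<le> killed_op f x"
      unfolding killed_op_def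
    proof (rule integral_le_of_emeasure_le[OF fin finite_killed_kernel[OF x]])
      show "emeasure (scale_measure (ennreal (a k)) ?D) B \<le> emeasure (killed_kernel x) B"
        if "B \<in> sets (scale_measure (ennreal (a k)) ?D)" for B
        using that P_lower[OF xA] by (simp add: emD s\<zeta> emeasure_killed_kernel[OF x])
    qed (use f in \<open>auto simp: s\<zeta> bf sp\<zeta> bfun_def space_scale_measure cong: measurable_cong_sets\<close>)
    finally show "a k * (\<integral>y. indicator (A k) y * f y \<partial>\<zeta>) \<le> killed_op f x" .
  next
    fix B x assume B: "B \<in> sets \<zeta>" "0 < \<zeta>.prob B" and "x \<in> space \<zeta>"
    then have x: "x \<in> space M" and BM: "B \<in> sets M" by (auto simp: sp\<zeta> s\<zeta>)
    have "ennreal (killed_op (indicator B) x) = emeasure (P (Some x)) (Some ` B)"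
      using BM by (subst ennreal_killed_op[OF x]) (auto simp: emeasure_killed_kernel[OF x] ennreal_indicator)
    also have "\<dots> > 0"
      using B(2) by (intro P_pos[OF x BM]) (simp add: \<zeta>.emeasure_eq_measure)
    finally show "0 < killed_op (indicator B) x" by simp
  next
    show "killed_op f \<in> bfun \<zeta>" if "f \<in> bfun \<zeta>" for f using that killed_op_bfun by (simp add: bf)
    show "positive_functional \<zeta> (\<lambda>f. killed_op f x)" if "x \<in> space \<zeta>" for x
      using that killed_op_functional by (simp add: pf sp\<zeta>)
    show "killed_op (\<lambda>_. 1) x \<le> 1" if "x \<in> space \<zeta>" for x using that killed_op_one by (simp add: sp\<zeta>)
    show "incseq A" by (rule A_inc)
    show "(\<Union>k. A k) = space \<zeta>" by (simp add: A_exh sp\<zeta>)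
    show "A k \<in> sets \<zeta>" for k using A_sets by (simp add: s\<zeta>)
    show "0 < a k" for k by (rule a_pos)
  qed
qed

end

section \<open>Quasi-stationary distributions of the chain\<close>

locale absorbed_minorized = absorbed_chain M P + minorized_operator_core \<zeta> killed_op A a C b m
  for M :: "'a measure" and P and \<zeta> :: "'a measure" and A a C b m +
  assumes sets_\<zeta>: "sets \<zeta> = sets M"
begin

lemma space_\<zeta>: "space \<zeta> = space M"
  by (rule sets_eq_imp_space_eq[OF sets_\<zeta>])

lemma bfun_\<zeta>: "bfun \<zeta> = bfun M"
  by (rule bfun_cong_sets[OF sets_\<zeta>])

lemma cond_law_profile:
  assumes "\<mu> \<in> space (prob_algebra M)" "B \<in> sets M"
  shows "cond_law M P \<mu> n B = profile (\<lambda>f. \<integral>x. f x \<partial>\<mu>) n (indicator B)"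
  using cond_law_eq[OF assms] by (simp add: profile_def surv_def)

lemma integral_functional:
  assumes "\<mu> \<in> space (prob_algebra M)"
  shows "positive_functional \<zeta> (\<lambda>f. \<integral>x. f x \<partial>\<mu>)" "0 < (\<integral>x. \<psi> x \<partial>\<mu>)"
proof -
  have "prob_space \<mu>" "sets \<mu> = sets \<zeta>" using assms by (auto simp: space_prob_algebra sets_\<zeta>)
  then show "positive_functional \<zeta> (\<lambda>f. \<integral>x. f x \<partial>\<mu>)" "0 < (\<integral>x. \<psi> x \<partial>\<mu>)"
    by (rule positive_functional_integral[OF prob_space.finite_measure], rule integral_\<psi>_pos)
qed

lemma quasi_stationary_exists: "\<exists>\<nu>. quasi_stationary M P \<nu>"
proof -
  obtain \<alpha> where \<alpha>: "prob_space \<alpha>" "sets \<alpha> = sets \<zeta>"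
    "\<forall>n. \<forall>f\<in>bfun \<zeta>. (\<integral>x. (killed_op ^^ n) f x \<partial>\<alpha>) = (\<integral>x. f x \<partial>\<alpha>) * (\<integral>x. surv n x \<partial>\<alpha>)"
    using quasi_stationary_measure_exists by (elim exE conjE)
  have p: "\<alpha> \<in> space (prob_algebra M)" using \<alpha> sets_\<zeta> by (simp add: space_prob_algebra)
  have sp: "space \<alpha> = space \<zeta>" by (rule sets_eq_imp_space_eq[OF \<alpha>(2)])
  have "cond_law M P \<alpha> n B = measure \<alpha> B" if B: "B \<in> sets M" for n B
  proof -
    have "0 < (\<integral>x. surv n x \<partial>\<alpha>)"
      by (rule functional_surv_pos[OF integral_functional[OF p]])
    moreover have "(\<integral>x. indicator B x \<partial>\<alpha>) = measure \<alpha> B"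
      using B \<alpha>(2) sets_\<zeta> by (simp add: Int_absorb1 sets.sets_into_space sp space_\<zeta>)
    ultimately show ?thesis
      using \<alpha>(3)[rule_format, of "indicator B" n] B
      by (simp add: cond_law_profile[OF p B] profile_def bfun_\<zeta> bfun_indicator)
  qed
  then show ?thesis using p by (auto simp: quasi_stationary_def)
qed

lemma cond_law_uniform_limit:
  assumes \<nu>: "quasi_stationary M P \<nu>" and \<mu>: "\<mu> \<in> space (prob_algebra M)" and \<epsilon>: "0 < \<epsilon>"
  shows "\<exists>N. \<forall>n\<ge>N. \<forall>B\<in>sets M. \<bar>cond_law M P \<mu> n B - measure \<nu> B\<bar> \<le> \<epsilon>"
proof -
  have \<nu>p: "\<nu> \<in> space (prob_algebra M)" and stat: "\<And>n B. B \<in> sets M \<Longrightarrow> cond_law M P \<nu> n B = measure \<nu> B"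
    using \<nu> by (auto simp: quasi_stationary_def)
  let ?F = "indicat_real ` sets M"
  define \<kappa> :: "('a \<Rightarrow> real) \<Rightarrow> real" where "\<kappa> f = (\<integral>x. f x \<partial>\<nu>)" for f
  have \<nu>s: "sets \<nu> = sets M" "space \<nu> = space M"
    using \<nu>p sets_eq_imp_space_eq[of \<nu> M] by (auto simp: space_prob_algebra)
  have \<kappa>: "\<kappa> (indicator B) = measure \<nu> B" if "B \<in> sets M" for B
    using that \<nu>s by (simp add: \<kappa>_def Int_absorb1 sets.sets_into_space)
  have "\<exists>N. \<forall>n\<ge>N. \<forall>f\<in>?F. \<bar>profile (\<lambda>f. \<integral>x. f x \<partial>\<mu>) n f - \<kappa> f\<bar> \<le> \<epsilon>"
  proof (rule profile_tendsto_stationary[OF integral_functional[OF \<mu>] integral_functional[OF \<nu>p] _ _ \<epsilon>])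
    show "?F \<subseteq> unit_bfun" by (auto simp: unit_bfun_def bfun_\<zeta>)
    show "profile (\<lambda>f. \<integral>x. f x \<partial>\<nu>) n f = \<kappa> f" if f: "f \<in> ?F" for n f
    proof -
      obtain B where B: "B \<in> sets M" "f = indicator B" using f by blast
      then show ?thesis using stat[OF B(1), of n] cond_law_profile[OF \<nu>p B(1), of n] \<kappa>[OF B(1)] by simp
    qed
  qed
  then obtain N where "\<forall>n\<ge>N. \<forall>f\<in>?F. \<bar>profile (\<lambda>f. \<integral>x. f x \<partial>\<mu>) n f - \<kappa> f\<bar> \<le> \<epsilon>" by (rule exE)
  then show ?thesis by (intro exI[of _ N]) (auto simp: cond_law_profile[OF \<mu>] \<kappa>)
qed

text \<open>
  A quasi-stationary distribution is its own conditioned law at every time, so another one attracts it.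
\<close>

lemma quasi_stationary_unique:
  assumes \<nu>: "quasi_stationary M P \<nu>" and \<nu>': "quasi_stationary M P \<nu>'"
  shows "\<nu> = \<nu>'"
proof -
  have p: "\<nu> \<in> space (prob_algebra M)" "\<nu>' \<in> space (prob_algebra M)"
    using assms by (auto simp: quasi_stationary_def)
  then have s: "sets \<nu> = sets M" "sets \<nu>' = sets M" and ps: "prob_space \<nu>" "prob_space \<nu>'"
    by (auto simp: space_prob_algebra)
  have eq: "measure \<nu> B = measure \<nu>' B" if B: "B \<in> sets M" for B
  proof (rule ccontr)
    assume "measure \<nu> B \<noteq> measure \<nu>' B"
    then have "0 < \<bar>measure \<nu>' B - measure \<nu> B\<bar> / 2" by simp
    from cond_law_uniform_limit[OF \<nu> p(2) this]
    obtain N where "\<forall>n\<ge>N. \<forall>C\<in>sets M. \<bar>cond_law M P \<nu>' n C - measure \<nu> C\<bar> \<le> \<bar>measure \<nu>' B - measure \<nu> B\<bar> / 2"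
      by (rule exE)
    then have "\<bar>cond_law M P \<nu>' N B - measure \<nu> B\<bar> \<le> \<bar>measure \<nu>' B - measure \<nu> B\<bar> / 2" using B by blast
    moreover have "cond_law M P \<nu>' N B = measure \<nu>' B" using \<nu>' B by (simp add: quasi_stationary_def)
    ultimately show False using \<open>measure \<nu> B \<noteq> measure \<nu>' B\<close> by simp
  qed
  interpret n: prob_space \<nu> by (rule ps)
  interpret n': prob_space \<nu>' by (rule ps)
  show ?thesis
    by (rule measure_eqI) (auto simp: s n.emeasure_eq_measure n'.emeasure_eq_measure eq)
qed

lemma attracts_all:
  assumes \<nu>: "quasi_stationary M P \<nu>"
  shows "space (prob_algebra M) \<subseteq> domain_of_attraction M P \<nu>"
proof
  fix \<mu> assume \<mu>: "\<mu> \<in> space (prob_algebra M)"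
  have "(\<lambda>n. tv_dist M (cond_law M P \<mu> n) (measure \<nu>)) \<longlonglongrightarrow> 0"
  proof (rule LIMSEQ_I)
    fix r :: real assume r: "0 < r"
    then have "0 < r / 2" by simp
    from cond_law_uniform_limit[OF \<nu> \<mu> this]
    obtain N where N: "\<forall>n\<ge>N. \<forall>B\<in>sets M. \<bar>cond_law M P \<mu> n B - measure \<nu> B\<bar> \<le> r / 2" by (rule exE)
    have "norm (tv_dist M (cond_law M P \<mu> n) (measure \<nu>) - 0) < r" if n: "N \<le> n" for n
    proof -
      have bd: "\<bar>cond_law M P \<mu> n B - measure \<nu> B\<bar> \<le> r / 2" if "B \<in> sets M" for B using N n that by blast
      have "tv_dist M (cond_law M P \<mu> n) (measure \<nu>) \<le> r / 2"
        unfolding tv_dist_def by (rule cSUP_least) (use bd in auto)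
      moreover have "0 \<le> tv_dist M (cond_law M P \<mu> n) (measure \<nu>)"
        unfolding tv_dist_def
        by (rule cSUP_upper2[where x = "{}"]) (use bd in \<open>auto intro!: bdd_aboveI[of _ "r / 2"]\<close>)
      ultimately show ?thesis using r by simp
    qed
    then show "\<exists>N. \<forall>n\<ge>N. norm (tv_dist M (cond_law M P \<mu> n) (measure \<nu>) - 0) < r" by blast
  qed
  then show "\<mu> \<in> domain_of_attraction M P \<nu>" using \<mu> by (simp add: domain_of_attraction_def)
qed

section \<open>Lyapunov functions and Harnack inequality\<close>

text \<open>
  Outside \<open>K\<close> the killing rate is so strong that \<open>\<phi>\<^sub>1 = 1\<close> decays at rate \<open>\<beta> / 2\<close>, below the rate \<open>\<beta>\<close> of the core.
  At points of \<open>K\<close> the mass surviving one step is at least \<open>\<beta> / 2\<close>, of which no more than \<open>\<beta> / 4\<close> can lie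
  outside \<open>A m\<close>. The rest, at least \<open>\<beta> / 4\<close>, is subject to the minorization on \<open>A m\<close>, which gives the constant \<open>\<gamma>\<close> for two steps.
\<close>

definition "K = {x \<in> space M. \<beta> / 2 \<le> killed_op (\<lambda>_. 1) x}"
definition "\<gamma> = (\<beta> / 4) * a m"

lemma \<gamma>_pos: "0 < \<gamma>" using \<beta>_pos a_pos by (simp add: \<gamma>_def)

lemma K_sets: "K \<in> sets M"
proof -
  have [measurable]: "killed_op (\<lambda>_. 1) \<in> borel_measurable M" by (intro bfun_measurable killed_op_bfun bfun_const)
  show ?thesis unfolding K_def by measurable
qed

lemma K_sub: "x \<in> K \<Longrightarrow> x \<in> space M" by (simp add: K_def)

lemma core_sub_K: "A b \<subseteq> K"
proof
  fix x assume x: "x \<in> A b"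
  have xs: "x \<in> space \<zeta>" by (rule A_sub[OF x])
  have "\<beta> \<le> \<psi> x" using \<psi>_ge_\<beta>[OF xs] x by simp
  also have "\<dots> \<le> killed_op (\<lambda>_. 1) x"
    unfolding \<psi>_def by (rule T_mono) (auto simp: indicator_le_1 xs)
  finally show "x \<in> K" using \<beta>_pos xs by (simp add: K_def space_\<zeta>)
qed

lemma K_two_steps:
  assumes x: "x \<in> K" and f: "f \<in> bfun \<zeta>" "\<And>y. y \<in> space \<zeta> \<Longrightarrow> 0 \<le> f y"
  shows "\<gamma> * (\<integral>y. indicator (A m) y * f y \<partial>\<zeta>) \<le> killed_op (killed_op f) x"
proof -
  have xs: "x \<in> space \<zeta>" using x by (simp add: K_def space_\<zeta>)
  note Tx = T_functional[OF xs]
  let ?q = "\<integral>y. indicator (A m) y * f y \<partial>\<zeta>"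
  have q: "0 \<le> ?q" by (rule positive_functional_nonneg[OF expectation_functional ind_A_mult(1)[OF f(1)]])
    (simp add: ind_mult_nonneg f(2))
  have "killed_op (\<lambda>y. indicator (space \<zeta> - A m) y * 1) x \<le> C * (\<integral>y. indicator (space \<zeta> - A m) y * 1 \<partial>\<zeta>)"
    by (rule T_upper) (auto simp: xs)
  also have "\<dots> \<le> C * (1 * prob (space \<zeta> - A m))"
    using C_pos by (intro mult_left_mono upper_outside) auto
  also have "\<dots> \<le> \<beta> / 4" using outer_small by (simp add: \<beta>_def)
  finally have out: "killed_op (\<lambda>y. indicator (space \<zeta> - A m) y * 1) x \<le> \<beta> / 4" .
  have "killed_op (\<lambda>_. 1) x = killed_op (\<lambda>y. indicator (A m) y * 1) x + killed_op (\<lambda>y. indicator (space \<zeta> - A m) y * 1) x"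
    by (rule positive_functional_split[OF Tx]) (auto simp: A_sets)
  with out x have "\<beta> / 4 \<le> killed_op (indicator (A m)) x" by (simp add: K_def)
  then have "(\<beta> / 4) * (a m * ?q) \<le> killed_op (indicator (A m)) x * (a m * ?q)"
    using q a_pos[of m] by (intro mult_right_mono) auto
  also have "\<dots> = killed_op (\<lambda>y. (a m * ?q) * indicator (A m) y) x"
    using T_cmult[OF ind_bfun(1) xs, of "a m * ?q" m] by simp
  also have "\<dots> \<le> killed_op (killed_op f) x"
  proof (intro T_mono bfun_cmult ind_bfun T_bfun f(1) xs)
    fix y assume y: "y \<in> space \<zeta>"
    show "(a m * ?q) * indicator (A m) y \<le> killed_op f y"
      using T_minor[OF f, of y m] T_nonneg[OF f y] by (cases "y \<in> A m") auto
  qed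
  finally show ?thesis by (simp add: \<gamma>_def)
qed

lemma K_two_steps_core:
  assumes x: "x \<in> K" and B: "B \<in> sets M"
  shows "\<gamma> * prob (B \<inter> A b) \<le> killed_op (killed_op (indicator B)) x"
proof -
  have "prob (B \<inter> A b) = (\<integral>y. indicator (B \<inter> A b) y \<partial>\<zeta>)"
    using B A_sets[of b] sets_\<zeta> by (simp add: Int_absorb1 sets.sets_into_space le_infI2)
  also have "\<dots> \<le> (\<integral>y. indicator (A m) y * indicator B y \<partial>\<zeta>)"
    using B A_sets A_b_sub_m sets_\<zeta>
    by (intro positive_functional_mono[OF expectation_functional] bfun_mult bfun_indicator)
       (auto simp: indicator_def)
  finally have "\<gamma> * prob (B \<inter> A b) \<le> \<gamma> * (\<integral>y. indicator (A m) y * indicator B y \<partial>\<zeta>)"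
    using \<gamma>_pos by simp
  also have "\<dots> \<le> killed_op (killed_op (indicator B)) x"
    using B by (intro K_two_steps[OF x]) (auto simp: bfun_\<zeta>)
  finally show ?thesis .
qed

text \<open>
  \<open>\<psi>\<close> may be arbitrarily small on \<open>K\<close>, where one step can lead to \<open>A m\<close> with hardly any mass in the core. One
  more step repairs this by \<open>K_two_steps\<close>.
\<close>

definition "\<phi> = killed_op \<psi>"

lemma \<phi>_bfun: "\<phi> \<in> bfun M" unfolding \<phi>_def using \<psi>_bfun by (intro killed_op_bfun) (simp add: bfun_\<zeta>)

lemma \<phi>_pos: "x \<in> space M \<Longrightarrow> 0 < \<phi> x"
proof -
  assume x: "x \<in> space M"
  then have "0 < \<beta> * \<psi> x" using \<beta>_pos \<psi>_pos[of x] by (simp add: space_\<zeta>)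
  also have "\<dots> \<le> \<phi> x" unfolding \<phi>_def using x by (intro T_\<psi>_ge) (simp add: space_\<zeta>)
  finally show ?thesis .
qed

lemma \<phi>_le_1: "x \<in> space M \<Longrightarrow> \<phi> x \<le> 1"
  unfolding \<phi>_def
  by (rule order_trans[OF T_mono T_one]) (auto simp: \<psi>_le_1 space_\<zeta>)

lemma \<phi>_growth: "x \<in> space M \<Longrightarrow> \<beta> * \<phi> x \<le> killed_op \<phi> x"
  using \<psi>_growth[OF T_functional, of x] by (simp add: space_\<zeta> \<phi>_def)

lemma \<phi>_lower_K: "x \<in> K \<Longrightarrow> \<gamma> * prob (A b) \<le> \<phi> x"
  using K_two_steps_core[of x "A b"] A_sets[of b] by (simp add: \<phi>_def \<psi>_def sets_\<zeta>)

text \<open>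
  Two steps from \<open>K\<close> dominate a multiple of \<open>\<zeta>\<close> on \<open>A m\<close>, so \<open>\<nu>\<close> may be \<open>\<zeta>\<close> conditioned on the core.
\<close>

lemma assumption_E1_holds:
  "assumption_E1 M P 2 (\<gamma> * prob (A b)) (restrict_space (uniform_measure \<zeta> (A b)) K) K"
  unfolding assumption_E1_def
proof (intro ballI)
  fix x B assume x: "x \<in> K" and B: "B \<in> sets M"
  have BK: "B \<inter> K \<in> sets \<zeta>" using B K_sets sets_\<zeta> by auto
  have "emeasure (restrict_space (uniform_measure \<zeta> (A b)) K) (B \<inter> K) = emeasure (uniform_measure \<zeta> (A b)) (B \<inter> K)"
    using K_sets sets.sets_into_space[OF K_sets]
    by (intro emeasure_restrict_space) (auto simp: sets_\<zeta> space_\<zeta> Int_absorb2)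
  also have "\<dots> = emeasure \<zeta> (A b \<inter> (B \<inter> K)) / emeasure \<zeta> (A b)"
    by (rule emeasure_uniform_measure) (use A_sets BK in auto)
  also have "A b \<inter> (B \<inter> K) = B \<inter> A b" using core_sub_K by auto
  also have "emeasure \<zeta> (B \<inter> A b) / emeasure \<zeta> (A b) = ennreal (prob (B \<inter> A b) / prob (A b))"
    using core_pos by (simp add: emeasure_eq_measure divide_ennreal)
  finally have "ennreal (\<gamma> * prob (A b)) * emeasure (restrict_space (uniform_measure \<zeta> (A b)) K) (B \<inter> K)
      = ennreal (\<gamma> * prob (B \<inter> A b))"
    using core_pos \<gamma>_pos by (simp add: ennreal_mult'[symmetric])
  also have "\<dots> \<le> hit_prob M P x 2 B"
    using K_two_steps_core[OF x B] by (simp add: hit_prob_eq[OF K_sub[OF x] B] numeral_2_eq_2 ennreal_leI)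
  finally show "ennreal (\<gamma> * prob (A b)) * emeasure (restrict_space (uniform_measure \<zeta> (A b)) K) (B \<inter> K)
      \<le> hit_prob M P x 2 B" .
qed

lemma core_measure_prob: "restrict_space (uniform_measure \<zeta> (A b)) K \<in> space (prob_algebra (restrict_space M K))"
proof -
  have "prob_space (uniform_measure \<zeta> (A b))"
    using core_pos by (intro prob_space_uniform_measure) (auto simp: emeasure_eq_measure)
  have K: "K \<subseteq> space M" "K \<in> sets \<zeta>" using K_sets sets.sets_into_space sets_\<zeta> by auto
  have e: "emeasure (uniform_measure \<zeta> (A b)) K = emeasure \<zeta> (A b \<inter> K) / emeasure \<zeta> (A b)"
    by (rule emeasure_uniform_measure) (use A_sets K in auto)
  have "A b \<inter> K = A b" using core_sub_K by auto
  then have "emeasure (uniform_measure \<zeta> (A b)) K = 1"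
    unfolding e using core_pos by (simp add: emeasure_eq_measure divide_ennreal)
  then have "prob_space (restrict_space (uniform_measure \<zeta> (A b)) K)"
    using K by (intro prob_space_restrict_space) auto
  then show ?thesis
    by (simp add: space_prob_algebra sets_restrict_space sets_\<zeta>)
qed

lemma assumption_E2_holds: "assumption_E2 M P (\<beta> / 2) \<beta> 1 (\<lambda>_. 1) \<phi> K"
  unfolding assumption_E2_def
proof (intro conjI ballI)
  show "\<beta> / 2 < \<beta>" using \<beta>_pos by simp
  show "1 \<le> (INF x\<in>space M. ennreal 1)" by (rule INF_greatest) simp
  show "(SUP x\<in>K. ennreal 1) < \<infinity>" by (rule le_less_trans[of _ 1]) (auto intro: SUP_least)
  have "0 < ennreal (\<gamma> * prob (A b))" using \<gamma>_pos core_pos by simp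
  also have "\<dots> \<le> (INF x\<in>K. ennreal (\<phi> x))" using \<phi>_lower_K by (intro INF_greatest ennreal_leI) auto
  finally show "0 < (INF x\<in>K. ennreal (\<phi> x))" .
  show "(SUP x\<in>space M. ennreal (\<phi> x)) \<le> 1" using \<phi>_le_1 by (intro SUP_least) simp
  fix x assume x: "x \<in> space M"
  have "P1_op M P (\<lambda>_. 1) x = ennreal (killed_op (\<lambda>_. 1) x)" by (rule P1_op_eq[OF x]) auto
  also have "\<dots> \<le> ennreal (\<beta> / 2 * 1) + ennreal 1 * indicator K x"
  proof (cases "x \<in> K")
    case True
    have "ennreal (killed_op (\<lambda>_. 1) x) \<le> 1" using killed_op_one[OF x] by simp
    then show ?thesis using True by (simp add: add_increasing)
  next
    case False
    then show ?thesis using x by (auto simp: K_def intro!: ennreal_leI)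
  qed
  finally show "P1_op M P (\<lambda>_. 1) x \<le> ennreal (\<beta> / 2 * 1) + ennreal 1 * indicator K x" .
  show "ennreal (\<beta> * \<phi> x) \<le> P1_op M P \<phi> x"
    using P1_op_eq[OF x \<phi>_bfun] \<phi>_pos \<phi>_growth[OF x] by (simp add: less_imp_le ennreal_leI)
qed

text \<open>
  For \<open>n = k + 1\<close> all survival probabilities are at most \<open>C\<close> times the average survival to time \<open>k\<close>. On \<open>K\<close>, two
  steps of minorization and \<open>core_mass_surv\<close> bound the survival to time \<open>n + 2\<close>, hence that to time \<open>n\<close>, from
  below by a multiple of the same average.
\<close>

lemma assumption_E3_holds: "assumption_E3 M P (max 1 (C * D / \<gamma>)) K"
  unfolding assumption_E3_def
proof (rule SUP_least)
  fix n :: nat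
  obtain x0 where x0: "x0 \<in> A b" using core_pos by fastforce
  then have x0K: "x0 \<in> K" using core_sub_K by auto
  let ?s = "\<lambda>y. survival_prob M P y n"
  have s: "?s y = ennreal (surv n y)" if "y \<in> K" for y
    using survival_prob_eq[OF K_sub[OF that], of n] by (simp add: surv_def)
  have main: "\<exists>u v. 0 < v \<and> (\<forall>y\<in>K. surv n y \<le> u) \<and> (\<forall>y\<in>K. v \<le> surv n y) \<and> u / v \<le> max 1 (C * D / \<gamma>)"
  proof (cases n)
    case 0
    then show ?thesis by (intro exI[of _ 1]) auto
  next
    case (Suc k)
    define z where "z = (\<integral>x. surv k x \<partial>\<zeta>)"
    have z: "0 < z" unfolding z_def
      by (rule functional_surv_pos[OF expectation_functional integral_\<psi>_pos[OF prob_space_axioms refl]])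
    have up: "surv n y \<le> C * z" if "y \<in> K" for y
      unfolding Suc z_def using K_sub[OF that] by (intro surv_Suc_upper) (simp add: space_\<zeta>)
    have low: "(\<gamma> / D) * z \<le> surv n y" if y: "y \<in> K" for y
    proof -
      have ys: "y \<in> space \<zeta>" using K_sub[OF y] by (simp add: space_\<zeta>)
      define Y where "Y = (\<integral>x. indicator (A m) x * surv n x \<partial>\<zeta>)"
      have "(\<integral>x. indicator (A b) x * surv n x \<partial>\<zeta>) \<le> Y"
        unfolding Y_def using A_b_sub_m
        by (intro positive_functional_mono[OF expectation_functional] ind_A_mult surv_bfun)
           (auto intro!: mult_right_mono surv_nonneg simp: indicator_def)
      moreover have "z \<le> D * (\<integral>x. indicator (A b) x * surv n x \<partial>\<zeta>)"
        unfolding z_def Suc by (rule core_mass_surv)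
      ultimately have "z \<le> D * Y" using D_pos by (meson mult_left_mono less_imp_le order_trans)
      then have "(\<gamma> / D) * z \<le> \<gamma> * Y"
        using mult_left_mono[of z "D * Y" "\<gamma> / D"] \<gamma>_pos D_pos by simp
      moreover have "\<gamma> * Y \<le> killed_op (killed_op (surv n)) y"
        unfolding Y_def by (rule K_two_steps[OF y]) (auto intro: surv_nonneg)
      moreover have "killed_op (killed_op (surv n)) y \<le> surv n y"
        unfolding surv_Suc[symmetric] by (rule surv_antimono) (auto simp: ys)
      ultimately show ?thesis by linarith
    qed
    have "C * z / ((\<gamma> / D) * z) = C * D / \<gamma>" using z \<gamma>_pos D_pos by simp
    then have "C * z / ((\<gamma> / D) * z) \<le> max 1 (C * D / \<gamma>)" by simp
    moreover have "0 < (\<gamma> / D) * z" using z \<gamma>_pos D_pos by simp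
    ultimately show ?thesis
      using up low by (intro exI[of _ "C * z"] exI[of _ "(\<gamma> / D) * z"] conjI ballI)
  qed
  then obtain u v where uv: "0 < v" "\<forall>y\<in>K. surv n y \<le> u" "\<forall>y\<in>K. v \<le> surv n y" "u / v \<le> max 1 (C * D / \<gamma>)"
    by (elim exE conjE)
  have u: "0 \<le> u" using bspec[OF uv(2) x0K] bspec[OF uv(3) x0K] uv(1) by linarith
  have "(SUP y\<in>K. ?s y) \<le> ennreal u" using uv(2) by (intro SUP_least) (auto simp: s ennreal_leI)
  moreover have "ennreal v \<le> (INF y\<in>K. ?s y)" using uv(3) by (intro INF_greatest) (auto simp: s ennreal_leI)
  moreover have "ennreal u = ennreal v * ennreal (u / v)"
    using uv(1) u by (simp add: ennreal_mult[symmetric])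
  ultimately have "(SUP y\<in>K. ?s y) \<le> (INF y\<in>K. ?s y) * ennreal (u / v)"
    by (metis mult_right_mono order_trans zero_le)
  moreover have "0 < (INF y\<in>K. ?s y)"
    using uv(1) by (intro less_le_trans[OF _ \<open>ennreal v \<le> (INF y\<in>K. ?s y)\<close>]) simp
  ultimately have "(SUP y\<in>K. ?s y) / (INF y\<in>K. ?s y) \<le> ennreal (u / v)"
    by (intro divide_le_posI_ennreal)
  also have "\<dots> \<le> ennreal (max 1 (C * D / \<gamma>))" using uv(4) by (rule ennreal_leI)
  finally show "(SUP y\<in>K. ?s y) / (INF y\<in>K. ?s y) \<le> ennreal (max 1 (C * D / \<gamma>))" .
qed

lemma assumption_E4_holds: "assumption_E4 M P K"
  unfolding assumption_E4_def
proof (intro ballI exI[of _ 1] allI impI)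
  fix x and n :: nat assume x: "x \<in> K" and "1 \<le> n"
  then obtain k where n: "n = Suc k" by (cases n) auto
  have xs: "x \<in> space \<zeta>" using K_sub[OF x] by (simp add: space_\<zeta>)
  have "0 < \<beta> ^ k * \<psi> x" using \<beta>_pos \<psi>_pos[OF xs] by simp
  also have "\<dots> \<le> (killed_op ^^ k) \<psi> x" using \<psi>_growth_iter[OF iter_functional[OF xs, of 0], of k] by simp
  also have "\<dots> = (killed_op ^^ n) (indicator (A b)) x" by (simp add: n \<psi>_def funpow_swap1)
  also have "\<dots> \<le> (killed_op ^^ n) (indicator K) x"
    using core_sub_K K_sets sets_\<zeta> by (intro iter_mono[OF _ _ _ xs]) (auto simp: indicator_def intro: bfun_indicator)
  finally show "0 < hit_prob M P x n K" by (simp add: hit_prob_eq[OF K_sub[OF x] K_sets])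
qed

lemma assumption_E_holds: "assumption_E M P (\<lambda>_. 1) \<phi>"
proof -
  let ?\<nu> = "restrict_space (uniform_measure \<zeta> (A b)) K"
  have "0 < (2::nat) \<and> 0 < \<beta> / 2 \<and> 0 < \<beta> \<and> 0 < \<gamma> * prob (A b) \<and> 0 < (1::real) \<and> 0 < max 1 (C * D / \<gamma>) \<and>
      K \<in> sets M \<and> ?\<nu> \<in> space (prob_algebra (restrict_space M K)) \<and>
      assumption_E1 M P 2 (\<gamma> * prob (A b)) ?\<nu> K \<and> assumption_E2 M P (\<beta> / 2) \<beta> 1 (\<lambda>_. 1) \<phi> K \<and>
      assumption_E3 M P (max 1 (C * D / \<gamma>)) K \<and> assumption_E4 M P K"
    using \<beta>_pos \<gamma>_pos core_pos K_sets core_measure_prob assumption_E1_holds assumption_E2_holds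
      assumption_E3_holds assumption_E4_holds by simp
  moreover have "\<phi> \<in> borel_measurable M" "\<forall>x\<in>space M. 0 \<le> \<phi> x"
    using bfun_measurable[OF \<phi>_bfun] \<phi>_pos by (auto intro: less_imp_le)
  ultimately show ?thesis
    unfolding assumption_E_def by (intro conjI) (simp, simp, assumption, assumption, blast)
qed

end

section \<open>Kernels with bounded density ratio\<close>

theorem theorem7p1:
  fixes M :: "'a measure"
    and Q P :: "'a option \<Rightarrow> 'a option measure"
    and \<zeta> :: "'a measure"
    and g :: "'a \<Rightarrow> real"
    and C :: real
    and p :: "'a \<Rightarrow> 'a \<Rightarrow> real"
    and L :: "nat \<Rightarrow> 'a set"
  assumes Q_kernel: "Q \<in> with_cemetery M \<rightarrow>\<^sub>M prob_algebra (with_cemetery M)"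
    and Q_absorbed: "emeasure (Q None) {None} = 1"
    and \<zeta>: "\<zeta> \<in> space (prob_algebra M)"
    and g_pos: "\<And>y. y \<in> space M \<Longrightarrow> 0 < g y"
    and C: "1 < C"
    and Q_bounds: "\<And>y A. y \<in> space M \<Longrightarrow> A \<in> sets M \<Longrightarrow>
           ennreal (g y) * emeasure \<zeta> A \<le> emeasure (Q (Some y)) (Some ` A) \<and>
           emeasure (Q (Some y)) (Some ` A) \<le> ennreal (C * g y) * emeasure \<zeta> A"
    and p_measurable: "(\<lambda>(x, y). p x y) \<in> borel_measurable (M \<Otimes>\<^sub>M M)"
    and p_range: "\<And>x y. x \<in> space M \<Longrightarrow> y \<in> space M \<Longrightarrow> 0 < p x y \<and> p x y \<le> 1"
    and P_kernel: "P \<in> with_cemetery M \<rightarrow>\<^sub>M prob_algebra (with_cemetery M)"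
    and P_E: "\<And>x A. x \<in> space M \<Longrightarrow> A \<in> sets M \<Longrightarrow>
           emeasure (P (Some x)) (Some ` A) = (\<integral>\<^sup>+z\<in>Some ` A. ennreal (p x (the z)) \<partial>Q (Some x))"
    and P_cemetery: "\<And>x. x \<in> space M \<Longrightarrow>
           emeasure (P (Some x)) {None} = 1 - emeasure (P (Some x)) (Some ` space M)"
    and P_absorbed: "P None = return (with_cemetery M) None"
    and L_measurable: "\<And>k. 1 \<le> k \<Longrightarrow> L k \<in> sets M"
    and L_increasing: "\<And>k. 1 \<le> k \<Longrightarrow> L k \<subseteq> L (Suc k)"
    and L_exhausts: "space M = (\<Union>k\<in>{1..}. L k)"
    and p_lower: "\<And>k. 1 \<le> k \<Longrightarrow> 0 < (INF (x, y)\<in>L k \<times> L k. ennreal (p x y))"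
  shows "(\<exists>\<phi>2. assumption_E M P (\<lambda>_. 1) \<phi>2 \<and> (\<forall>x\<in>space M. 0 < \<phi>2 x)) \<and>
         (\<exists>!\<nu>. quasi_stationary M P \<nu>) \<and>
         (\<forall>\<nu>. quasi_stationary M P \<nu> \<longrightarrow>
            space (prob_algebra M) \<subseteq> domain_of_attraction M P \<nu>)"
proof -
  interpret absorbed_chain M P
    by unfold_locales (fact P_kernel, fact P_absorbed)
  interpret \<zeta>: prob_space \<zeta> using \<zeta> by (simp add: space_prob_algebra)
  have s\<zeta>: "sets \<zeta> = sets M" using \<zeta> by (simp add: space_prob_algebra)
  have sp\<zeta>: "space \<zeta> = space M" by (rule sets_eq_imp_space_eq[OF s\<zeta>])
  have Q_sets: "sets (Q (Some x)) = sets S" and Q_prob: "prob_space (Q (Some x))" if "x \<in> space M" for x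
    using measurable_space[OF Q_kernel, of "Some x"] that by (auto simp: space_with_cemetery space_prob_algebra)
  have SomeS: "Some ` B \<in> sets S" if "B \<in> sets M" for B by (rule Some_image_sets_with_cemetery[OF that])
  define G where "G x = measure (Q (Some x)) (Some ` space M)" for x
  have emG: "emeasure (Q (Some x)) (Some ` space M) = ennreal (G x)" if "x \<in> space M" for x
    unfolding G_def by (rule finite_measure.emeasure_eq_measure[OF prob_space.finite_measure[OF Q_prob[OF that]]])
  have G_meas[measurable]: "G \<in> borel_measurable M"
    unfolding G_def
    by (rule measurable_compose[OF measurable_compose[OF Some_measurable_with_cemetery measurable_prob_algebraD[OF Q_kernel]]
          measurable_measure_subprob_algebra[OF SomeS[OF sets.top]]])
  have \<zeta>1: "emeasure \<zeta> (space M) = 1" using \<zeta>.emeasure_space_1 by (simp add: sp\<zeta>)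
  have gG: "g x \<le> G x" "G x \<le> C * g x" if x: "x \<in> space M" for x
    using Q_bounds[OF x sets.top] emG[OF x] \<zeta>1 g_pos[OF x] C
    by (auto simp: G_def)
  have G_le1: "G x \<le> 1" if x: "x \<in> space M" for x
    unfolding G_def using prob_space.prob_le_1[OF Q_prob[OF x]] .
  have G_pos: "0 < G x" if x: "x \<in> space M" for x using gG(1)[OF x] g_pos[OF x] by simp
  have P_le_Q: "emeasure (P (Some x)) (Some ` B) \<le> emeasure (Q (Some x)) (Some ` B)"
    if x: "x \<in> space M" and B: "B \<in> sets M" for x B
  proof -
    have "emeasure (P (Some x)) (Some ` B) \<le> (\<integral>\<^sup>+z. indicator (Some ` B) z \<partial>Q (Some x))"
      unfolding P_E[OF x B]
      using p_range[OF x] sets.sets_into_space[OF B]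
      by (intro nn_integral_mono) (auto simp: indicator_def)
    also have "\<dots> = emeasure (Q (Some x)) (Some ` B)" using SomeS[OF B] Q_sets[OF x] by simp
    finally show ?thesis .
  qed
  have P_upper: "emeasure (P (Some x)) (Some ` B) \<le> ennreal C * emeasure \<zeta> B"
    if x: "x \<in> space M" and B: "B \<in> sets M" for x B
  proof -
    have "emeasure (P (Some x)) (Some ` B) \<le> ennreal (C * g x) * emeasure \<zeta> B"
      using P_le_Q[OF x B] Q_bounds[OF x B] by (auto intro: order_trans)
    also have "\<dots> \<le> ennreal C * emeasure \<zeta> B"
      using gG(1)[OF x] G_le1[OF x] C by (intro mult_right_mono ennreal_leI) (auto simp: mult_left_le)
    finally show ?thesis .
  qed
  have P_pos: "0 < emeasure (P (Some x)) (Some ` B)"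
    if x: "x \<in> space M" and B: "B \<in> sets M" and pos: "0 < emeasure \<zeta> B" for x B
  proof -
    have m: "(\<lambda>z. ennreal (p x (the z)) * indicator (Some ` B) z) \<in> borel_measurable (Q (Some x))"
    proof -
      have px: "p x \<in> borel_measurable M"
        using measurable_compose[OF measurable_Pair1'[OF x] p_measurable] by simp
      note [measurable] = extend_measurable[OF px] SomeS[OF B]
      have "(\<lambda>z. ennreal (extend (p x) z) * indicator (Some ` B) z) \<in> borel_measurable (Q (Some x))"
        unfolding measurable_cong_sets[OF Q_sets[OF x] refl] by measurable
      moreover have "(\<lambda>z. ennreal (extend (p x) z) * indicator (Some ` B) z) =
          (\<lambda>z. ennreal (p x (the z)) * indicator (Some ` B) z)"
        by (auto simp: indicator_def extend_def split: option.splits)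
      ultimately show ?thesis by simp
    qed
    have "emeasure (P (Some x)) (Some ` B) \<noteq> 0"
    proof
      assume "emeasure (P (Some x)) (Some ` B) = 0"
      then have "AE z in Q (Some x). ennreal (p x (the z)) * indicator (Some ` B) z = 0"
        unfolding P_E[OF x B] by (subst (asm) nn_integral_0_iff_AE[OF m]) simp
      then have "AE z in Q (Some x). z \<notin> Some ` B"
      proof eventually_elim
        case (elim z)
        show ?case
        proof
          assume "z \<in> Some ` B"
          then obtain y where y: "y \<in> B" "z = Some y" by auto
          then have "0 < p x y" using p_range[OF x] sets.sets_into_space[OF B] by auto
          then show False using elim y by (auto simp: indicator_def ennreal_eq_0_iff)
        qed
      qed
      then have "emeasure (Q (Some x)) (Some ` B) = 0"
        using AE_iff_null_sets[of "Some ` B" "Q (Some x)"] SomeS[OF B] Q_sets[OF x] by auto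
      then have "ennreal (g x) * emeasure \<zeta> B = 0" using Q_bounds[OF x B] by simp
      then show False using pos g_pos[OF x] by simp
    qed
    then show ?thesis by (simp add: zero_less_iff_neq_zero)
  qed
  have "\<exists>r>0. \<forall>x\<in>L (Suc k). \<forall>y\<in>L (Suc k). r \<le> p x y" for k
  proof -
    let ?I = "INF (x, y)\<in>L (Suc k) \<times> L (Suc k). ennreal (p x y)"
    \<comment> \<open>The infimum is \<open>\<infinity>\<close> when \<open>L (Suc k)\<close> is empty.\<close>
    define q where "q = enn2real (min 1 ?I)"
    have fin: "min 1 ?I < top" by (simp add: min_less_iff_disj)
    have "0 < min 1 ?I" using p_lower[of "Suc k"] by simp
    then have "0 < q" using fin by (simp add: q_def enn2real_positive_iff)
    moreover have "q \<le> p x y" if xy: "x \<in> L (Suc k)" "y \<in> L (Suc k)" for x y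
    proof -
      have "ennreal q = min 1 ?I" using fin by (simp add: q_def)
      also have "\<dots> \<le> ?I" by simp
      also have "\<dots> \<le> ennreal (p x y)" using xy by (intro INF_lower2[of "(x, y)"]) auto
      finally have "ennreal q \<le> ennreal (p x y)" .
      moreover have "x \<in> space M" "y \<in> space M" using xy L_exhausts by auto
      then have "0 < p x y" using p_range by blast
      ultimately show ?thesis by simp
    qed
    ultimately show ?thesis by blast
  qed
  then obtain r where r: "\<And>k. 0 < r k" "\<And>k x y. x \<in> L (Suc k) \<Longrightarrow> y \<in> L (Suc k) \<Longrightarrow> r k \<le> p x y" by metis
  \<comment> \<open>\<open>g\<close> need not be measurable, but \<open>G\<close> is, and the two are comparable.\<close>
  define A where "A k = L (Suc k) \<inter> {x \<in> space M. 1 / real (Suc k) \<le> G x}" for k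
  define a where "a k = r k / (C * real (Suc k))" for k
  have A_sets: "A k \<in> sets M" for k
    unfolding A_def using L_measurable[of "Suc k"] by (intro sets.Int) (auto, measurable)
  have P_lower: "ennreal (a k) * emeasure \<zeta> (A k \<inter> B) \<le> emeasure (P (Some x)) (Some ` B)"
    if x: "x \<in> A k" and B: "B \<in> sets M" for x B k
  proof -
    have xM: "x \<in> space M" and xL: "x \<in> L (Suc k)" and xG: "1 / real (Suc k) \<le> G x"
      using x by (auto simp: A_def)
    have AB: "A k \<inter> B \<in> sets M" using A_sets[of k] B by auto
    have "a k = r k / C * (1 / real (Suc k))" by (simp add: a_def)
    also have "\<dots> \<le> r k / C * (C * g x)"
      using xG gG(2)[OF xM] r(1)[of k] C by (intro mult_left_mono) auto
    also have "\<dots> = r k * g x" using C by simp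
    finally have "ennreal (a k) * emeasure \<zeta> (A k \<inter> B) \<le> ennreal (r k * g x) * emeasure \<zeta> (A k \<inter> B)"
      by (intro mult_right_mono ennreal_leI) auto
    also have "\<dots> = ennreal (r k) * (ennreal (g x) * emeasure \<zeta> (A k \<inter> B))"
      using r(1)[of k] g_pos[OF xM] by (simp add: ennreal_mult mult.assoc)
    also have "\<dots> \<le> ennreal (r k) * emeasure (Q (Some x)) (Some ` (A k \<inter> B))"
      using Q_bounds[OF xM AB] by (intro mult_left_mono) auto
    also have "\<dots> = (\<integral>\<^sup>+z. ennreal (r k) * indicator (Some ` (A k \<inter> B)) z \<partial>Q (Some x))"
      using SomeS[OF AB] Q_sets[OF xM] by (simp add: nn_integral_cmult_indicator)
    also have "\<dots> \<le> emeasure (P (Some x)) (Some ` B)"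
      unfolding P_E[OF xM B] using r(2)[OF xL]
      by (intro nn_integral_mono) (auto simp: indicator_def A_def intro!: ennreal_leI)
    finally show ?thesis .
  qed
  have mono: "L (Suc i) \<subseteq> L (Suc j)" if "i \<le> j" for i j
    using L_increasing by (intro lift_Suc_mono_le[of "\<lambda>i. L (Suc i)", OF _ that]) auto
  have inv: "1 / real (Suc j) \<le> 1 / real (Suc i)" if "i \<le> j" for i j
    using that by (intro divide_left_mono) auto
  have A_inc: "incseq A"
    unfolding incseq_def A_def using mono inv by (blast intro: order_trans)
  have A_exh: "(\<Union>k. A k) = space M"
  proof (intro equalityI subsetI)
    fix x assume x: "x \<in> space M"
    then obtain i where i: "1 \<le> i" "x \<in> L i" using L_exhausts by auto
    obtain j where j: "inverse (real (Suc j)) < G x" using reals_Archimedean[OF G_pos[OF x]] by blast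
    have "x \<in> L (Suc (max (i - 1) j))" using mono[of "i - 1" "max (i - 1) j"] i by auto
    moreover have "1 / real (Suc (max (i - 1) j)) \<le> G x"
      using inv[of j "max (i - 1) j"] j by (simp add: inverse_eq_divide)
    ultimately show "x \<in> (\<Union>k. A k)" using x by (auto simp: A_def)
  qed (auto simp: A_def)
  have a_pos: "0 < a k" for k using r(1)[of k] C by (simp add: a_def)
  interpret minorized_operator \<zeta> killed_op A a C
    using \<zeta>.prob_space_axioms s\<zeta> C P_upper A_sets A_inc A_exh a_pos P_lower P_pos
    by (rule minorized_operatorI) auto
  have "\<forall>\<^sub>F k in sequentially. 0 < \<zeta>.prob (A k)"
    using prob_A_tendsto by (rule order_tendstoD) simp
  then obtain b where b: "0 < \<zeta>.prob (A b)" by (auto simp: eventually_sequentially)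
  obtain m where m: "b \<le> m" "4 * C * \<zeta>.prob (space \<zeta> - A m) \<le> a b * \<zeta>.prob (A b)"
  proof -
    have "0 < a b * \<zeta>.prob (A b) / (4 * C)" using b a_pos[of b] C by simp
    from eventually_conj[OF prob_compl_A_eventually_less[OF this] eventually_ge_at_top[of b]]
    obtain m where m: "\<zeta>.prob (space \<zeta> - A m) < a b * \<zeta>.prob (A b) / (4 * C)" "b \<le> m"
      by (auto simp: eventually_sequentially)
    have "\<zeta>.prob (space \<zeta> - A m) * (4 * C) < a b * \<zeta>.prob (A b)"
      using m(1) C by (subst pos_less_divide_eq[symmetric]) auto
    then show ?thesis using m(2) by (intro that[of m]) (simp_all add: mult.commute)
  qed
  interpret absorbed_minorized M P \<zeta> A a C b m
    by unfold_locales (use b m s\<zeta> in auto)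
  show ?thesis
    using assumption_E_holds \<phi>_pos quasi_stationary_exists quasi_stationary_unique attracts_all
    by blast
qed

end
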